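(* Let $U_*(z)=\frac{1}{\sqrt2}\big(|z|-\frac{\pi}{2}\big)$ for $z\in[-\pi,\pi]$, extended $2\pi$-periodically, and $c_*=\pi^2/8$, so that $c_*-U_*(z)^2=\frac12|z|(\pi-|z|)$ on $[-\pi,\pi]$. Consider the operator $A:\mathrm{dom}(A)\subset\dot L^2_{\rm per}\to\dot L^2_{\rm per}$, $$(Av)(z)=\partial_z\big[(c_*-U_*(z)^2)v(z)\big]+(\partial_z^{-1}v)(z),\quad z\in(-\pi,\pi),$$ with maximal domain $\mathrm{dom}(A)=\{v\in\dot L^2_{\rm per}:\ \partial_z[(c_*-U_*^2)v]\in\dot L^2_{\rm per}\}$. Then $$\sigma(A)=\Big\{\lambda\in\mathbb{C}:\ -\tfrac{\pi}{4}\le \mathrm{Re}(\lambda)\le\tfrac{\pi}{4}\Big\}.$$ In particular the peaked wave $U_*$ of the reduced modified Ostrovsky equation $u_t+u^2u_x=\partial_x^{-1}u$ is spectrally unstable.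
   Context: $\dot L^2_{\rm per}$ denotes the Hilbert space of $2\pi$-periodic functions in $L^2(-\pi,\pi)$ (complex-valued) with zero mean. $\partial_z^{-1}:\dot L^2_{\rm per}\to\dot L^2_{\rm per}$ denotes the antiderivative with zero mean. Derivatives are distributional on $(-\pi,\pi)$. Spectral instability means $\sigma(A)\not\subset i\mathbb{R}$. Spectrum: $\rho(T)=\{\lambda:\ker(T-\lambda I)=\{0\},\ \mathrm{ran}(T-\lambda I)=X,\ (T-\lambda I)^{-1}\text{ bounded}\}$, $\sigma(T)=\mathbb{C}\setminus\rho(T)$. *)

theory Defs
  imports "HOL-Analysis.Analysis"
begin

text \<open>The fundamental interval (-pi,pi); 2pi-periodic functions are represented by
  functions real => complex, of which only the values on (-pi,pi) matter.\<close>

abbreviation Iper :: "real set" where "Iper \<equiv> {-pi<..<pi}"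

definition L2dot :: "(real \<Rightarrow> complex) set" where
  "L2dot = {f. set_borel_measurable lborel Iper f
              \<and> set_integrable lborel Iper (\<lambda>x. (cmod (f x))\<^sup>2)
              \<and> (LINT x:Iper|lborel. f x) = 0}"

definition l2norm :: "(real \<Rightarrow> complex) \<Rightarrow> real" where
  "l2norm f = sqrt (LINT x:Iper|lborel. (cmod (f x))\<^sup>2)"

definition ae_eq :: "(real \<Rightarrow> complex) \<Rightarrow> (real \<Rightarrow> complex) \<Rightarrow> bool" where
  "ae_eq f g \<longleftrightarrow> (AE x in lborel. x \<in> Iper \<longrightarrow> f x = g x)"

definition test_fun :: "(real \<Rightarrow> real) \<Rightarrow> bool" where
  "test_fun \<phi> \<longleftrightarrow> (\<forall>n x. ((deriv ^^ n) \<phi>) differentiable (at x))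
      \<and> (\<exists>a b. -pi < a \<and> b < pi \<and> (\<forall>x. x \<notin> {a..b} \<longrightarrow> \<phi> x = 0))"

definition distr_deriv :: "(real \<Rightarrow> complex) \<Rightarrow> (real \<Rightarrow> complex) \<Rightarrow> bool" where
  "distr_deriv w g \<longleftrightarrow> (\<forall>\<phi>. test_fun \<phi> \<longrightarrow>
      (LINT x:Iper|lborel. w x * complex_of_real (deriv \<phi> x))
        = - (LINT x:Iper|lborel. g x * complex_of_real (\<phi> x)))"

definition antideriv :: "(real \<Rightarrow> complex) \<Rightarrow> real \<Rightarrow> complex" where
  "antideriv v z = (LINT t:{-pi..z}|lborel. v t)
      - complex_of_real (1 / (2 * pi)) * (LINT s:Iper|lborel. (LINT t:{-pi..s}|lborel. v t))"

definition U_star :: "real \<Rightarrow> real" where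
  "U_star z = (let y = z - 2 * pi * of_int \<lfloor>(z + pi) / (2 * pi)\<rfloor>
               in (1 / sqrt 2) * (\<bar>y\<bar> - pi / 2))"

definition c_star :: real where "c_star = pi\<^sup>2 / 8"

definition coeffA :: "(real \<Rightarrow> complex) \<Rightarrow> real \<Rightarrow> complex" where
  "coeffA v z = complex_of_real (c_star - (U_star z)\<^sup>2) * v z"

definition domA :: "(real \<Rightarrow> complex) set" where
  "domA = {v \<in> L2dot. \<exists>g \<in> L2dot. distr_deriv (coeffA v) g}"

text \<open>A v = d/dz[(c - U^2) v] + antiderivative of v (the derivative is unique a.e.).\<close>
definition opA :: "(real \<Rightarrow> complex) \<Rightarrow> real \<Rightarrow> complex" where
  "opA v z = (SOME g. g \<in> L2dot \<and> distr_deriv (coeffA v) g) z + antideriv v z"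

definition resolventA :: "complex set" where
  "resolventA = {\<mu>.
      (\<forall>v \<in> domA. ae_eq (\<lambda>z. opA v z - \<mu> * v z) (\<lambda>_. 0) \<longrightarrow> ae_eq v (\<lambda>_. 0))
    \<and> (\<forall>f \<in> L2dot. \<exists>v \<in> domA. ae_eq (\<lambda>z. opA v z - \<mu> * v z) f)
    \<and> (\<exists>C. \<forall>v \<in> domA. l2norm v \<le> C * l2norm (\<lambda>z. opA v z - \<mu> * v z))}"

definition spectrumA :: "complex set" where
  "spectrumA = - resolventA"

end

theory Submission
  imports Defs "HOL-Real_Asymp.Real_Asymp"
begin

text \<open>Write \<open>a = c_* - U_*\<^sup>2\<close>. On each of the half periods \<open>(-pi, 0)\<close> and \<open>(0, pi)\<close> the coefficient \<open>a\<close>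
  is a parabola vanishing at both ends, and \<open>a v\<close> vanishes there for \<open>v\<close> in the domain, because \<open>1 / a\<close> is
  not square integrable. Integration by parts gives
  \<open>Re \<langle>A v, v\<rangle> = 1/2 \<integral> a' |v|\<^sup>2\<close> with \<open>|a'| \<le> pi / 2\<close>, the antiderivative being skew-adjoint. Hence
  \<open>\<parallel>(A - \<mu>) v\<parallel> \<ge> (|Re \<mu>| - pi / 4) \<parallel>v\<parallel>\<close>.

  In terms of \<open>u\<close> with \<open>u' = v\<close>, the equation \<open>(A - \<mu>) v = f\<close> is the hypergeometric equation
  \<open>(a u')' + u - \<mu> u' = f\<close>, which on a half period \<open>(l, l + pi)\<close> has the affine homogeneous solution
  \<open>h(z) = z - l - pi / 2 + \<mu>\<close>. The Wronskian \<open>\<omega> = u - h v\<close> then satisfies \<open>a \<omega>' = h (\<omega> - f)\<close>, whose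
  integrating factor is \<open>a / E\<close> with \<open>E = ((z - l) / (l + pi - z))\<close> to the power \<open>2 \<mu> / pi\<close>.
  For \<open>|Re \<mu>| \<le> pi / 4\<close> the function \<open>E / a\<close> is square integrable at neither end, so a right-hand side
  supported inside \<open>(0, pi)\<close> must be orthogonal to \<open>h / E\<close> there, and \<open>A - \<mu>\<close> is not surjective. For
  \<open>|Re \<mu>| > pi / 4\<close> energy estimates give square integrable solutions \<open>\<omega>\<close>, \<open>v\<close> on both half periods,
  and the multiples of \<open>h\<close> are adjusted so that \<open>u\<close> becomes continuous and periodic; the determinant of this
  linear system is \<open>2 pi \<mu> \<noteq> 0\<close>.\<close>

subsection \<open>Locally absolutely continuous functions\<close>

text \<open>\<open>h\<close> is \<open>\<mu> - a'\<close>: as \<open>a'' = -1\<close> it has slope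
  1, and \<open>a' + h = \<mu>\<close> says exactly that it solves the homogeneous equation.
  Together with \<open>(a v)' = f - u + \<mu> v\<close> it decouples the second-order problem into
  \<open>a \<omega>' = h (\<omega> - f)\<close> followed by \<open>a v' = f - \<omega>\<close>, two
  scalar first-order equations with degenerate ends. The number \<open>pi / 4\<close> is read off
  from \<open>E / a\<close>, whose squared modulus behaves like \<open>z - l\<close> to the power
  \<open>4 Re \<mu> / pi - 2\<close> at the left end and like \<open>l + pi - z\<close> to the power
  \<open>- 4 Re \<mu> / pi - 2\<close> at the right end: in the closed strip both exponents are at
  most \<open>-1\<close>, outside exactly one exceeds it. The obstacle is regularity. The domain
  offers only a distributional derivative; du Bois-Reymond turns it into an absolutely continuous
  version of \<open>a v\<close>, and all later differentiation is a product rule for almost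
  everywhere derivatives, proved by Fubini. Values at the zeros of \<open>a\<close> come from one
  principle: a continuous quantity bounded by the distance to the end times \<open>|v|^2\<close>,
  with \<open>v\<close> square integrable, vanishes there, since the reciprocal distance is not
  integrable.\<close>

lemma set_integrable_imp_borel:
  "set_integrable M S f \<Longrightarrow> set_borel_measurable M S f"
  unfolding set_integrable_def set_borel_measurable_def by (rule borel_measurable_integrable)

lemma set_borel_measurable_mult:
  fixes f g :: "real \<Rightarrow> 'a :: {real_normed_algebra, second_countable_topology}"
  assumes "set_borel_measurable lborel S f" "set_borel_measurable lborel S g"
  shows "set_borel_measurable lborel S (\<lambda>x. f x * g x)"
proof -
  have "(\<lambda>x. (indicat_real S x *\<^sub>R f x) * (indicat_real S x *\<^sub>R g x)) \<in> borel_measurable lborel"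
    using assms unfolding set_borel_measurable_def by measurable
  also have "(\<lambda>x. (indicat_real S x *\<^sub>R f x) * (indicat_real S x *\<^sub>R g x))
      = (\<lambda>x. indicat_real S x *\<^sub>R (f x * g x))"
    by (auto simp: indicator_def)
  finally show ?thesis unfolding set_borel_measurable_def .
qed

lemma set_borel_measurable_add:
  fixes f g :: "real \<Rightarrow> 'a :: {real_normed_vector, second_countable_topology}"
  assumes "set_borel_measurable lborel S f" "set_borel_measurable lborel S g"
  shows "set_borel_measurable lborel S (\<lambda>x. f x + g x)"
  using borel_measurable_add[OF assms[unfolded set_borel_measurable_def]]
  unfolding set_borel_measurable_def by (simp add: scaleR_add_right)

lemma set_borel_measurable_comp:
  fixes f :: "real \<Rightarrow> 'a :: real_normed_vector" and h :: "'a \<Rightarrow> 'b :: {real_normed_vector, second_countable_topology}"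
  assumes f: "set_borel_measurable lborel S f" and h: "h \<in> borel_measurable borel" and S: "S \<in> sets borel"
  shows "set_borel_measurable lborel S (\<lambda>x. h (f x))"
proof -
  have "(\<lambda>x. h (indicat_real S x *\<^sub>R f x)) \<in> borel_measurable lborel"
    by (rule measurable_compose[OF f[unfolded set_borel_measurable_def] h])
  then have "(\<lambda>x. indicat_real S x *\<^sub>R h (indicat_real S x *\<^sub>R f x)) \<in> borel_measurable lborel"
    using S by (intro borel_measurable_scaleR borel_measurable_indicator) auto
  also have "(\<lambda>x. indicat_real S x *\<^sub>R h (indicat_real S x *\<^sub>R f x)) = (\<lambda>x. indicat_real S x *\<^sub>R h (f x))"
    by (auto simp: indicator_def)
  finally show ?thesis unfolding set_borel_measurable_def .
qed

lemma set_borel_measurable_continuous_on: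
  fixes f :: "real \<Rightarrow> 'a :: real_normed_vector"
  assumes "continuous_on S f" "S \<in> sets borel"
  shows "set_borel_measurable lborel S f"
  using borel_measurable_continuous_on_indicator[OF assms(2,1)]
  unfolding set_borel_measurable_def by simp

lemma set_borel_measurable_ident:
  fixes f g :: "real \<Rightarrow> 'a :: real_normed_vector"
  assumes "set_borel_measurable lborel S f" "\<And>x. x \<in> S \<Longrightarrow> f x = g x"
  shows "set_borel_measurable lborel S g"
proof -
  have "(\<lambda>x. indicat_real S x *\<^sub>R f x) = (\<lambda>x. indicat_real S x *\<^sub>R g x)"
    by (rule ext) (use assms(2) in \<open>auto simp: indicator_def\<close>)
  with assms(1) show ?thesis by (simp add: set_borel_measurable_def)
qed

lemma set_borel_measurable_Un:
  fixes f :: "real \<Rightarrow> 'a :: {real_normed_vector, second_countable_topology}"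
  assumes A: "set_borel_measurable lborel A f" and B: "set_borel_measurable lborel B f"
    and [measurable]: "A \<in> sets borel" "B \<in> sets borel"
  shows "set_borel_measurable lborel (A \<union> B) f"
proof -
  have "(\<lambda>x. indicat_real A x *\<^sub>R f x + indicat_real (-A) x *\<^sub>R (indicat_real B x *\<^sub>R f x)) \<in> borel_measurable lborel"
    using A B unfolding set_borel_measurable_def by measurable
  also have "(\<lambda>x. indicat_real A x *\<^sub>R f x + indicat_real (-A) x *\<^sub>R (indicat_real B x *\<^sub>R f x))
     = (\<lambda>x. indicat_real (A \<union> B) x *\<^sub>R f x)"
    by (auto simp: indicator_def)
  finally show ?thesis unfolding set_borel_measurable_def .
qed

lemma set_integrable_cong_ae:
  fixes f g :: "real \<Rightarrow> 'a :: {banach, second_countable_topology}"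
  assumes "set_integrable lborel S f" "set_borel_measurable lborel S g"
    and "AE x in lborel. x \<in> S \<longrightarrow> f x = g x"
  shows "set_integrable lborel S g"
  by (rule set_integrable_bound[OF assms(1,2)]) (use assms(3) in auto)

lemma set_integral_cong_ae:
  fixes f g :: "real \<Rightarrow> 'a :: {banach, second_countable_topology}"
  assumes "set_borel_measurable lborel S f" "set_borel_measurable lborel S g"
    and "AE x in lborel. x \<in> S \<longrightarrow> f x = g x"
  shows "(LINT x:S|lborel. f x) = (LINT x:S|lborel. g x)"
  unfolding set_lebesgue_integral_def
  by (rule integral_cong_AE) (use assms in \<open>auto simp: set_borel_measurable_def indicator_def\<close>)

lemma set_integrable_bounded_mult:
  fixes f g :: "real \<Rightarrow> complex"
  assumes f: "set_integrable lborel S f" and g: "set_borel_measurable lborel S g"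
    and B: "\<And>x. x \<in> S \<Longrightarrow> cmod (g x) \<le> B"
  shows "set_integrable lborel S (\<lambda>x. f x * g x)"
proof (rule set_integrable_bound)
  show "set_integrable lborel S (\<lambda>x. of_real \<bar>B\<bar> * f x)" using f by simp
  show "set_borel_measurable lborel S (\<lambda>x. f x * g x)"
    by (intro set_borel_measurable_mult set_integrable_imp_borel f g)
  have "norm (f x * g x) \<le> norm (of_real \<bar>B\<bar> * f x)" if "x \<in> S" for x
    using mult_left_mono[OF order_trans[OF B[OF that] abs_ge_self], of "norm (f x)"]
    by (simp add: norm_mult mult.commute)
  then show "AE x in lborel. x \<in> S \<longrightarrow> norm (f x * g x) \<le> norm (of_real \<bar>B\<bar> * f x)" by auto
qed

lemma set_integrable_continuous_mult:
  fixes f g :: "real \<Rightarrow> complex"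
  assumes "set_integrable lborel {p..q} f" "continuous_on {p..q} g"
  shows "set_integrable lborel {p..q} (\<lambda>x. f x * g x)"
proof -
  have "bounded (g ` {p..q})"
    by (intro compact_imp_bounded compact_continuous_image assms) simp
  then obtain B where "\<forall>x\<in>{p..q}. cmod (g x) \<le> B"
    by (auto simp: bounded_iff)
  then show ?thesis
    by (intro set_integrable_bounded_mult[where B=B] assms set_borel_measurable_continuous_on) auto
qed

lemma set_integral_split:
  fixes f :: "real \<Rightarrow> 'a :: {banach, second_countable_topology}"
  assumes "set_integrable lborel {p..r} f" "p \<le> q" "q \<le> r"
  shows "(LINT x:{p..r}|lborel. f x) = (LINT x:{p..q}|lborel. f x) + (LINT x:{q..r}|lborel. f x)"
proof -
  have "AE x in lborel. x \<noteq> q" by (rule AE_lborel_singleton)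
  then have "AE x in lborel. \<not> (x \<in> {p..q} \<and> x \<in> {q..r})" by auto
  then have "(LINT x:{p..q} \<union> {q..r}|lborel. f x) = (LINT x:{p..q}|lborel. f x) + (LINT x:{q..r}|lborel. f x)"
    by (intro set_integral_Un_AE set_integrable_subset[OF assms(1)]) (use assms in auto)
  then show ?thesis using assms by (simp add: ivl_disj_un_two_touch(4))
qed

lemma set_integral_Icc_Ioo:
  fixes f :: "real \<Rightarrow> 'a :: {banach, second_countable_topology}"
  shows "(LINT x:{p..q}|lborel. f x) = (LINT x:{p<..<q}|lborel. f x)"
  by (rule set_integral_discrete_difference[where X="{p,q}"]) auto

lemma set_integrable_Icc_Ioo:
  fixes f :: "real \<Rightarrow> 'a :: {banach, second_countable_topology}"
  shows "set_integrable lborel {p..q} f \<longleftrightarrow> set_integrable lborel {p<..<q} f"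
  by (rule set_integrable_discrete_difference[where X="{p,q}"]) auto

text \<open>\<open>abs_cont_on S w g\<close>: on the interval \<open>S\<close> the function \<open>w\<close> is locally absolutely continuous
  with almost everywhere derivative \<open>g\<close>.\<close>

definition abs_cont_on :: "real set \<Rightarrow> (real \<Rightarrow> complex) \<Rightarrow> (real \<Rightarrow> complex) \<Rightarrow> bool" where
  "abs_cont_on S w g \<longleftrightarrow> is_interval S \<and> (\<forall>p\<in>S. \<forall>q\<in>S. p \<le> q \<longrightarrow>
     set_integrable lborel {p..q} g \<and> (LINT t:{p..q}|lborel. g t) = w q - w p)"

lemma abs_cont_onD:
  assumes "abs_cont_on S w g" "p \<in> S" "q \<in> S" "p \<le> q"
  shows "set_integrable lborel {p..q} g" "(LINT t:{p..q}|lborel. g t) = w q - w p" "{p..q} \<subseteq> S"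
proof -
  show "{p..q} \<subseteq> S"
    using assms unfolding abs_cont_on_def is_interval_1 by (meson atLeastAtMost_iff subsetI)
qed (use assms in \<open>simp_all add: abs_cont_on_def\<close>)

lemma abs_cont_on_subset:
  "abs_cont_on S w g \<Longrightarrow> T \<subseteq> S \<Longrightarrow> is_interval T \<Longrightarrow> abs_cont_on T w g"
  unfolding abs_cont_on_def by blast

lemma abs_cont_on_add:
  assumes "abs_cont_on S w g" "abs_cont_on S m k"
  shows "abs_cont_on S (\<lambda>x. w x + m x) (\<lambda>x. g x + k x)"
  using assms unfolding abs_cont_on_def by (auto simp: set_integral_add)

lemma abs_cont_on_cmult:
  assumes "abs_cont_on S w g"
  shows "abs_cont_on S (\<lambda>x. c * w x) (\<lambda>x. c * g x)"
  using assms unfolding abs_cont_on_def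
  by (metis right_diff_distrib set_integral_mult_right set_integrable_mult_right)

lemma abs_cont_on_diff:
  assumes "abs_cont_on S w g" "abs_cont_on S m k"
  shows "abs_cont_on S (\<lambda>x. w x - m x) (\<lambda>x. g x - k x)"
  using assms unfolding abs_cont_on_def by (auto simp: set_integral_diff)

lemma abs_cont_on_cnj:
  assumes "abs_cont_on S w g"
  shows "abs_cont_on S (\<lambda>x. cnj (w x)) (\<lambda>x. cnj (g x))"
proof -
  have 1: "(\<lambda>x. indicat_real A x *\<^sub>R cnj (g x)) = (\<lambda>x. cnj (indicat_real A x *\<^sub>R g x))" for A
    by (auto simp: indicator_def)
  have 2: "set_integrable lborel A (\<lambda>x. cnj (g x)) \<longleftrightarrow> set_integrable lborel A g" for A
    unfolding set_integrable_def 1 by (rule complex_integrable_cnj)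
  have 3: "(LINT x:A|lborel. cnj (g x)) = cnj (LINT x:A|lborel. g x)" for A
    unfolding set_lebesgue_integral_def 1 by (rule Bochner_Integration.integral_cnj)
  show ?thesis
    using assms unfolding abs_cont_on_def 2 3 by (metis complex_cnj_diff)
qed

text \<open>Agreement almost everywhere does not carry Borel measurability over to
  \<open>g'\<close>, hence the separate assumption; \<open>abs_cont_on_ident\<close> below covers
  equality at every point.\<close>

lemma abs_cont_on_cong:
  assumes w: "abs_cont_on S w g" and eq: "\<And>x. x \<in> S \<Longrightarrow> w x = w' x"
    and g': "set_borel_measurable lborel S g'" and ae: "AE x in lborel. x \<in> S \<longrightarrow> g x = g' x"
  shows "abs_cont_on S w' g'"
proof -
  have "set_integrable lborel {p..q} g' \<and> (LINT t:{p..q}|lborel. g' t) = w' q - w' p"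
    if pq: "p \<in> S" "q \<in> S" "p \<le> q" for p q
  proof -
    note D = abs_cont_onD[OF w pq]
    have m: "set_borel_measurable lborel {p..q} g'"
      by (rule set_borel_measurable_subset[OF g']) (use D in auto)
    have ae': "AE x in lborel. x \<in> {p..q} \<longrightarrow> g x = g' x" using ae by eventually_elim (use D(3) in auto)
    show ?thesis
      using set_integrable_cong_ae[OF D(1) m ae'] 
        set_integral_cong_ae[OF set_integrable_imp_borel[OF D(1)] m ae'] D(2) eq pq by simp
  qed
  with w show ?thesis unfolding abs_cont_on_def by blast
qed

lemma abs_cont_on_ident:
  assumes w: "abs_cont_on S w g" and eq: "\<And>x. x \<in> S \<Longrightarrow> w x = w' x" "\<And>x. x \<in> S \<Longrightarrow> g x = g' x"
  shows "abs_cont_on S w' g'"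
proof -
  have "set_integrable lborel {p..q} g' \<and> (LINT t:{p..q}|lborel. g' t) = w' q - w' p"
    if pq: "p \<in> S" "q \<in> S" "p \<le> q" for p q
  proof -
    note D = abs_cont_onD[OF w pq]
    have "set_integrable lborel {p..q} g = set_integrable lborel {p..q} g'"
      by (rule set_integrable_cong) (use eq(2) D(3) in auto)
    moreover have "(LINT t:{p..q}|lborel. g t) = (LINT t:{p..q}|lborel. g' t)"
      by (rule set_lebesgue_integral_cong) (use eq(2) D(3) in auto)
    ultimately show ?thesis using D(1,2) eq(1) pq by simp
  qed
  with w show ?thesis unfolding abs_cont_on_def by blast
qed

lemma abs_cont_on_continuous:
  assumes w: "abs_cont_on S w g"
  shows "continuous_on S w"
proof -
  have Icc: "continuous_on {p..q} w" if pq: "p \<in> S" "q \<in> S" "p \<le> q" for p q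
  proof -
    note D = abs_cont_onD[OF w pq]
    have "continuous_on {p..q} (\<lambda>x. w p + integral {p..x} g)"
      by (intro continuous_intros indefinite_integral_continuous_1
           set_borel_integral_eq_integral(1) D(1))
    moreover have "w x = w p + integral {p..x} g" if x: "x \<in> {p..q}" for x
    proof -
      from x D(3) have "x \<in> S" "p \<le> x" by auto
      note D' = abs_cont_onD[OF w pq(1) this]
      show ?thesis
        using D'(2) set_borel_integral_eq_integral(2)[OF D'(1)] by (simp add: algebra_simps)
    qed
    ultimately show ?thesis
      by (subst continuous_on_cong[OF refl, of _ w "\<lambda>x. w p + integral {p..x} g"])
  qed
  have "continuous (at x within S) w" if x: "x \<in> S" for x
  proof -
    \<comment> \<open>Continuity is known on compact subintervals only. An end of
      \<open>{p..q}\<close> coincides with \<open>x\<close> only if \<open>x\<close> is the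
      corresponding end of \<open>S\<close>, so \<open>{p..q}\<close> is a neighbourhood of
      \<open>x\<close> relative to \<open>S\<close>.\<close>
    have "\<exists>p q. p \<in> S \<and> q \<in> S \<and> p \<le> x \<and> x \<le> q \<and> (at x within S) \<le> (at x within {p..q})"
    proof -
      obtain p where p: "p \<in> S" "p \<le> x" "p < x \<or> (\<forall>y\<in>S. x \<le> y)"
      proof (cases "\<exists>y\<in>S. y < x")
        case True then show ?thesis using that by auto
      next
        case False then show ?thesis using that[of x] x by (simp add: not_less)
      qed
      obtain q where q: "q \<in> S" "x \<le> q" "x < q \<or> (\<forall>y\<in>S. y \<le> x)"
      proof (cases "\<exists>y\<in>S. x < y")
        case True then show ?thesis using that by auto
      next
        case False then show ?thesis using that[of x] x by (simp add: not_less)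
      qed
      define T where "T = {if p < x then p else x - 1 <..< if x < q then q else x + 1}"
      have "at x within S = at x within (S \<inter> T)"
        by (rule at_within_nhd[of x T]) (auto simp: T_def)
      also have "\<dots> \<le> at x within {p..q}"
        by (rule at_le) (use p q in \<open>auto simp: T_def intro: antisym split: if_splits\<close>)
      finally show ?thesis using p q by blast
    qed
    then obtain p q where pq: "p \<in> S" "q \<in> S" "p \<le> x" "x \<le> q"
       "(at x within S) \<le> (at x within {p..q})" by blast
    have "continuous (at x within {p..q}) w"
      using Icc[of p q] pq by (auto simp: continuous_on_eq_continuous_within)
    then show ?thesis using pq(5) unfolding continuous_within by (rule tendsto_mono[rotated])
  qed
  then show ?thesis by (simp add: continuous_on_eq_continuous_within)
qed

lemma abs_cont_on_C1:
  assumes S: "is_interval S" and D: "\<And>x. x \<in> S \<Longrightarrow> (w has_vector_derivative g x) (at x within S)"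
    and g: "continuous_on S g"
  shows "abs_cont_on S w g"
  unfolding abs_cont_on_def
proof (intro conjI ballI impI S)
  fix p q assume pq: "p \<in> S" "q \<in> S" "p \<le> q"
  then have sub: "{p..q} \<subseteq> S"
    using S unfolding is_interval_1 by (meson atLeastAtMost_iff subsetI)
  then have c: "continuous_on {p..q} g" using g continuous_on_subset by blast
  then show "set_integrable lborel {p..q} g" by (rule borel_integrable_atLeastAtMost')
  show "(LINT t:{p..q}|lborel. g t) = w q - w p"
    unfolding set_lebesgue_integral_def
    by (rule integral_FTC_atLeastAtMost[OF pq(3) _ c])
      (meson D sub has_vector_derivative_within_subset atLeastAtMost_iff subsetD)
qed

text \<open>Integration by parts through Fubini: the product of the two increments is the integral
  of \<open>g t * k s\<close> over a square. Cutting the square along the diagonal and integrating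
  out the inner variable leaves \<open>g (m - m p)\<close> on one triangle and
  \<open>(w - w p) k\<close> on the other. No pointwise derivative is involved.\<close>

lemma abs_cont_on_mult:
  assumes w: "abs_cont_on S w g" and m: "abs_cont_on S m k"
  shows "abs_cont_on S (\<lambda>x. w x * m x) (\<lambda>x. g x * m x + w x * k x)"
  unfolding abs_cont_on_def
proof (intro conjI ballI impI)
  show "is_interval S" using w by (simp add: abs_cont_on_def)
  fix p q assume pq: "p \<in> S" "q \<in> S" "p \<le> q"
  note W = abs_cont_onD[OF w pq] and M = abs_cont_onD[OF m pq]
  have cw: "continuous_on {p..q} w" and cm: "continuous_on {p..q} m"
    using abs_cont_on_continuous[OF w] abs_cont_on_continuous[OF m] W(3) continuous_on_subset by blast+
  have igm: "set_integrable lborel {p..q} (\<lambda>x. g x * m x)"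
    by (rule set_integrable_continuous_mult[OF W(1) cm])
  have iwk: "set_integrable lborel {p..q} (\<lambda>x. w x * k x)"
    using set_integrable_continuous_mult[OF M(1) cw] by (simp add: mult.commute)
  show "set_integrable lborel {p..q} (\<lambda>x. g x * m x + w x * k x)"
    by (intro set_integral_add igm iwk)
  define G where "G t = indicat_real {p..q} t *\<^sub>R g t" for t
  define K where "K t = indicat_real {p..q} t *\<^sub>R k t" for t
  have G: "integrable lborel G" and K: "integrable lborel K"
    using W(1) M(1) unfolding set_integrable_def G_def K_def by auto
  have [measurable]: "G \<in> borel_measurable borel" "K \<in> borel_measurable borel"
    using G K by (auto dest: borel_measurable_integrable)
  have H: "integrable (lborel \<Otimes>\<^sub>M lborel) (\<lambda>(t, s). G t * K s)"
  proof (rule lborel_pair.Fubini_integrable)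
    show "(\<lambda>(t, s). G t * K s) \<in> borel_measurable (lborel \<Otimes>\<^sub>M lborel)" by measurable
    show "integrable lborel (\<lambda>x. LINT y|lborel. norm (case (x, y) of (t, s) \<Rightarrow> G t * K s))"
      using G by (simp add: norm_mult)
    show "AE x in lborel. integrable lborel (\<lambda>y. case (x, y) of (t, s) \<Rightarrow> G t * K s)"
      using K by simp
  qed
  have H1: "integrable (lborel \<Otimes>\<^sub>M lborel) (\<lambda>(t, s). of_bool (s \<le> t) * (G t * K s))"
    by (rule Bochner_Integration.integrable_bound[OF H]) (auto simp: norm_mult)
  have H2: "integrable (lborel \<Otimes>\<^sub>M lborel) (\<lambda>(t, s). of_bool (t < s) * (G t * K s))"
    by (rule Bochner_Integration.integrable_bound[OF H]) (auto simp: norm_mult)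
  have "integral\<^sup>L (lborel \<Otimes>\<^sub>M lborel) (\<lambda>(t, s). G t * K s)
     = integral\<^sup>L (lborel \<Otimes>\<^sub>M lborel) (\<lambda>(t, s). of_bool (s \<le> t) * (G t * K s))
     + integral\<^sup>L (lborel \<Otimes>\<^sub>M lborel) (\<lambda>(t, s). of_bool (t < s) * (G t * K s))"
    by (subst Bochner_Integration.integral_add[symmetric, OF H1 H2])
       (rule Bochner_Integration.integral_cong, auto)
  moreover have "integral\<^sup>L lborel G = w q - w p" "integral\<^sup>L lborel K = m q - m p"
    using W(2) M(2) unfolding G_def K_def set_lebesgue_integral_def .
  then have "integral\<^sup>L (lborel \<Otimes>\<^sub>M lborel) (\<lambda>(t, s). G t * K s) = (w q - w p) * (m q - m p)"
    using lborel_pair.integral_fst[OF H] by simp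
  moreover have "integral\<^sup>L (lborel \<Otimes>\<^sub>M lborel) (\<lambda>(t, s). of_bool (s \<le> t) * (G t * K s))
     = (LINT t:{p..q}|lborel. g t * (m t - m p))"
  proof -
    have "(LINT s|lborel. of_bool (s \<le> t) * (G t * K s)) = indicat_real {p..q} t *\<^sub>R (g t * (m t - m p))" for t
    proof (cases "t \<in> {p..q}")
      case True
      then have t: "t \<in> S" "p \<le> t" using W(3) by auto
      have "(LINT s|lborel. of_bool (s \<le> t) * (G t * K s)) = (LINT s:{p..t}|lborel. g t * k s)"
        unfolding set_lebesgue_integral_def
        by (rule Bochner_Integration.integral_cong) (use True in \<open>auto simp: G_def K_def indicator_def\<close>)
      also have "\<dots> = g t * (m t - m p)" using abs_cont_onD(2)[OF m pq(1) t] by simp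
      finally show ?thesis using True by simp
    qed (simp add: G_def)
    then show ?thesis using lborel_pair.integral_fst[OF H1] by (simp add: set_lebesgue_integral_def)
  qed
  moreover have "integral\<^sup>L (lborel \<Otimes>\<^sub>M lborel) (\<lambda>(t, s). of_bool (t < s) * (G t * K s))
     = (LINT t:{p..q}|lborel. (w t - w p) * k t)"
  proof -
    have "(LINT t|lborel. of_bool (t < s) * (G t * K s)) = indicat_real {p..q} s *\<^sub>R ((w s - w p) * k s)" for s
    proof (cases "s \<in> {p..q}")
      case True
      then have s: "s \<in> S" "p \<le> s" using W(3) by auto
      have "(LINT t|lborel. of_bool (t < s) * (G t * K s)) = (LINT t:{p..<s}|lborel. g t * k s)"
        unfolding set_lebesgue_integral_def
        by (rule Bochner_Integration.integral_cong) (use True in \<open>auto simp: G_def K_def indicator_def\<close>)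
      also have "\<dots> = (LINT t:{p..<s}|lborel. g t) * k s" by simp
      also have "(LINT t:{p..<s}|lborel. g t) = (LINT t:{p..s}|lborel. g t)"
        by (rule set_integral_discrete_difference[where X="{s}"]) auto
      also have "\<dots> = w s - w p" using abs_cont_onD(2)[OF w pq(1) s] by simp
      finally show ?thesis using True by simp
    qed (simp add: K_def)
    then show ?thesis using lborel_pair.integral_snd[OF H2] by (simp add: set_lebesgue_integral_def)
  qed
  moreover have "(LINT t:{p..q}|lborel. g t * (m t - m p)) = (LINT t:{p..q}|lborel. g t * m t) - (w q - w p) * m p"
    unfolding right_diff_distrib
      set_integral_diff(2)[OF igm set_integrable_mult_left[OF W(1)]] set_integral_mult_left W(2) ..
  moreover have "(LINT t:{p..q}|lborel. (w t - w p) * k t) = (LINT t:{p..q}|lborel. w t * k t) - w p * (m q - m p)"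
    unfolding left_diff_distrib
      set_integral_diff(2)[OF iwk set_integrable_mult_right[OF M(1)]] set_integral_mult_right M(2) ..
  moreover have "(LINT t:{p..q}|lborel. g t * m t + w t * k t) = (LINT t:{p..q}|lborel. g t * m t) + (LINT t:{p..q}|lborel. w t * k t)"
    by (rule set_integral_add[OF igm iwk])
  \<comment> \<open>Pure algebra, with variables in place of the integrals so that the facts
    collected above only have to be matched against the premises.\<close>
  moreover have "R = w q * m q - w p * m p"
    if "T = A + B" "T = (w q - w p) * (m q - m p)" "A = C" "B = D"
      "C = P - (w q - w p) * m p" "D = Q - w p * (m q - m p)" "R = P + Q" for A B C D P Q R T :: complex
  proof -
    have "R = T + (w q - w p) * m p + w p * (m q - m p)" using that by (simp add: algebra_simps)
    then show ?thesis unfolding that(2) by (simp add: algebra_simps)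
  qed
  ultimately show "(LINT t:{p..q}|lborel. g t * m t + w t * k t) = w q * m q - w p * m p"
    by blast
qed

lemma abs_cont_on_primitive:
  assumes g: "set_integrable lborel {l..m} g"
  shows "abs_cont_on {l..m} (\<lambda>z. c + (LINT t:{l..z}|lborel. g t)) g"
  unfolding abs_cont_on_def
proof (intro conjI ballI impI)
  fix p q assume pq: "p \<in> {l..m}" "q \<in> {l..m}" "p \<le> q"
  show "set_integrable lborel {p..q} g"
    by (rule set_integrable_subset[OF g]) (use pq in auto)
  have "set_integrable lborel {l..q} g"
    by (rule set_integrable_subset[OF g]) (use pq in auto)
  from set_integral_split[OF this, of p] pq
  show "(LINT t:{p..q}|lborel. g t) = c + (LINT t:{l..q}|lborel. g t) - (c + (LINT t:{l..p}|lborel. g t))"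
    by auto
qed (simp add: is_interval_cc)

text \<open>An integrable derivative forces limits at both ends. The primitive based at
  \<open>l\<close>, with its constant adjusted at the midpoint, is the continuous extension; the
  values of \<open>w\<close> at \<open>l\<close> and \<open>m\<close> themselves remain
  arbitrary.\<close>

lemma abs_cont_on_extend:
  assumes w: "abs_cont_on {l<..<m} w g" and g: "set_integrable lborel {l<..<m} g" and lm: "l < m"
  obtains c where "\<And>z. z \<in> {l<..<m} \<Longrightarrow> w z = c + (LINT t:{l..z}|lborel. g t)"
    "abs_cont_on {l..m} (\<lambda>z. c + (LINT t:{l..z}|lborel. g t)) g"
proof -
  define G where "G z = (LINT t:{l..z}|lborel. g t)" for z
  have g': "set_integrable lborel {l..m} g" using g by (simp add: set_integrable_Icc_Ioo)
  have G: "abs_cont_on {l..m} (\<lambda>z. c + G z) g" for c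
    unfolding G_def by (rule abs_cont_on_primitive[OF g'])
  define h where "h = (l + m) / 2"
  have h: "h \<in> {l<..<m}" using lm by (auto simp: h_def)
  have "w z = (w h - G h) + G z" if z: "z \<in> {l<..<m}" for z
  proof (cases "z \<le> h")
    case True

    have "w h - w z = (0 + G h) - (0 + G z)"
      by (rule trans[OF sym[OF abs_cont_onD(2)[OF w z h True]] abs_cont_onD(2)[OF G[of 0] _ _ True]])
         (use z h in auto)
    then show ?thesis by (simp add: algebra_simps)
  next
    case False

    then have False: "h \<le> z" by simp
    have "w z - w h = (0 + G z) - (0 + G h)"
      by (rule trans[OF sym[OF abs_cont_onD(2)[OF w h z False]] abs_cont_onD(2)[OF G[of 0] _ _ False]])
         (use z h in auto)
    then show ?thesis by (simp add: algebra_simps)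
  qed
  with G[of "w h - G h"] show thesis using that[of "w h - G h"] by (simp add: G_def)
qed

lemma abs_cont_on_glue:
  assumes a: "abs_cont_on {l..m} w g" and b: "abs_cont_on {m..n} w g" and "l \<le> m" "m \<le> n"
  shows "abs_cont_on {l..n} w g"
  unfolding abs_cont_on_def
proof (intro conjI ballI impI)
  fix p q assume pq: "p \<in> {l..n}" "q \<in> {l..n}" "p \<le> q"
  have ilm: "set_integrable lborel {l..m} g" using abs_cont_onD(1)[OF a, of l m] assms by auto
  have imn: "set_integrable lborel {m..n} g" using abs_cont_onD(1)[OF b, of m n] assms by auto
  have iln: "set_integrable lborel {l..n} g"
    using set_integrable_Un[OF ilm imn] assms(3,4) by (simp add: ivl_disj_un_two_touch(4))
  show ipq: "set_integrable lborel {p..q} g" by (rule set_integrable_subset[OF iln]) (use pq in auto)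
  consider "q \<le> m" | "m \<le> p" | "p \<le> m" "m \<le> q" by linarith
  then show "(LINT t:{p..q}|lborel. g t) = w q - w p"
  proof cases
    case 1 then show ?thesis using abs_cont_onD(2)[OF a, of p q] pq by auto
  next
    case 2 then show ?thesis using abs_cont_onD(2)[OF b, of p q] pq by auto
  next
    case 3 then show ?thesis
      using abs_cont_onD(2)[OF a, of p m] abs_cont_onD(2)[OF b, of m q] set_integral_split[OF ipq 3] pq by auto
  qed
qed (simp add: is_interval_cc)

text \<open>Reflections swap the ends of an interval. They transfer estimates from the left end to
  the right one, and later the half plane \<open>Re \<mu> > pi / 4\<close> to
  \<open>Re \<mu> < - pi / 4\<close>.\<close>

lemma set_integral_reflect:
  fixes f :: "real \<Rightarrow> 'a :: {banach, second_countable_topology}"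
  shows "set_integrable lborel ((\<lambda>x. c - x) -` S) (\<lambda>x. f (c - x)) \<longleftrightarrow> set_integrable lborel S f"
    "(LINT x:((\<lambda>x. c - x) -` S)|lborel. f (c - x)) = (LINT x:S|lborel. f x)"
proof -
  have 1: "(\<lambda>x. indicat_real ((\<lambda>x. c - x) -` S) x *\<^sub>R f (c - x)) = (\<lambda>x. (\<lambda>x. indicat_real S x *\<^sub>R f x) (c + (-1) * x))"
    by (auto simp: indicator_def)
  show "set_integrable lborel ((\<lambda>x. c - x) -` S) (\<lambda>x. f (c - x)) \<longleftrightarrow> set_integrable lborel S f"
    unfolding set_integrable_def 1 by (subst lborel_integrable_real_affine_iff) auto
  show "(LINT x:((\<lambda>x. c - x) -` S)|lborel. f (c - x)) = (LINT x:S|lborel. f x)"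
    unfolding set_lebesgue_integral_def 1 by (subst (2) lborel_integral_real_affine[of "-1" _ c]) auto
qed

lemma abs_cont_on_reflect:
  assumes w: "abs_cont_on {l..m} w g"
  shows "abs_cont_on {l..m} (\<lambda>x. w (l + m - x)) (\<lambda>x. - g (l + m - x))"
  unfolding abs_cont_on_def
proof (intro conjI ballI impI)
  fix p q assume pq: "p \<in> {l..m}" "q \<in> {l..m}" "p \<le> q"
  have *: "(\<lambda>x. l + m - x) -` {l + m - q..l + m - p} = {p..q}" by auto
  note D = abs_cont_onD[OF w, of "l + m - q" "l + m - p"]
  have i: "set_integrable lborel {p..q} (\<lambda>x. g (l + m - x))"
    using set_integral_reflect(1)[of "l+m" "{l + m - q..l + m - p}" g] D pq unfolding * by auto
  have e: "(LINT x:{p..q}|lborel. g (l + m - x)) = w (l + m - p) - w (l + m - q)"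
    using set_integral_reflect(2)[of "l+m" "{l + m - q..l + m - p}" g] D pq unfolding * by auto
  show "set_integrable lborel {p..q} (\<lambda>x. - g (l + m - x))"
    using set_integrable_mult_right[of "-1" lborel "{p..q}", OF i] by simp
  show "(LINT x:{p..q}|lborel. - g (l + m - x)) = w (l + m - q) - w (l + m - p)"
    using set_integral_uminus[OF i] e by simp
qed (simp add: is_interval_cc)

subsection \<open>Square integrable functions\<close>

text \<open>The conditions of \<open>L2dot\<close> without the zero mean and on an arbitrary set, so
  that each half period can be treated by itself.\<close>

definition L2_on :: "real set \<Rightarrow> (real \<Rightarrow> complex) \<Rightarrow> bool" where
  "L2_on S f \<longleftrightarrow> set_borel_measurable lborel S f \<and> set_integrable lborel S (\<lambda>x. (cmod (f x))\<^sup>2)"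

lemma L2_on_measurable: "L2_on S f \<Longrightarrow> set_borel_measurable lborel S f"
  and L2_on_square: "L2_on S f \<Longrightarrow> set_integrable lborel S (\<lambda>x. (cmod (f x))\<^sup>2)"
  by (simp_all add: L2_on_def)

lemma set_borel_measurable_cmod_square:
  fixes f :: "real \<Rightarrow> complex"
  assumes "set_borel_measurable lborel S f" "S \<in> sets borel"
  shows "set_borel_measurable lborel S (\<lambda>x. (cmod (f x))\<^sup>2)"
  by (rule set_borel_measurable_comp[where h="\<lambda>z. (cmod z)\<^sup>2"]) (use assms in auto)

lemma L2_on_subset:
  assumes "L2_on S f" "T \<in> sets borel" "T \<subseteq> S"
  shows "L2_on T f"
  using assms unfolding L2_on_def
  by (auto intro: set_borel_measurable_subset set_integrable_subset)

lemma L2_on_bound: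
  assumes f: "set_borel_measurable lborel S f" and g: "L2_on S g" and S: "S \<in> sets borel"
    and b: "AE x in lborel. x \<in> S \<longrightarrow> cmod (f x) \<le> K * cmod (g x)"
  shows "L2_on S f"
  unfolding L2_on_def
proof
  show "set_integrable lborel S (\<lambda>x. (cmod (f x))\<^sup>2)"
  proof (rule set_integrable_bound)
    show "set_integrable lborel S (\<lambda>x. K\<^sup>2 * (cmod (g x))\<^sup>2)"
      using L2_on_square[OF g] by simp
    show "set_borel_measurable lborel S (\<lambda>x. (cmod (f x))\<^sup>2)"
      by (rule set_borel_measurable_cmod_square[OF f S])
    show "AE x in lborel. x \<in> S \<longrightarrow> norm ((cmod (f x))\<^sup>2) \<le> norm (K\<^sup>2 * (cmod (g x))\<^sup>2)"
      using b
    proof eventually_elim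
      case (elim x)
      show ?case
      proof
        assume "x \<in> S"
        with elim have "(cmod (f x))\<^sup>2 \<le> (K * cmod (g x))\<^sup>2" by (intro power_mono) auto
        then show "norm ((cmod (f x))\<^sup>2) \<le> norm (K\<^sup>2 * (cmod (g x))\<^sup>2)" by (simp add: power_mult_distrib)
      qed
    qed
  qed
qed (rule f)

lemma L2_on_cong_ae:
  assumes "L2_on S f" "set_borel_measurable lborel S g" "S \<in> sets borel"
    and "AE x in lborel. x \<in> S \<longrightarrow> f x = g x"
  shows "L2_on S g"
  by (rule L2_on_bound[OF assms(2,1,3), of 1]) (use assms(4) in auto)

lemma L2_on_ident:
  assumes "L2_on S f" "S \<in> sets borel" "\<And>x. x \<in> S \<Longrightarrow> f x = g x"
  shows "L2_on S g"
  by (rule L2_on_cong_ae[OF assms(1) set_borel_measurable_ident[OF L2_on_measurable[OF assms(1)] assms(3)] assms(2)])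
    (use assms(3) in auto)

lemma L2_on_bounded_mult:
  assumes f: "L2_on S f" and g: "set_borel_measurable lborel S g" and S: "S \<in> sets borel"
    and B: "\<And>x. x \<in> S \<Longrightarrow> cmod (g x) \<le> B"
  shows "L2_on S (\<lambda>x. g x * f x)"
proof (rule L2_on_bound[OF _ f S, of _ B])
  show "set_borel_measurable lborel S (\<lambda>x. g x * f x)"
    by (intro set_borel_measurable_mult g L2_on_measurable[OF f])
  show "AE x in lborel. x \<in> S \<longrightarrow> cmod (g x * f x) \<le> B * cmod (f x)"
    using B by (intro AE_I2) (auto simp: norm_mult intro!: mult_right_mono)
qed

lemma L2_on_continuous_mult:
  assumes f: "L2_on S f" and g: "continuous_on {l..m} g" and S: "S \<in> sets borel" "S \<subseteq> {l..m}"
  shows "L2_on S (\<lambda>x. g x * f x)"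
proof -
  have "bounded (g ` {l..m})"
    by (intro compact_imp_bounded compact_continuous_image g) simp
  then obtain B where "\<forall>x\<in>{l..m}. cmod (g x) \<le> B"
    by (auto simp: bounded_iff)
  then show ?thesis
    using S by (intro L2_on_bounded_mult[where B=B] f set_borel_measurable_continuous_on
       continuous_on_subset[OF g]) auto
qed

lemma L2_on_cmult:
  assumes "L2_on S f" "S \<in> sets borel"
  shows "L2_on S (\<lambda>x. c * f x)"
  by (rule L2_on_bounded_mult[OF assms(1) _ assms(2), where B="cmod c"])
    (auto intro!: set_borel_measurable_continuous_on assms continuous_intros)

lemma L2_on_add:
  assumes f: "L2_on S f" and g: "L2_on S g" and S: "S \<in> sets borel"
  shows "L2_on S (\<lambda>x. f x + g x)"
  unfolding L2_on_def
proof
  show m: "set_borel_measurable lborel S (\<lambda>x. f x + g x)"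
    by (intro set_borel_measurable_add L2_on_measurable f g)
  show "set_integrable lborel S (\<lambda>x. (cmod (f x + g x))\<^sup>2)"
  proof (rule set_integrable_bound)
    show "set_integrable lborel S (\<lambda>x. 2 * (cmod (f x))\<^sup>2 + 2 * (cmod (g x))\<^sup>2)"
      by (intro set_integral_add set_integrable_mult_right L2_on_square f g)
    show "set_borel_measurable lborel S (\<lambda>x. (cmod (f x + g x))\<^sup>2)"
      by (rule set_borel_measurable_cmod_square[OF m S])
    have "(cmod (a + b))\<^sup>2 \<le> 2 * (cmod a)\<^sup>2 + 2 * (cmod b)\<^sup>2" for a b
    proof -
      have "(cmod (a + b))\<^sup>2 \<le> (cmod a + cmod b)\<^sup>2" by (intro power_mono norm_triangle_ineq) auto
      also have "\<dots> \<le> 2 * (cmod a)\<^sup>2 + 2 * (cmod b)\<^sup>2"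
        using sum_squares_bound[of "cmod a" "cmod b"] by (simp add: power2_sum)
      finally show ?thesis .
    qed
    then show "AE x in lborel. x \<in> S \<longrightarrow> norm ((cmod (f x + g x))\<^sup>2) \<le> norm (2 * (cmod (f x))\<^sup>2 + 2 * (cmod (g x))\<^sup>2)"
      by auto
  qed
qed

lemma L2_on_diff:
  assumes f: "L2_on S f" and g: "L2_on S g" and S: "S \<in> sets borel"
  shows "L2_on S (\<lambda>x. f x - g x)"
  using L2_on_add[OF f L2_on_cmult[OF g S, of "-1"] S] by simp

lemma L2_on_mult_integrable:
  assumes f: "L2_on S f" and g: "L2_on S g"
  shows "set_integrable lborel S (\<lambda>x. f x * g x)"
proof (rule set_integrable_bound)
  show "set_integrable lborel S (\<lambda>x. (cmod (f x))\<^sup>2 + (cmod (g x))\<^sup>2)"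
    by (intro set_integral_add L2_on_square f g)
  show "set_borel_measurable lborel S (\<lambda>x. f x * g x)"
    by (intro set_borel_measurable_mult L2_on_measurable f g)
  have "cmod (a * b) \<le> (cmod a)\<^sup>2 + (cmod b)\<^sup>2" for a b
    using sum_squares_bound[of "cmod a" "cmod b"] zero_le_mult_iff[of "cmod a" "cmod b"]
    unfolding norm_mult by (auto intro: order_trans[rotated])
  then show "AE x in lborel. x \<in> S \<longrightarrow> norm (f x * g x) \<le> norm ((cmod (f x))\<^sup>2 + (cmod (g x))\<^sup>2)"
    by auto
qed

lemma L2_on_bounded:
  assumes m: "set_borel_measurable lborel S f" and S: "S \<in> sets borel" "S \<subseteq> {l..m}"
    and B: "\<And>x. x \<in> S \<Longrightarrow> cmod (f x) \<le> B"
  shows "L2_on S f"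
  unfolding L2_on_def
proof
  show "set_integrable lborel S (\<lambda>x. (cmod (f x))\<^sup>2)"
  proof (rule set_integrable_bound)
    have "set_integrable lborel {l..m} (\<lambda>x. B\<^sup>2)" by (intro borel_integrable_atLeastAtMost' continuous_intros)
    then show "set_integrable lborel S (\<lambda>x. B\<^sup>2)" by (rule set_integrable_subset) (use S in auto)
    show "set_borel_measurable lborel S (\<lambda>x. (cmod (f x))\<^sup>2)"
      by (rule set_borel_measurable_cmod_square[OF m S(1)])
    show "AE x in lborel. x \<in> S \<longrightarrow> norm ((cmod (f x))\<^sup>2) \<le> norm (B\<^sup>2)"
      using B by (auto intro!: power_mono)
  qed
qed (rule m)

lemma L2_on_const: 
  assumes "S \<in> sets borel" "S \<subseteq> {l..m}"
  shows "L2_on S (\<lambda>x. c)"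
  by (rule L2_on_bounded[OF _ assms, of _ "cmod c"])
    (auto intro!: set_borel_measurable_continuous_on assms continuous_intros)

lemma L2_on_continuous:
  assumes f: "continuous_on {l..m} f" and S: "S \<in> sets borel" "S \<subseteq> {l..m}"
  shows "L2_on S f"
  using L2_on_continuous_mult[OF L2_on_const[OF S, of 1] f S] by simp

lemma L2_on_integrable:
  assumes "L2_on S f" "S \<in> sets borel" "S \<subseteq> {l..m}"
  shows "set_integrable lborel S f"
  using L2_on_mult_integrable[OF assms(1) L2_on_const[OF assms(2,3), of 1]] by simp

lemma L2_on_Un:
  assumes "L2_on A f" "L2_on B f" "A \<in> sets borel" "B \<in> sets borel"
  shows "L2_on (A \<union> B) f"
  using assms unfolding L2_on_def by (auto intro!: set_borel_measurable_Un set_integrable_Un)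

lemma L2_on_cnj:
  assumes "L2_on S f" "S \<in> sets borel"
  shows "L2_on S (\<lambda>z. cnj (f z))"
  by (rule L2_on_bound[OF _ assms(1), of _ 1])
    (auto intro!: set_borel_measurable_comp[OF L2_on_measurable[OF assms(1)]] borel_measurable_continuous_onI continuous_intros assms(2))

text \<open>On \<open>{c}\<close> every function is bounded and measurable. This joins the two open
  half periods across \<open>0\<close> and passes from open to closed intervals.\<close>

lemma L2_on_null_diff:
  assumes "L2_on A f" "B \<subseteq> A \<union> {c}" "A \<in> sets borel" "B \<in> sets borel"
  shows "L2_on B f"
proof -
  have "L2_on {c} f"
    by (rule L2_on_bounded[of _ _ c c "cmod (f c)"]) (auto intro!: set_borel_measurable_continuous_on)
  from L2_on_Un[OF assms(1) this assms(3)] show ?thesis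
    by (rule L2_on_subset) (use assms in auto)
qed

subsection \<open>Test functions\<close>

text \<open>Smoothness in a form suited to induction: the recursion goes through
  \<open>deriv f\<close>, so closure under sums, products and affine substitutions follows by
  induction on \<open>n\<close> for all functions at once. Note the shift: \<open>Ck n\<close>
  demands \<open>n + 1\<close> derivatives.\<close>

primrec Ck :: "nat \<Rightarrow> (real \<Rightarrow> real) \<Rightarrow> bool" where
  "Ck 0 f \<longleftrightarrow> (\<forall>x. f differentiable (at x))"
| "Ck (Suc n) f \<longleftrightarrow> (\<forall>x. f differentiable (at x)) \<and> Ck n (deriv f)"

lemma Ck_differentiable: "Ck n f \<Longrightarrow> f differentiable (at x)"
  by (cases n) auto

lemma Ck_SucI:
  assumes "\<And>x. (f has_real_derivative f' x) (at x)" "Ck n f'"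
  shows "Ck (Suc n) f"
proof -
  have "deriv f = f'" using assms(1) by (auto intro: DERIV_imp_deriv)
  with assms show ?thesis by (auto simp: real_differentiable_def)
qed

lemma Ck_SucD:
  assumes "Ck (Suc n) f"
  shows "Ck n f" "(f has_real_derivative deriv f x) (at x)"
proof -
  show "(f has_real_derivative deriv f x) (at x)"
    using assms by (simp add: DERIV_deriv_iff_real_differentiable)
  show "Ck n f" using assms by (induction n arbitrary: f) auto
qed

lemma Ck_deriv_power: "(\<forall>n. Ck n f) \<longleftrightarrow> (\<forall>n x. ((deriv ^^ n) f) differentiable (at x))"
proof -
  have "Ck n f \<longleftrightarrow> (\<forall>k\<le>n. \<forall>x. ((deriv ^^ k) f) differentiable (at x))" for n
  proof (induction n arbitrary: f)
    case (Suc n)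
    have "(\<forall>k\<le>Suc n. \<forall>x. ((deriv ^^ k) f) differentiable (at x)) \<longleftrightarrow>
      (\<forall>x. f differentiable (at x)) \<and> (\<forall>k\<le>n. \<forall>x. ((deriv ^^ Suc k) f) differentiable (at x))"
      by (metis Suc_le_mono funpow_0 le0 not0_implies_Suc)
    also have "\<dots> \<longleftrightarrow> Ck (Suc n) f" by (simp add: Suc funpow_swap1)
    finally show ?case ..
  qed simp
  then show ?thesis by auto
qed

lemma Ck_const: "Ck n (\<lambda>x. c)"
proof (induction n arbitrary: c)
  case (Suc n) show ?case by (rule Ck_SucI[where f'="\<lambda>x. 0"]) (auto intro: Suc)
qed auto

lemma Ck_add: "Ck n f \<Longrightarrow> Ck n g \<Longrightarrow> Ck n (\<lambda>x. f x + g x)"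
proof (induction n arbitrary: f g)
  case (Suc n)
  show ?case
    by (rule Ck_SucI[where f'="\<lambda>x. deriv f x + deriv g x"])
       (use Suc Ck_SucD(2) in \<open>auto intro!: DERIV_add\<close>)
qed auto

lemma Ck_mult: "Ck n f \<Longrightarrow> Ck n g \<Longrightarrow> Ck n (\<lambda>x. f x * g x)"
proof (induction n arbitrary: f g)
  case (Suc n)
  show ?case
  proof (rule Ck_SucI[where f'="\<lambda>x. deriv f x * g x + deriv g x * f x"])
    show "((\<lambda>x. f x * g x) has_real_derivative deriv f x * g x + deriv g x * f x) (at x)" for x
      by (rule DERIV_mult) (use Suc.prems Ck_SucD(2) in auto)
    show "Ck n (\<lambda>x. deriv f x * g x + deriv g x * f x)"
      using Suc.prems Ck_SucD(1) by (intro Ck_add Suc.IH) auto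
  qed
qed auto

lemma Ck_affine: "Ck n f \<Longrightarrow> Ck n (\<lambda>x. f (a * x + b))"
proof (induction n arbitrary: f)
  case 0
  have "(\<lambda>x. f (a * x + b)) differentiable (at x)" for x
    by (rule differentiable_compose) (use 0 in auto)
  then show ?case by simp
next
  case (Suc n)
  show ?case
  proof (rule Ck_SucI[where f'="\<lambda>x. deriv f (a * x + b) * a"])
    show "((\<lambda>x. f (a * x + b)) has_real_derivative deriv f (a * x + b) * a) (at x)" for x
      by (rule DERIV_chain2[where f=f]) (use Suc.prems Ck_SucD(2) in \<open>auto intro!: derivative_eq_intros\<close>)
    show "Ck n (\<lambda>x. deriv f (a * x + b) * a)"
      using Suc.prems by (intro Ck_mult[OF Suc.IH Ck_const]) auto
  qed
qed

section \<open>Smooth cut-off functions\<close>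

text \<open>For \<open>m = 0\<close> the classical smooth non-analytic function. The powers of
  \<open>1 / x\<close> make the linear span of the family closed under differentiation, so that one
  induction gives smoothness of all members.\<close>

definition flat :: "nat \<Rightarrow> real \<Rightarrow> real" where
  "flat m x = (if x > 0 then (1 / x) ^ m * exp (- 1 / x) else 0)"

lemma flat_deriv: "(flat m has_real_derivative flat (m + 2) x + (- real m) * flat (m + 1) x) (at x)"
proof -
  consider "x > 0" | "x < 0" | "x = 0" by linarith
  then show ?thesis
  proof cases
    case 1
    have *: "((\<lambda>x. (1 / x) ^ m * exp (- 1 / x)) has_real_derivative
        flat (m + 2) x + (- real m) * flat (m + 1) x) (at x)"
    proof -
      have d1: "((\<lambda>x. 1 / x) has_real_derivative - ((1 / x)\<^sup>2)) (at x)"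
        using 1 by (auto intro!: derivative_eq_intros simp: power2_eq_square)
      have d2: "((\<lambda>x. exp (- 1 / x)) has_real_derivative exp (- 1 / x) * (1 / x)\<^sup>2) (at x)"
        using 1 by (auto intro!: derivative_eq_intros simp: power2_eq_square)
      show ?thesis
      proof (cases m)
        case 0
        then show ?thesis using d2 1 by (simp add: flat_def power2_eq_square)
      next
        case (Suc k)
        have "(1 / x) ^ Suc k * (exp (- 1 / x) * (1 / x)\<^sup>2) + (1 + real k) * (- ((1 / x)\<^sup>2) * (1 / x) ^ k) * exp (- 1 / x)
          = flat (m + 2) x + (- real m) * flat (m + 1) x"
        proof -
          have "y ^ Suc k * (e * y\<^sup>2) + (1 + real k) * (- (y\<^sup>2) * y ^ k) * e
            = y ^ (Suc k + 2) * e + (- real (Suc k)) * (y ^ (Suc k + 1) * e)" for y e :: real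
            by (simp add: power2_eq_square algebra_simps)
          from this[of "1 / x" "exp (- 1 / x)"] 1 show ?thesis unfolding flat_def Suc by (simp only: if_True)
        qed
        with DERIV_mult'[OF DERIV_power_Suc[OF d1, of k] d2] show ?thesis unfolding Suc by simp
      qed
    qed
    have "eventually (\<lambda>y. y > 0) (nhds x)" using eventually_nhds_in_open[of "{0<..}" x] 1 by simp
    then have "eventually (\<lambda>y. flat m y = (1 / y) ^ m * exp (- 1 / y)) (nhds x)"
      by eventually_elim (simp add: flat_def)
    from DERIV_cong_ev[OF refl this refl] * show ?thesis by blast
  next
    case 2
    have "eventually (\<lambda>y. y < 0) (nhds x)" using eventually_nhds_in_open[of "{..<0}" x] 2 by simp
    then have "eventually (\<lambda>y. flat m y = 0) (nhds x)"
      by eventually_elim (simp add: flat_def)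
    from DERIV_cong_ev[OF refl this refl, of 0] have "(flat m has_real_derivative 0) (at x)" by simp
    moreover have "flat (m + 2) x + (- real m) * flat (m + 1) x = 0" using 2 by (simp add: flat_def)
    ultimately show ?thesis by (simp only:)
  next
    case 3
    \<comment> \<open>With \<open>y = 1 / h\<close> the difference quotient at 0 from the right is
      \<open>y ^ (m + 1) / exp y\<close>, which tends to 0 as \<open>y\<close> grows.\<close>
    have "((\<lambda>h. flat m h / h) \<longlongrightarrow> 0) (at_right 0)"
    proof (rule Lim_transform_eventually)
      show "((\<lambda>h. (inverse h) ^ (m + 1) / exp (inverse h)) \<longlongrightarrow> 0) (at_right (0::real))"
        by (rule filterlim_compose[OF tendsto_power_div_exp_0 filterlim_inverse_at_top_right])
      show "\<forall>\<^sub>F h in at_right 0. (inverse h) ^ (m + 1) / exp (inverse h) = flat m h / h"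
        unfolding eventually_at_filter
        by (rule always_eventually) (auto simp: flat_def exp_minus field_simps)
    qed
    moreover have "((\<lambda>h. flat m h / h) \<longlongrightarrow> 0) (at_left 0)"
    proof (rule Lim_transform_eventually[OF tendsto_const])
      show "\<forall>\<^sub>F h in at_left 0. 0 = flat m h / h"
        unfolding eventually_at_filter
        by (rule always_eventually) (auto simp: flat_def)
    qed
    ultimately have "((\<lambda>h. flat m h / h) \<longlongrightarrow> 0) (at 0)" by (simp add: filterlim_split_at)
    then have "(flat m has_real_derivative 0) (at 0)"
      unfolding DERIV_def by (simp add: flat_def)
    moreover have "flat (m + 2) x + (- real m) * flat (m + 1) x = 0" using 3 by (simp add: flat_def)
    ultimately show ?thesis using 3 by (simp only:)
  qed
qed

lemma Ck_flat: "Ck n (flat m)"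
proof (induction n arbitrary: m)
  case 0 show ?case using flat_deriv by (auto simp: real_differentiable_def)
next
  case (Suc n)
  show ?case by (rule Ck_SucI[OF flat_deriv]) (intro Ck_add Ck_mult Ck_const Suc)
qed

lemma flat_0_bounds: "0 \<le> flat 0 x" "flat 0 x \<le> 1"
  by (auto simp: flat_def)

lemma test_fun_alt:
  "test_fun \<phi> \<longleftrightarrow> (\<forall>n. Ck n \<phi>) \<and> (\<exists>a b. -pi < a \<and> b < pi \<and> (\<forall>x. x \<notin> {a..b} \<longrightarrow> \<phi> x = 0))"
  by (simp add: test_fun_def Ck_deriv_power)

lemma test_fun_continuous:
  assumes "test_fun \<phi>"
  shows "continuous_on S \<phi>" "continuous_on S (deriv \<phi>)" "(\<phi> has_real_derivative deriv \<phi> x) (at x)"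
proof -
  from assms have C: "Ck 2 \<phi>" by (simp add: test_fun_alt)
  then show D: "(\<phi> has_real_derivative deriv \<phi> x) (at x)" for x
    using Ck_SucD(2)[of 1] by (simp add: numeral_2_eq_2)
  then show "continuous_on S \<phi>" by (meson DERIV_isCont continuous_at_imp_continuous_on)
  from C have "Ck 1 (deriv \<phi>)" by (simp add: numeral_2_eq_2)
  then show "continuous_on S (deriv \<phi>)"
    by (meson Ck_differentiable continuous_at_imp_continuous_on differentiable_imp_continuous_within)
qed

lemma test_fun_combine:
  assumes "test_fun f" "test_fun g"
  shows "test_fun (\<lambda>x. f x + c * g x)"
proof -
  obtain a b where ab: "-pi < a" "b < pi" "\<And>x. x \<notin> {a..b} \<Longrightarrow> f x = 0" using assms by (auto simp: test_fun_alt)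
  obtain a' b' where ab': "-pi < a'" "b' < pi" "\<And>x. x \<notin> {a'..b'} \<Longrightarrow> g x = 0" using assms by (auto simp: test_fun_alt)
  have "f x + c * g x = 0" if "x \<notin> {min a a'..max b b'}" for x
    using ab(3)[of x] ab'(3)[of x] that by (auto simp: min_def max_def split: if_splits)
  moreover have "-pi < min a a'" "max b b' < pi" using ab ab' by auto
  moreover have "\<forall>n. Ck n (\<lambda>x. f x + c * g x)"
    using assms by (auto simp: test_fun_alt intro!: Ck_add Ck_mult Ck_const)
  ultimately show ?thesis unfolding test_fun_alt by blast
qed

text \<open>A smooth approximation from below of the indicator of \<open>(p, q)\<close>. The inner
  shift by 1 confines the support to \<open>[p + 1 / n, q - 1 / n]\<close>, which is compact in
  \<open>(-pi, pi)\<close> even for \<open>p = -pi\<close> and \<open>q = pi\<close>; the outer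
  factor \<open>n\<close> drives the arguments to infinity inside \<open>(p, q)\<close>, where
  \<open>flat 0\<close> tends to 1.\<close>

definition plateau :: "real \<Rightarrow> real \<Rightarrow> nat \<Rightarrow> real \<Rightarrow> real" where
  "plateau p q n x = flat 0 (real n * (real n * (x - p) - 1)) * flat 0 (real n * (real n * (q - x) - 1))"

lemma plateau_bounds: "0 \<le> plateau p q n x" "plateau p q n x \<le> 1"
  unfolding plateau_def using flat_0_bounds by (auto intro!: mult_le_one)

lemma plateau_test_fun:
  assumes "n > 0" "-pi \<le> p" "q \<le> pi"
  shows "test_fun (plateau p q n)"
proof -
  have "Ck k (\<lambda>x. flat 0 ((real n)\<^sup>2 * x + (- (real n)\<^sup>2 * p - real n)) * flat 0 (-(real n)\<^sup>2 * x + ((real n)\<^sup>2 * q - real n)))" for k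
    by (intro Ck_mult Ck_affine Ck_flat)
  moreover have "(\<lambda>x. flat 0 ((real n)\<^sup>2 * x + (- (real n)\<^sup>2 * p - real n)) * flat 0 (-(real n)\<^sup>2 * x + ((real n)\<^sup>2 * q - real n)))
      = plateau p q n"
    unfolding plateau_def by (rule ext) (simp add: algebra_simps power2_eq_square)
  moreover have "plateau p q n x = 0" if "x \<notin> {p + 1 / n..q - 1 / n}" for x
  proof -
    have "real n * (x - p) - 1 \<le> 0 \<or> real n * (q - x) - 1 \<le> 0"
      using that assms(1) by (auto simp: field_simps)
    then have "real n * (real n * (x - p) - 1) \<le> 0 \<or> real n * (real n * (q - x) - 1) \<le> 0"
      by (meson mult_nonneg_nonpos of_nat_0_le_iff)
    then show ?thesis by (elim disjE) (simp_all add: plateau_def flat_def not_less[symmetric])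
  qed
  moreover have "-pi < p + 1 / n" "q - 1 / n < pi" 
  proof -
    have "1 / real n > 0" using assms(1) by simp
    then show "-pi < p + 1 / n" "q - 1 / n < pi" using assms(2,3) by linarith+
  qed
  ultimately show ?thesis unfolding test_fun_alt
    by (intro conjI allI exI[of _ "p + 1 / n"] exI[of _ "q - 1 / n"] impI) simp_all
qed

lemma plateau_tendsto: "(\<lambda>n. plateau p q n x) \<longlonglongrightarrow> indicat_real {p<..<q} x"
proof -
  have flat: "(\<lambda>n. flat 0 (real n * (real n * d - 1))) \<longlonglongrightarrow> (if d > 0 then 1 else 0)" for d
  proof (cases "d > 0")
    case True
    have lim: "filterlim (\<lambda>n. real n * (real n * d - 1)) at_top sequentially"
      using True by real_asymp
    have "((\<lambda>y. exp (- 1 / y)) \<longlongrightarrow> 1) (at_top :: real filter)" by real_asymp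
    moreover have "\<forall>\<^sub>F y in at_top. exp (- 1 / y) = flat 0 y"
      using eventually_gt_at_top[of 0] by eventually_elim (simp add: flat_def)
    ultimately have "(flat 0 \<longlongrightarrow> 1) at_top" by (rule Lim_transform_eventually)
    from filterlim_compose[OF this lim] True show ?thesis by simp
  next
    case False
    have "real n * (real n * d - 1) \<le> 0" for n
      using False by (intro mult_nonneg_nonpos) (auto simp: mult_le_0_iff intro: order_trans[of _ 0])
    then have "flat 0 (real n * (real n * d - 1)) = 0" for n unfolding flat_def by (meson not_less)
    with False show ?thesis by simp
  qed
  show ?thesis
    using tendsto_mult[OF flat[of "x - p"] flat[of "q - x"]]
    by (simp add: plateau_def indicator_def)
      (auto split: if_splits)
qed

subsection \<open>The lemma of du Bois-Reymond\<close>

lemma set_integrable_mult_test: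
  assumes W: "set_integrable lborel Iper W" and c: "continuous_on UNIV \<psi>"
  shows "set_integrable lborel Iper (\<lambda>x. W x * complex_of_real (\<psi> x))"
proof -
  have "set_integrable lborel {-pi..pi} (\<lambda>x. W x * complex_of_real (\<psi> x))"
    by (rule set_integrable_continuous_mult)
      (use W in \<open>auto simp: set_integrable_Icc_Ioo intro!: continuous_intros continuous_on_subset[OF c]\<close>)
  then show ?thesis by (simp add: set_integrable_Icc_Ioo)
qed

lemma plateau_integral_tendsto:
  fixes f :: "real \<Rightarrow> complex"
  assumes f: "integrable lborel f"
  shows "(\<lambda>n. LINT x|lborel. f x * complex_of_real (plateau p q n x)) \<longlonglongrightarrow> (LINT x:{p<..<q}|lborel. f x)"
proof -
  have c: "continuous_on UNIV (plateau p q n)" for n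
  proof -
    have "continuous_on UNIV (flat 0)"
      using flat_deriv by (meson DERIV_isCont continuous_at_imp_continuous_on)
    then have *: "continuous_on UNIV (\<lambda>x. flat 0 (a x))" if "continuous_on UNIV a" for a :: "real \<Rightarrow> real"
      by (rule continuous_on_compose2) (use that in auto)
    show ?thesis unfolding plateau_def
      by (intro continuous_intros *)
  qed
  have "(\<lambda>n. LINT x|lborel. f x * complex_of_real (plateau p q n x))
    \<longlonglongrightarrow> (LINT x|lborel. f x * complex_of_real (indicat_real {p<..<q} x))"
  proof (rule integral_dominated_convergence[where w="\<lambda>x. norm (f x)"])
    show "(\<lambda>x. f x * complex_of_real (indicat_real {p<..<q} x)) \<in> borel_measurable lborel"
      using borel_measurable_integrable[OF f] by measurable
    show "(\<lambda>x. f x * complex_of_real (plateau p q n x)) \<in> borel_measurable lborel" for n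
    proof -
      have [measurable]: "plateau p q n \<in> borel_measurable borel" by (rule borel_measurable_continuous_onI[OF c])
      show ?thesis using borel_measurable_integrable[OF f] by measurable
    qed
    show "integrable lborel (\<lambda>x. norm (f x))" using f by simp
    show "AE x in lborel. (\<lambda>n. f x * complex_of_real (plateau p q n x)) \<longlonglongrightarrow> f x * complex_of_real (indicat_real {p<..<q} x)"
      by (intro AE_I2 tendsto_intros plateau_tendsto)
    show "AE x in lborel. norm (f x * complex_of_real (plateau p q n x)) \<le> norm (f x)" for n
      using plateau_bounds by (intro AE_I2) (auto simp: norm_mult intro!: mult_left_le)
  qed
  moreover have "(LINT x|lborel. f x * complex_of_real (indicat_real {p<..<q} x)) = (LINT x:{p<..<q}|lborel. f x)"
    unfolding set_lebesgue_integral_def by (intro Bochner_Integration.integral_cong) (auto simp: indicator_def)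
  ultimately show ?thesis by simp
qed

lemma set_integral_indicator_mult:
  "(LINT x:S|lborel. W x * complex_of_real (\<psi> x)) = (LINT x|lborel. (indicat_real S x *\<^sub>R W x) * complex_of_real (\<psi> x))"
  unfolding set_lebesgue_integral_def by (intro Bochner_Integration.integral_cong) auto

text \<open>Plateaus and dominated convergence give zero integral over every open interval. Open
  intervals form an intersection-stable generator of the Borel sets, so Dynkin's argument extends
  this to all Borel sets, and a function whose integral over every Borel set is zero vanishes almost
  everywhere.\<close>

lemma test_fun_null:
  assumes W: "set_integrable lborel Iper W"
    and null: "\<And>\<phi>. test_fun \<phi> \<Longrightarrow> (LINT x:Iper|lborel. W x * complex_of_real (\<phi> x)) = 0"
  shows "AE x in lborel. x \<in> Iper \<longrightarrow> W x = 0"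
proof -
  define f where "f x = indicat_real Iper x *\<^sub>R W x" for x
  have f: "integrable lborel f" using W by (simp add: f_def[abs_def] set_integrable_def)
  have si: "set_integrable lborel A f" if "A \<in> sets borel" for A
    unfolding set_integrable_def by (intro integrable_mult_indicator f) (use that in simp)
  have sb: "sets (borel :: real measure) = sigma_sets UNIV (range (\<lambda>(a, b). box a b :: real set))"
    by (subst borel_eq_box, rule sets_measure_of) simp
  have 1: "(LINT x:{p<..<q}|lborel. f x) = 0" if "-pi \<le> p" "q \<le> pi" for p q
  proof (rule LIMSEQ_unique)
    show "(\<lambda>n. LINT x|lborel. f x * complex_of_real (plateau p q n x)) \<longlonglongrightarrow> (LINT x:{p<..<q}|lborel. f x)"
      by (rule plateau_integral_tendsto[OF f])
    have "(LINT x|lborel. f x * complex_of_real (plateau p q n x)) = 0" if "n > 0" for n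
      using null[OF plateau_test_fun[OF that \<open>-pi \<le> p\<close> \<open>q \<le> pi\<close>]] unfolding set_integral_indicator_mult f_def .
    then show "(\<lambda>n. LINT x|lborel. f x * complex_of_real (plateau p q n x)) \<longlonglongrightarrow> 0"
      by (intro tendsto_eventually eventually_mono[OF eventually_gt_at_top[of 0]])
  qed
  have 2: "(LINT x:A|lborel. f x) = 0" if "A \<in> sigma_sets UNIV (range (\<lambda>(a, b). box a b :: real set))" for A
  proof (rule sigma_sets_induct_disjoint[OF _ _ that])
    show "Int_stable (range (\<lambda>(a, b). box a b :: real set))"
      unfolding Int_stable_def by (auto simp: box_Int_box image_iff)
    show "range (\<lambda>(a, b). box a b :: real set) \<subseteq> Pow UNIV" by simp
    show "(LINT x:{}|lborel. f x) = 0" by (simp add: set_lebesgue_integral_def)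
  next
    fix A assume "A \<in> range (\<lambda>(a, b). box a b :: real set)"
    then obtain a b :: real where A: "A = {a<..<b}" by auto
    have "(LINT x:A|lborel. f x) = (LINT x:{max a (-pi)<..<min b pi}|lborel. f x)"
      unfolding set_lebesgue_integral_def A
      by (intro Bochner_Integration.integral_cong) (auto simp: f_def indicator_def)
    with 1[of "max a (-pi)" "min b pi"] show "(LINT x:A|lborel. f x) = 0" by simp
  next
    fix A assume A: "A \<in> sigma_sets UNIV (range (\<lambda>(a, b). box a b :: real set))" "(LINT x:A|lborel. f x) = 0"
    from A(1) have Ab: "A \<in> sets borel" unfolding sb .
    have "(LINT x:A \<union> (UNIV - A)|lborel. f x) = (LINT x:A|lborel. f x) + (LINT x:UNIV - A|lborel. f x)"
      by (rule set_integral_Un) (use Ab in \<open>auto intro!: si\<close>)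
    moreover have "(LINT x:UNIV|lborel. f x) = (LINT x:{-pi<..<pi}|lborel. f x)"
      unfolding set_lebesgue_integral_def
      by (intro Bochner_Integration.integral_cong) (auto simp: f_def indicator_def)
    ultimately show "(LINT x:UNIV - A|lborel. f x) = 0" using A(2) 1[of "-pi" pi] by simp
  next
    fix A :: "nat \<Rightarrow> real set"
    assume d: "disjoint_family A" and r: "range A \<subseteq> sigma_sets UNIV (range (\<lambda>(a, b). box a b :: real set))"
      and z: "\<And>i. (LINT x:A i|lborel. f x) = 0"
    have Ab: "A i \<in> sets borel" for i unfolding sb using r by (rule subsetD) (rule rangeI)
    have "(LINT x:(\<Union>i. A i)|lborel. f x) = (\<Sum>i. LINT x:A i|lborel. f x)"
      by (rule lebesgue_integral_countable_add)
         (use Ab d in \<open>auto intro!: si sets.countable_UN simp: disjoint_family_on_def\<close>)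
    then show "(LINT x:(\<Union>i. A i)|lborel. f x) = 0" by (simp add: z)
  qed
  have "AE x in lborel. f x = 0"
  proof (rule sigma_finite_measure.density_zero[OF sigma_finite_lborel f])
    fix A :: "real set" assume "A \<in> sets lborel"
    then have "A \<in> sigma_sets UNIV (range (\<lambda>(a, b). box a b :: real set))"
      unfolding sets_lborel sb .
    then show "(LINT x:A|lborel. f x) = 0" by (rule 2)
  qed
  then show ?thesis by eventually_elim (auto simp: f_def)
qed

text \<open>The primitive from \<open>-pi\<close> is 0 to the left of the support; zero mean is
  precisely what makes it return to 0 on the right.\<close>

lemma test_fun_antideriv:
  assumes t: "test_fun \<eta>" and z: "(LINT x:Iper|lborel. complex_of_real (\<eta> x)) = 0"
  shows "\<exists>\<phi>. test_fun \<phi> \<and> deriv \<phi> = \<eta>"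
proof -
  obtain a b where ab: "-pi < a" "b < pi" "\<And>x. x \<notin> {a..b} \<Longrightarrow> \<eta> x = 0"
    using t by (auto simp: test_fun_alt)
  note c = test_fun_continuous(1)[OF t]
  define \<phi> where "\<phi> x = integral {-pi..x} \<eta>" for x
  have \<phi>0: "\<phi> x = 0" if "x < a" for x
  proof -
    have "\<phi> x = integral {-pi..x} (\<lambda>x. 0)"
      unfolding \<phi>_def by (rule integral_cong) (use that ab in auto)
    then show ?thesis by simp
  qed
  have i: "\<eta> integrable_on {p..q}" for p q by (intro integrable_continuous_interval c)
  have "set_integrable lborel {-pi..pi} \<eta>" by (intro borel_integrable_atLeastAtMost' c)
  then have "integral {-pi..pi} \<eta> = (LINT x:{-pi..pi}|lborel. \<eta> x)"
    by (rule set_borel_integral_eq_integral(2)[symmetric])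
  also have "\<dots> = 0"
    using z unfolding set_integral_complex_of_real by (simp add: set_integral_Icc_Ioo)
  finally have tot: "integral {-pi..pi} \<eta> = 0" .
  have \<phi>1: "\<phi> x = 0" if "x > b" for x
  proof -
    consider "x < a" | "a \<le> x" "x \<le> pi" | "x > pi" by linarith
    then show ?thesis
    proof cases
      case 2
      have "integral {x..pi} \<eta> = integral {x..pi} (\<lambda>x. 0)"
        by (rule integral_cong) (use that ab in auto)
      then show ?thesis
        using Henstock_Kurzweil_Integration.integral_combine[where a="-pi" and c=x and b=pi and f=\<eta>] 2 ab tot i by (simp add: \<phi>_def)
    next
      case 3
      have "integral {pi..x} \<eta> = integral {pi..x} (\<lambda>x. 0)"
        by (rule integral_cong) (use that ab in auto)
      then show ?thesis
        using Henstock_Kurzweil_Integration.integral_combine[where a="-pi" and c=pi and b=x and f=\<eta>] 3 ab tot i by (simp add: \<phi>_def)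
    qed (use \<phi>0 in auto)
  qed
  have D: "(\<phi> has_real_derivative \<eta> x) (at x)" for x
  proof (cases "x < a")
    case True
    have "eventually (\<lambda>y. y < a) (nhds x)" using eventually_nhds_in_open[of "{..<a}" x] True by simp
    then have "eventually (\<lambda>y. \<phi> y = 0) (nhds x)" by eventually_elim (rule \<phi>0)
    from DERIV_cong_ev[OF refl this refl, of 0] have "(\<phi> has_real_derivative 0) (at x)" by simp
    with ab(3)[of x] True show ?thesis by simp
  next
    case False
    have "(\<phi> has_real_derivative \<eta> x) (at x within {-pi..x + 1})"
      unfolding \<phi>_def by (rule integral_has_real_derivative[OF c]) (use False ab in auto)
    moreover have "at x within {-pi..x + 1} = at x"
      by (rule at_within_interior) (use False ab in auto)
    ultimately show ?thesis by simp
  qed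
  then have "deriv \<phi> = \<eta>" by (auto intro: DERIV_imp_deriv)
  moreover have "Ck n \<phi>" for n
  proof (cases n)
    case 0 with D show ?thesis by (auto simp: real_differentiable_def)
  next
    case (Suc k)
    show ?thesis unfolding Suc by (rule Ck_SucI[OF D]) (use t in \<open>simp add: test_fun_alt\<close>)
  qed
  moreover have "\<phi> x = 0" if "x \<notin> {a..b}" for x using that \<phi>0[of x] \<phi>1[of x] by auto
  ultimately show ?thesis using ab unfolding test_fun_alt by blast
qed

text \<open>Fix a test function \<open>\<psi>0\<close> with nonzero integral. Any test function
  becomes one of zero mean, hence a derivative, after adding a multiple of \<open>\<psi>0\<close>.
  So testing against \<open>W\<close> is \<open>c\<close> times integration with
  \<open>c = J \<psi>0 / I \<psi>0\<close>, and \<open>W - c\<close> is annihilated by all test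
  functions.\<close>

lemma du_Bois_Reymond:
  assumes W: "set_integrable lborel Iper W"
    and null: "\<And>\<phi>. test_fun \<phi> \<Longrightarrow> (LINT x:Iper|lborel. W x * complex_of_real (deriv \<phi> x)) = 0"
  shows "\<exists>c. AE x in lborel. x \<in> Iper \<longrightarrow> W x = c"
proof -
  define I where "I \<psi> = (LINT x:Iper|lborel. complex_of_real (\<psi> x))" for \<psi> :: "real \<Rightarrow> real"
  have one: "set_integrable lborel Iper (\<lambda>x. 1 :: complex)"
    by (rule L2_on_integrable[OF L2_on_const[of Iper "-pi" pi 1], of "-pi" pi]) auto
  \<comment> \<open>A test function with nonzero integral is found among the plateaus on the full
    period, whose integrals tend to \<open>2 pi\<close>.\<close>
  have "(\<lambda>n. LINT x|lborel. (indicat_real Iper x *\<^sub>R (1::complex)) * complex_of_real (plateau (-pi) pi n x))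
      \<longlonglongrightarrow> (LINT x:Iper|lborel. indicat_real Iper x *\<^sub>R (1::complex))"
    by (rule plateau_integral_tendsto) (use one in \<open>simp add: set_integrable_def\<close>)
  moreover have "(LINT x:Iper|lborel. indicat_real Iper x *\<^sub>R (1::complex)) = complex_of_real (2 * pi)"
  proof -
    have "(LINT x:Iper|lborel. indicat_real Iper x *\<^sub>R (1::complex)) = (LINT x:Iper|lborel. 1)"
      by (rule set_lebesgue_integral_cong) auto
    then show ?thesis by (simp add: set_lebesgue_integral_def scaleR_conv_of_real)
  qed
  ultimately have lim: "(\<lambda>n. I (plateau (-pi) pi n)) \<longlonglongrightarrow> complex_of_real (2 * pi)"
    unfolding I_def using set_integral_indicator_mult[of Iper "\<lambda>x. 1"] by simp
  have "\<forall>\<^sub>F n in sequentially. I (plateau (-pi) pi n) \<noteq> 0"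
    by (rule tendsto_imp_eventually_ne[OF lim]) simp
  then obtain n where n: "n > 0" "I (plateau (-pi) pi n) \<noteq> 0"
    using eventually_conj[OF _ eventually_gt_at_top[of 0]] eventually_happens'[OF sequentially_bot] by (smt (verit) eventually_conj_iff)
  define \<psi>0 where "\<psi>0 = plateau (-pi) pi n"
  have \<psi>0: "test_fun \<psi>0" unfolding \<psi>0_def by (rule plateau_test_fun) (use n in auto)
  have I_mult: "(LINT x:Iper|lborel. 1 * complex_of_real (\<psi> x)) = I \<psi>" for \<psi> by (simp add: I_def)
  define r where "r = Re (I \<psi>0)"
  have I_real: "I \<psi> = complex_of_real (Re (I \<psi>))" for \<psi>
    unfolding I_def set_integral_complex_of_real by simp
  have r: "r \<noteq> 0" using n(2) I_real[of \<psi>0] by (auto simp: r_def \<psi>0_def)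
  define J where "J \<psi> = (LINT x:Iper|lborel. W x * complex_of_real (\<psi> x))" for \<psi> :: "real \<Rightarrow> real"
  define c where "c = J \<psi>0 / r"
  have J: "J \<psi> = c * I \<psi>" if t: "test_fun \<psi>" for \<psi>
  proof -
    \<comment> \<open>Test functions are real valued, so the multiplier has to be real although
      \<open>I\<close> takes complex values.\<close>
    define k where "k = - Re (I \<psi>) / r"
    define \<eta> where "\<eta> x = \<psi> x + k * \<psi>0 x" for x
    have \<eta>: "test_fun \<eta>" unfolding \<eta>_def by (rule test_fun_combine[OF t \<psi>0])
    have lin: "(LINT x:Iper|lborel. w x * complex_of_real (\<eta> x)) =
       (LINT x:Iper|lborel. w x * complex_of_real (\<psi> x)) + k * (LINT x:Iper|lborel. w x * complex_of_real (\<psi>0 x))"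
      if "set_integrable lborel Iper w" for w
    proof -
      have i: "set_integrable lborel Iper (\<lambda>x. w x * complex_of_real (\<psi> x))"
          "set_integrable lborel Iper (\<lambda>x. w x * complex_of_real (\<psi>0 x))"
        by (intro set_integrable_mult_test that test_fun_continuous t \<psi>0)+
      have "(LINT x:Iper|lborel. w x * complex_of_real (\<eta> x))
         = (LINT x:Iper|lborel. w x * complex_of_real (\<psi> x) + k * (w x * complex_of_real (\<psi>0 x)))"
        by (simp add: \<eta>_def algebra_simps)
      also have "\<dots> = (LINT x:Iper|lborel. w x * complex_of_real (\<psi> x)) + (LINT x:Iper|lborel. k * (w x * complex_of_real (\<psi>0 x)))"
        by (rule set_integral_add(2)[OF i(1) set_integrable_mult_right[OF i(2)]])
      finally show ?thesis by simp
    qed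
    have "I \<eta> = I \<psi> + k * I \<psi>0" using lin[OF one] unfolding I_mult .
    also have "\<dots> = 0" using r I_real[of \<psi>0] I_real[of \<psi>] unfolding k_def r_def[symmetric]
      by (metis add.right_inverse nonzero_divide_eq_eq of_real_minus of_real_mult times_divide_eq_left)
    finally obtain \<phi> where "test_fun \<phi>" "deriv \<phi> = \<eta>"
      using test_fun_antideriv[OF \<eta>] unfolding I_def by blast
    with null have "J \<eta> = 0" unfolding J_def by blast
    moreover have "J \<eta> = J \<psi> + k * J \<psi>0" using lin[OF W] unfolding J_def .
    ultimately have "J \<psi> = - k * J \<psi>0" by (simp add: eq_neg_iff_add_eq_0)
    also have "\<dots> = c * complex_of_real (Re (I \<psi>))" by (simp add: c_def k_def)
    finally show ?thesis using I_real[of \<psi>] by simp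
  qed
  have "AE x in lborel. x \<in> Iper \<longrightarrow> W x - c = 0"
  proof (rule test_fun_null)
    have ci: "set_integrable lborel Iper (\<lambda>x. c)" using set_integrable_mult_right[OF one, of c] by simp
    show "set_integrable lborel Iper (\<lambda>x. W x - c)" by (rule set_integral_diff(1)[OF W ci])
    fix \<psi> assume t: "test_fun \<psi>"
    have "(LINT x:Iper|lborel. (W x - c) * complex_of_real (\<psi> x)) = J \<psi> - (LINT x:Iper|lborel. c * complex_of_real (\<psi> x))"
      unfolding left_diff_distrib J_def
      by (intro set_integral_diff(2) set_integrable_mult_test W ci test_fun_continuous t)
    also have "(LINT x:Iper|lborel. c * complex_of_real (\<psi> x)) = c * I \<psi>" by (simp add: I_def)
    finally show "(LINT x:Iper|lborel. (W x - c) * complex_of_real (\<psi> x)) = 0" using J[OF t] by simp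
  qed
  then show ?thesis by (intro exI[of _ c]) simp
qed

section \<open>Distributional derivatives and absolute continuity\<close>

lemma abs_cont_on_of_real_C1:
  assumes "\<And>x. (\<phi> has_real_derivative \<phi>' x) (at x)" "continuous_on UNIV \<phi>'" "is_interval S"
  shows "abs_cont_on S (\<lambda>x. complex_of_real (\<phi> x)) (\<lambda>x. complex_of_real (\<phi>' x))"
proof (rule abs_cont_on_C1[OF assms(3)])
  fix x
  have "(\<phi> has_vector_derivative \<phi>' x) (at x within S)"
    using assms(1)[of x] by (auto simp: has_real_derivative_iff_has_vector_derivative intro: has_vector_derivative_at_within)
  then show "((\<lambda>x. complex_of_real (\<phi> x)) has_vector_derivative complex_of_real (\<phi>' x)) (at x within S)"
    by (rule bounded_linear.has_vector_derivative[OF bounded_linear_of_real])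
qed (intro continuous_intros continuous_on_subset[OF assms(2)] subset_UNIV)

lemma test_fun_boundary: "test_fun \<phi> \<Longrightarrow> \<phi> pi = 0" "test_fun \<phi> \<Longrightarrow> \<phi> (-pi) = 0"
  unfolding test_fun_def by force+

text \<open>Integrating the product rule for \<open>w \<phi>\<close> over the period leaves no
  boundary terms, because test functions vanish at \<open>-pi\<close> and \<open>pi\<close>.\<close>

lemma abs_cont_on_imp_distr_deriv:
  assumes w: "abs_cont_on {-pi..pi} w g" and v: "set_borel_measurable lborel Iper v"
    and ae: "AE x in lborel. x \<in> Iper \<longrightarrow> v x = w x"
  shows "distr_deriv v g"
  unfolding distr_deriv_def
proof (intro allI impI)
  fix \<phi> assume t: "test_fun \<phi>"
  have g: "set_integrable lborel Iper g"
    using abs_cont_onD(1)[OF w, of "-pi" pi] by (simp add: set_integrable_Icc_Ioo)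
  have cw: "continuous_on {-pi..pi} w" by (rule abs_cont_on_continuous[OF w])
  then have wi: "set_integrable lborel Iper w"
    using borel_integrable_atLeastAtMost'[OF cw] by (simp add: set_integrable_Icc_Ioo)
  have "abs_cont_on {-pi..pi} (\<lambda>x. w x * complex_of_real (\<phi> x))
     (\<lambda>x. g x * complex_of_real (\<phi> x) + w x * complex_of_real (deriv \<phi> x))"
    by (intro abs_cont_on_mult w abs_cont_on_of_real_C1 test_fun_continuous t) (simp add: is_interval_cc)
  from abs_cont_onD(2)[OF this, of "-pi" pi] test_fun_boundary[OF t]
  have "(LINT x:Iper|lborel. g x * complex_of_real (\<phi> x) + w x * complex_of_real (deriv \<phi> x)) = 0"
    by (simp add: set_integral_Icc_Ioo)
  moreover have "(LINT x:Iper|lborel. g x * complex_of_real (\<phi> x) + w x * complex_of_real (deriv \<phi> x))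
    = (LINT x:Iper|lborel. g x * complex_of_real (\<phi> x)) + (LINT x:Iper|lborel. w x * complex_of_real (deriv \<phi> x))"
    by (intro set_integral_add(2) set_integrable_mult_test g wi test_fun_continuous t)
  moreover have "(LINT x:Iper|lborel. v x * complex_of_real (deriv \<phi> x)) = (LINT x:Iper|lborel. w x * complex_of_real (deriv \<phi> x))"
  proof (rule set_integral_cong_ae)
    have m: "set_borel_measurable lborel Iper (\<lambda>x. complex_of_real (deriv \<phi> x))"
      by (intro set_borel_measurable_continuous_on continuous_intros test_fun_continuous t) auto
    show "set_borel_measurable lborel Iper (\<lambda>x. v x * complex_of_real (deriv \<phi> x))"
      by (rule set_borel_measurable_mult[OF v m])
    show "set_borel_measurable lborel Iper (\<lambda>x. w x * complex_of_real (deriv \<phi> x))"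
      by (rule set_borel_measurable_mult[OF set_integrable_imp_borel[OF wi] m])
    show "AE x in lborel. x \<in> Iper \<longrightarrow> v x * complex_of_real (deriv \<phi> x) = w x * complex_of_real (deriv \<phi> x)"
      using ae by eventually_elim simp
  qed
  ultimately show "(LINT x:Iper|lborel. v x * complex_of_real (deriv \<phi> x)) = - (LINT x:Iper|lborel. g x * complex_of_real (\<phi> x))"
    by (simp add: eq_neg_iff_add_eq_0 add.commute)
qed

lemma distr_deriv_diff:
  assumes "distr_deriv w g" "distr_deriv w' g'" "set_integrable lborel Iper w" "set_integrable lborel Iper w'"
    "set_integrable lborel Iper g" "set_integrable lborel Iper g'"
  shows "distr_deriv (\<lambda>x. w x - w' x) (\<lambda>x. g x - g' x)"
  unfolding distr_deriv_def
proof (intro allI impI)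
  fix \<phi> assume t: "test_fun \<phi>"
  have *: "(LINT x:Iper|lborel. (f x - h x) * complex_of_real (\<psi> x))
    = (LINT x:Iper|lborel. f x * complex_of_real (\<psi> x)) - (LINT x:Iper|lborel. h x * complex_of_real (\<psi> x))"
    if "set_integrable lborel Iper f" "set_integrable lborel Iper h" "continuous_on UNIV \<psi>" for f h \<psi>
    unfolding left_diff_distrib by (intro set_integral_diff(2) set_integrable_mult_test that)
  show "(LINT x:Iper|lborel. (w x - w' x) * complex_of_real (deriv \<phi> x)) = - (LINT x:Iper|lborel. (g x - g' x) * complex_of_real (\<phi> x))"
    unfolding *[OF assms(3,4) test_fun_continuous(2)[OF t]] *[OF assms(5,6) test_fun_continuous(1)[OF t]]
    using assms(1,2) t unfolding distr_deriv_def by simp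
qed

text \<open>Subtracting the primitive of \<open>g\<close> leaves a function with distributional
  derivative 0, which du Bois-Reymond shows to be constant almost everywhere.\<close>

lemma distr_deriv_imp_abs_cont:
  assumes d: "distr_deriv w g" and w: "set_integrable lborel Iper w" and g: "set_integrable lborel Iper g"
  shows "\<exists>c. AE x in lborel. x \<in> Iper \<longrightarrow> w x = c + (LINT t:{-pi..x}|lborel. g t)"
proof -
  define G where "G x = 0 + (LINT t:{-pi..x}|lborel. g t)" for x
  have G: "abs_cont_on {-pi..pi} G g"
    unfolding G_def by (rule abs_cont_on_primitive) (use g in \<open>simp add: set_integrable_Icc_Ioo\<close>)
  have Gi: "set_integrable lborel Iper G"
    using borel_integrable_atLeastAtMost'[OF abs_cont_on_continuous[OF G]] by (simp add: set_integrable_Icc_Ioo)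
  have "distr_deriv G g" by (rule abs_cont_on_imp_distr_deriv[OF G set_integrable_imp_borel[OF Gi]]) simp
  from distr_deriv_diff[OF d this w Gi g g]
  have dd: "distr_deriv (\<lambda>x. w x - G x) (\<lambda>x. 0)" by simp
  have "\<exists>c. AE x in lborel. x \<in> Iper \<longrightarrow> w x - G x = c"
    by (rule du_Bois_Reymond[OF set_integral_diff(1)[OF w Gi]]) (use dd in \<open>simp add: distr_deriv_def\<close>)
  then obtain c where "AE x in lborel. x \<in> Iper \<longrightarrow> w x - G x = c" ..
  then have "AE x in lborel. x \<in> Iper \<longrightarrow> w x = c + (LINT t:{-pi..x}|lborel. g t)"
    by eventually_elim (auto simp: G_def algebra_simps)
  then show ?thesis ..
qed

text \<open>Needed because \<open>opA\<close> selects its derivative by \<open>SOME\<close>: this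
  identifies the selected one with a derivative constructed by hand.\<close>

lemma distr_deriv_unique:
  assumes "distr_deriv w g" "distr_deriv w g'" "set_integrable lborel Iper w"
    "set_integrable lborel Iper g" "set_integrable lborel Iper g'"
  shows "AE x in lborel. x \<in> Iper \<longrightarrow> g x = g' x"
proof -
  have dd: "distr_deriv (\<lambda>x. w x - w x) (\<lambda>x. g x - g' x)"
    by (rule distr_deriv_diff) (use assms in auto)
  have "AE x in lborel. x \<in> Iper \<longrightarrow> g x - g' x = 0"
    by (rule test_fun_null[OF set_integral_diff(1)[OF assms(4,5)]]) (use dd in \<open>simp add: distr_deriv_def\<close>)
  then show ?thesis by simp
qed

subsection \<open>The equation on a half period\<close>

lemma set_borel_measurable_reflect:
  fixes f :: "real \<Rightarrow> complex"
  assumes "set_borel_measurable lborel S f"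
  shows "set_borel_measurable lborel ((\<lambda>x. c - x) -` S) (\<lambda>x. f (c - x))"
proof -
  have 1: "(\<lambda>x. indicat_real ((\<lambda>x. c - x) -` S) x *\<^sub>R f (c - x)) = (\<lambda>x. (\<lambda>x. indicat_real S x *\<^sub>R f x) (c - x))"
    by (auto simp: indicator_def)
  show ?thesis unfolding set_borel_measurable_def 1
    by (rule measurable_compose[OF _ assms[unfolded set_borel_measurable_def]]) simp
qed

lemma L2_on_reflect:
  assumes "L2_on {l<..<m} f"
  shows "L2_on {l<..<m} (\<lambda>x. f (l + m - x))"
proof -
  have S: "(\<lambda>x. l + m - x) -` {l<..<m} = {l<..<m}" by auto
  show ?thesis
    using assms set_borel_measurable_reflect[of "{l<..<m}" f "l + m"]
      set_integral_reflect(1)[of "l + m" "{l<..<m}" "\<lambda>x. (cmod (f x))\<^sup>2"]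
    unfolding L2_on_def S by blast
qed

section \<open>Square integrability and boundary values\<close>

text \<open>If \<open>c\<close> were positive, \<open>1 / (z - l)\<close> would be dominated by a
  multiple of \<open>|V|^2\<close> and hence integrable near \<open>l\<close>, against the
  divergence of the logarithm.\<close>

lemma L2_lower_left:
  assumes V: "L2_on {l<..<h} V" and lh: "l < h"
    and low: "\<And>z. z \<in> {l<..<h} \<Longrightarrow> c \<le> K * ((z - l) * (cmod (V z))\<^sup>2)"
  shows "c \<le> 0"
proof (rule ccontr)
  assume "\<not> c \<le> 0"
  then have c: "c > 0" by simp
  have K: "K > 0"
  proof (rule ccontr)
    assume "\<not> K > 0"
    then have "K * (((l + h) / 2 - l) * (cmod (V ((l + h) / 2)))\<^sup>2) \<le> 0"
      using lh by (intro mult_nonpos_nonneg) auto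
    with low[of "(l + h) / 2"] c lh show False by auto
  qed
  have i: "set_integrable lborel {l<..<h} (\<lambda>z. 1 / (z - l))"
  proof (rule set_integrable_bound)
    show "set_integrable lborel {l<..<h} (\<lambda>z. (K / c) * (cmod (V z))\<^sup>2)"
      using L2_on_square[OF V] by simp
    show "set_borel_measurable lborel {l<..<h} (\<lambda>z. 1 / (z - l))"
      by (intro set_borel_measurable_continuous_on continuous_intros) auto
    have "norm (1 / (z - l)) \<le> norm ((K / c) * (cmod (V z))\<^sup>2)" if "z \<in> {l<..<h}" for z
      using low[OF that] that c K by (auto simp: field_simps)
    then show "AE z in lborel. z \<in> {l<..<h} \<longrightarrow> norm (1 / (z - l)) \<le> norm ((K / c) * (cmod (V z))\<^sup>2)"
      by auto
  qed
  define C where "C = (LINT z:{l<..<h}|lborel. 1 / (z - l))"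
  \<comment> \<open>Chosen so that the integral of \<open>1 / (z - l)\<close> over
    \<open>{p..q}\<close> is exactly \<open>C + 1\<close>, one more than the supposed total
    \<open>C\<close>.\<close>
  define p where "p = l + (h - l) / 2 * exp (- C - 1)"
  define q where "q = l + (h - l) / 2"
  have "C \<ge> 0" unfolding C_def set_lebesgue_integral_def
    by (rule Bochner_Integration.integral_nonneg) (auto simp: indicator_def)
  then have "exp (- C - 1) \<le> 1" by simp
  then have pq: "l < p" "p \<le> q" "q < h"
    using lh mult_left_le[of "exp (- C - 1)" "(h - l) / 2"] by (auto simp: p_def q_def field_simps)
  have "(LINT z:{p..q}|lborel. 1 / (z - l)) = ln (q - l) - ln (p - l)"
    unfolding set_lebesgue_integral_def
  proof (rule integral_FTC_atLeastAtMost[OF pq(2)])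
    fix x assume "p \<le> x" "x \<le> q"
    then show "((\<lambda>z. ln (z - l)) has_vector_derivative 1 / (x - l)) (at x within {p..q})"
      unfolding has_real_derivative_iff_has_vector_derivative[symmetric]
      using pq by (auto intro!: derivative_eq_intros)
  qed (use pq in \<open>auto intro!: continuous_intros\<close>)
  also have "ln (p - l) = ln ((h - l) / 2) + ln (exp (- C - 1))"
  proof -
    have pl: "p - l = (h - l) / 2 * exp (- C - 1)" by (simp add: p_def)
    show ?thesis unfolding pl by (rule ln_mult_pos) (use lh in auto)
  qed
  also have "ln (q - l) - (ln ((h - l) / 2) + ln (exp (- C - 1))) = C + 1" by (simp add: q_def)
  finally have "(LINT z:{p..q}|lborel. 1 / (z - l)) = C + 1" .
  moreover have "(LINT z:{p..q}|lborel. 1 / (z - l)) \<le> C"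
    unfolding C_def set_lebesgue_integral_def
  proof (rule Bochner_Integration.integral_mono)
    show "integrable lborel (\<lambda>x. indicat_real {p..q} x *\<^sub>R (1 / (x - l)))"
    proof -
      have "set_integrable lborel {p..q} (\<lambda>x. 1 / (x - l))"
        by (rule set_integrable_subset[OF i]) (use pq in auto)
      then show ?thesis by (simp add: set_integrable_def)
    qed
    show "integrable lborel (\<lambda>x. indicat_real {l<..<h} x *\<^sub>R (1 / (x - l)))"
      using i by (simp add: set_integrable_def)
  qed (use pq in \<open>auto simp: indicator_def\<close>)
  ultimately show False by simp
qed

lemma L2_lower_right:
  assumes V: "L2_on {h<..<m} V" and lh: "h < m"
    and low: "\<And>z. z \<in> {h<..<m} \<Longrightarrow> c \<le> K * ((m - z) * (cmod (V z))\<^sup>2)"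
  shows "c \<le> 0"
proof (rule L2_lower_left[OF L2_on_reflect[OF V] lh])
  fix z assume "z \<in> {h<..<m}"
  then show "c \<le> K * ((z - h) * (cmod (V (h + m - z)))\<^sup>2)"
    using low[of "h + m - z"] by (auto simp: algebra_simps)
qed

text \<open>A nonzero end value would keep \<open>|F|\<close> above half of it nearby. One of the
  two distance factors in the bound is at most \<open>m - l\<close>, and the remaining one is
  excluded by \<open>L2_lower_left\<close> or its mirror image.\<close>

lemma L2_vanish_ends:
  fixes F :: "real \<Rightarrow> complex"
  assumes V: "L2_on {l<..<m} V" and lm: "l < m" and F: "continuous_on {l..m} F"
    and bd: "\<And>z. z \<in> {l<..<m} \<Longrightarrow> cmod (F z) \<le> K * ((z - l) * (m - z) * (cmod (V z))\<^sup>2)" and K: "0 \<le> K"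
  shows "F l = 0" "F m = 0"
proof -
  have near: "\<exists>d>0. \<forall>z\<in>{l..m}. \<bar>z - a\<bar> < d \<longrightarrow> cmod (F a) / 2 \<le> cmod (F z)" if a: "a \<in> {l..m}" "F a \<noteq> 0" for a
  proof -
    have "cmod (F a) / 2 > 0" using a by simp
    then obtain d where d: "d > 0" "\<And>z. z \<in> {l..m} \<Longrightarrow> dist z a < d \<Longrightarrow> dist (F z) (F a) < cmod (F a) / 2"
      using F a(1) unfolding continuous_on_iff by blast
    have "cmod (F a) / 2 \<le> cmod (F z)" if "z \<in> {l..m}" "\<bar>z - a\<bar> < d" for z
      using d(2)[OF that(1)] that(2) norm_triangle_ineq2[of "F a" "F z"]
      by (simp add: dist_norm norm_minus_commute)
    with d(1) show ?thesis by blast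
  qed
  show "F l = 0"
  proof (rule ccontr)
    assume nz: "F l \<noteq> 0"
    from near[OF _ nz] lm obtain d where d: "d > 0"
      "\<And>z. z \<in> {l..m} \<Longrightarrow> \<bar>z - l\<bar> < d \<Longrightarrow> cmod (F l) / 2 \<le> cmod (F z)" by auto
    define h where "h = min m (l + d)"
    have h: "l < h" "h \<le> m" "h \<le> l + d" using lm d by (auto simp: h_def)
    have "cmod (F l) / 2 \<le> 0"
    proof (rule L2_lower_left[OF L2_on_subset[OF V] h(1)])
      fix z assume z: "z \<in> {l<..<h}"
      have "cmod (F l) / 2 \<le> cmod (F z)" by (rule d(2)) (use z h in auto)
      also have "\<dots> \<le> K * ((z - l) * (m - z) * (cmod (V z))\<^sup>2)" by (rule bd) (use z h in auto)
      also have "\<dots> \<le> K * ((z - l) * (m - l) * (cmod (V z))\<^sup>2)"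
        using z h K by (intro mult_left_mono mult_right_mono) auto
      finally show "cmod (F l) / 2 \<le> (K * (m - l)) * ((z - l) * (cmod (V z))\<^sup>2)" by (simp add: mult_ac)
    qed (use h in auto)
    with nz show False by simp
  qed
  show "F m = 0"
  proof (rule ccontr)
    assume nz: "F m \<noteq> 0"
    from near[OF _ nz] lm obtain d where d: "d > 0"
      "\<And>z. z \<in> {l..m} \<Longrightarrow> \<bar>z - m\<bar> < d \<Longrightarrow> cmod (F m) / 2 \<le> cmod (F z)" by auto
    define h where "h = max l (m - d)"
    have h: "h < m" "l \<le> h" "m - d \<le> h" using lm d by (auto simp: h_def)
    have "cmod (F m) / 2 \<le> 0"
    proof (rule L2_lower_right[OF L2_on_subset[OF V] h(1)])
      fix z assume z: "z \<in> {h<..<m}"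
      have "cmod (F m) / 2 \<le> cmod (F z)" by (rule d(2)) (use z h in auto)
      also have "\<dots> \<le> K * ((z - l) * (m - z) * (cmod (V z))\<^sup>2)" by (rule bd) (use z h in auto)
      also have "\<dots> \<le> K * ((m - l) * (m - z) * (cmod (V z))\<^sup>2)"
        using z h K by (intro mult_left_mono mult_right_mono) auto
      finally show "cmod (F m) / 2 \<le> (K * (m - l)) * ((m - z) * (cmod (V z))\<^sup>2)" by (simp add: mult_ac)
    qed (use h in auto)
    with nz show False by simp
  qed
qed

text \<open>On each of the two half periods \<open>(l, l + pi)\<close>, \<open>l \<in> {- pi, 0}\<close>, the coefficient
  \<open>c_* - U_*\<^sup>2\<close> is the parabola \<open>hb l\<close>, and \<open>hom l \<mu>\<close> below spans the solutions of
  \<open>(hb u')' + u = \<mu> u'\<close> with square integrable derivative.\<close>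

definition hb :: "real \<Rightarrow> real \<Rightarrow> real" where
  "hb l z = (z - l) * (l + pi - z) / 2"

definition hom :: "real \<Rightarrow> complex \<Rightarrow> real \<Rightarrow> complex" where
  "hom l \<mu> z = complex_of_real (z - l - pi / 2) + \<mu>"

text \<open>A primitive of \<open>1 / hb l\<close> by partial fractions,
  \<open>2 / (x (pi - x)) = (2 / pi) (1 / x + 1 / (pi - x))\<close> with \<open>x = z - l\<close>,
  normalised to vanish at the midpoint.\<close>

definition xi :: "real \<Rightarrow> real \<Rightarrow> real" where
  "xi l z = (2 / pi) * (ln (z - l) - ln (l + pi - z))"

text \<open>The solution of \<open>hb y' = \<mu> y\<close> with value 1 at the midpoint. As the
  exponential of a multiple of a real function it needs no branch of the complex power, and its
  modulus depends on \<open>Re \<mu>\<close> alone.\<close>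

definition En :: "real \<Rightarrow> complex \<Rightarrow> real \<Rightarrow> complex" where
  "En l \<mu> z = exp (\<mu> * complex_of_real (xi l z))"

lemma hb_pos: "z \<in> {l<..<l + pi} \<Longrightarrow> hb l z > 0"
  by (simp add: hb_def)

lemma hb_ends [simp]: "hb l l = 0" "hb l (l + pi) = 0"
  by (simp_all add: hb_def)

lemma En_uminus: "En l (- \<mu>) z * En l \<mu> z = 1" "En l \<mu> z * En l (- \<mu>) z = 1"
  by (simp_all add: En_def flip: exp_add)

lemma norm_En: "cmod (En l \<mu> z) = exp (Re \<mu> * xi l z)"
  by (simp add: En_def norm_exp_eq_Re)

lemma hb_deriv: "(hb l has_real_derivative (l + pi / 2 - z)) (at z)"
  unfolding hb_def by (auto intro!: derivative_eq_intros simp: field_simps)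

lemma xi_deriv: "z \<in> {l<..<l + pi} \<Longrightarrow> (xi l has_real_derivative 1 / hb l z) (at z)"
  unfolding xi_def hb_def by (auto intro!: derivative_eq_intros simp: divide_simps)

lemma hb_abs_cont:
  "is_interval S \<Longrightarrow> abs_cont_on S (\<lambda>z. complex_of_real (hb l z)) (\<lambda>z. complex_of_real (l + pi / 2 - z))"
  by (intro abs_cont_on_of_real_C1 hb_deriv continuous_intros)

lemma hom_abs_cont: "is_interval S \<Longrightarrow> abs_cont_on S (hom l \<mu>) (\<lambda>z. 1)"
  unfolding hom_def
  by (rule abs_cont_on_C1) (auto intro!: derivative_eq_intros continuous_intros)

lemma continuous_on_hom: "continuous_on S (hom l \<mu>)"
  unfolding hom_def by (intro continuous_intros)

lemma continuous_on_hb: "continuous_on S (hb l)"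
  unfolding hb_def by (intro continuous_intros) auto

lemma continuous_on_En: "S \<subseteq> {l<..<l + pi} \<Longrightarrow> continuous_on S (En l \<mu>)"
  unfolding En_def xi_def by (intro continuous_intros) auto

lemma inverse_hb_abs_cont:
  "abs_cont_on {l<..<l + pi} (\<lambda>z. 1 / complex_of_real (hb l z))
     (\<lambda>z. - complex_of_real (l + pi / 2 - z) / (complex_of_real (hb l z))\<^sup>2)"
proof (rule abs_cont_on_C1)
  fix z assume z: "z \<in> {l<..<l + pi}"
  have "((\<lambda>z. 1 / hb l z) has_real_derivative - (l + pi / 2 - z) / (hb l z)\<^sup>2) (at z within {l<..<l + pi})"
    using hb_pos[OF z] by (auto intro!: derivative_eq_intros has_field_derivative_at_within[OF hb_deriv] simp: power2_eq_square)
  then have "((\<lambda>z. complex_of_real (1 / hb l z)) has_vector_derivative complex_of_real (- (l + pi / 2 - z) / (hb l z)\<^sup>2)) (at z within {l<..<l + pi})"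
    unfolding has_real_derivative_iff_has_vector_derivative
    by (rule bounded_linear.has_vector_derivative[OF bounded_linear_of_real])
  then show "((\<lambda>z. 1 / complex_of_real (hb l z)) has_vector_derivative - complex_of_real (l + pi / 2 - z) / (complex_of_real (hb l z))\<^sup>2) (at z within {l<..<l + pi})"
    by simp
next
  show "continuous_on {l<..<l + pi} (\<lambda>z. - complex_of_real (l + pi / 2 - z) / (complex_of_real (hb l z))\<^sup>2)"
    using hb_pos[of _ l] by (auto intro!: continuous_intros continuous_on_hb simp: less_imp_neq[symmetric])
qed (simp add: is_interval_oo)

lemma En_abs_cont:
  "abs_cont_on {l<..<l + pi} (En l \<mu>) (\<lambda>z. \<mu> * En l \<mu> z / complex_of_real (hb l z))"
proof (rule abs_cont_on_C1)
  fix z assume z: "z \<in> {l<..<l + pi}"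
  have "(xi l has_vector_derivative 1 / hb l z) (at z within {l<..<l + pi})"
    using has_field_derivative_at_within[OF xi_deriv[OF z]] by (simp add: has_real_derivative_iff_has_vector_derivative)
  then have "((\<lambda>z. complex_of_real (xi l z)) has_vector_derivative complex_of_real (1 / hb l z)) (at z within {l<..<l + pi})"
    by (rule bounded_linear.has_vector_derivative[OF bounded_linear_of_real])
  then have "((\<lambda>z. \<mu> * complex_of_real (xi l z)) has_vector_derivative \<mu> * complex_of_real (1 / hb l z)) (at z within {l<..<l + pi})"
    by (rule has_vector_derivative_mult_right)
  then have "((exp \<circ> (\<lambda>z. \<mu> * complex_of_real (xi l z))) has_vector_derivative (\<mu> * complex_of_real (1 / hb l z)) * exp (\<mu> * complex_of_real (xi l z))) (at z within {l<..<l + pi})"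
    by (rule field_vector_diff_chain_within) (rule has_field_derivative_at_within[OF DERIV_exp])
  then show "(En l \<mu> has_vector_derivative \<mu> * En l \<mu> z / complex_of_real (hb l z)) (at z within {l<..<l + pi})"
    by (simp add: En_def[abs_def] o_def)
next
  show "continuous_on {l<..<l + pi} (\<lambda>z. \<mu> * En l \<mu> z / complex_of_real (hb l z))"
    using hb_pos[of _ l] by (auto intro!: continuous_intros continuous_on_hb continuous_on_En) fastforce
qed (simp add: is_interval_oo)

text \<open>The limits of \<open>hb v\<close> at the ends exist because \<open>g\<close> is
  integrable, and are 0 because \<open>v\<close> is square integrable. At an end \<open>hb\<close>
  is 0 whatever value \<open>v\<close> has there, so the product itself is the continuous
  extension.\<close>

lemma half_extend:
  assumes w: "abs_cont_on {l<..<l + pi} (\<lambda>z. complex_of_real (hb l z) * v z) g"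
    and v: "L2_on {l<..<l + pi} v" and g: "set_integrable lborel {l<..<l + pi} g"
  shows "abs_cont_on {l..l + pi} (\<lambda>z. complex_of_real (hb l z) * v z) g"
proof -
  obtain c where c: "\<And>z. z \<in> {l<..<l + pi} \<Longrightarrow> complex_of_real (hb l z) * v z = c + (LINT t:{l..z}|lborel. g t)"
    and W: "abs_cont_on {l..l + pi} (\<lambda>z. c + (LINT t:{l..z}|lborel. g t)) g"
    using abs_cont_on_extend[OF w g] by auto
  define W where "W z = c + (LINT t:{l..z}|lborel. g t)" for z
  note Wc = abs_cont_on_continuous[OF W, folded W_def]
  \<comment> \<open>The square is taken since the vanishing criterion wants a bound quadratic in
    \<open>v\<close>. The constant comes from \<open>(z - l) (l + pi - z) <= pi^2\<close>, applied
    to one of the two such factors in \<open>hb^2\<close>.\<close>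
  have bd: "cmod (W z * W z) \<le> pi\<^sup>2 / 4 * ((z - l) * (l + pi - z) * (cmod (v z))\<^sup>2)" if z: "z \<in> {l<..<l + pi}" for z
  proof -
    have "cmod (W z * W z) = (hb l z)\<^sup>2 * (cmod (v z))\<^sup>2"
      using c[OF z] by (simp add: W_def[symmetric] norm_mult power2_eq_square flip: power_mult_distrib)
        (metis (no_types, lifting) mult.assoc mult.left_commute norm_mult norm_of_real abs_mult_self_eq)
    moreover have "(z - l) * (l + pi - z) \<le> pi * pi" using z by (intro mult_mono) auto
    then have "(hb l z)\<^sup>2 \<le> pi\<^sup>2 / 4 * ((z - l) * (l + pi - z))"
      using z mult_right_mono[of "(z - l) * (l + pi - z)" "pi * pi" "(z - l) * (l + pi - z)"]
      by (simp add: hb_def power2_eq_square mult_ac)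
    then have "(hb l z)\<^sup>2 * (cmod (v z))\<^sup>2 \<le> pi\<^sup>2 / 4 * ((z - l) * (l + pi - z)) * (cmod (v z))\<^sup>2"
      by (rule mult_right_mono) simp
    ultimately show ?thesis by (simp add: mult_ac)
  qed
  have z: "W l * W l = 0" "W (l + pi) * W (l + pi) = 0"
    using L2_vanish_ends[OF v _ continuous_on_mult[OF Wc Wc] bd] by simp_all
  show ?thesis
  proof (rule abs_cont_on_ident[OF W, folded W_def])
    fix x assume "x \<in> {l..l + pi}"
    then consider "x = l" | "x = l + pi" | "x \<in> {l<..<l + pi}" by force
    then show "W x = complex_of_real (hb l x) * v x"
      using z c W_def by cases auto
  qed simp
qed

text \<open>The integrand is the derivative of \<open>hb |v|^2\<close>, the factor
  \<open>l + pi / 2 - z\<close> being \<open>hb'\<close>. This energy is continuous up to the ends,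
  where it vanishes by square integrability of \<open>v\<close>.\<close>

lemma half_energy:
  assumes w: "abs_cont_on {l<..<l + pi} (\<lambda>z. complex_of_real (hb l z) * v z) g"
    and v: "L2_on {l<..<l + pi} v" and g: "L2_on {l<..<l + pi} g"
  shows "(LINT z:{l<..<l + pi}|lborel. g z * cnj (v z) + v z * cnj (g z)
      - complex_of_real ((l + pi / 2 - z) * (cmod (v z))\<^sup>2)) = 0" (is "(LINT z:_|_. ?h z) = 0")
proof -
  define F where "F z = complex_of_real (hb l z) * (v z * cnj (v z))" for z
  have "L2_on {l<..<l + pi} (\<lambda>z. complex_of_real (l + pi / 2 - z) * v z)"
    by (rule L2_on_continuous_mult[OF v, of l "l + pi"]) (auto intro!: continuous_intros)
  from L2_on_mult_integrable[OF this L2_on_cnj[OF v]]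
  have i3: "set_integrable lborel {l<..<l + pi} (\<lambda>z. complex_of_real ((l + pi / 2 - z) * (cmod (v z))\<^sup>2))"
    by (simp only: of_real_mult complex_norm_square mult.assoc) simp
  have hi: "set_integrable lborel {l<..<l + pi} ?h"
    by (intro set_integral_diff(1) set_integral_add(1) L2_on_mult_integrable v g L2_on_cnj i3) auto
  \<comment> \<open>The hypothesis controls \<open>hb v\<close> rather than \<open>v\<close>, so the
    energy is differentiated as \<open>|hb v|^2\<close> times \<open>1 / hb\<close>.\<close>
  have "abs_cont_on {l<..<l + pi} F ?h"
  proof (rule abs_cont_on_ident[OF abs_cont_on_mult[OF abs_cont_on_mult[OF w abs_cont_on_cnj[OF w]] inverse_hb_abs_cont]])
    fix x assume x: "x \<in> {l<..<l + pi}"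
    have h: "complex_of_real (hb l x) \<noteq> 0" using hb_pos[OF x] by simp
    then show "complex_of_real (hb l x) * v x * cnj (complex_of_real (hb l x) * v x) * (1 / complex_of_real (hb l x)) = F x"
      by (simp add: F_def field_simps)
    have e: "complex_of_real ((l + pi / 2 - x) * (cmod (v x))\<^sup>2) = complex_of_real (l + pi / 2 - x) * (v x * cnj (v x))"
      by (simp only: of_real_mult complex_norm_square)
    from h show "(g x * cnj (complex_of_real (hb l x) * v x) + complex_of_real (hb l x) * v x * cnj (g x)) *
           (1 / complex_of_real (hb l x)) +
           complex_of_real (hb l x) * v x * cnj (complex_of_real (hb l x) * v x) *
           (- complex_of_real (l + pi / 2 - x) / (complex_of_real (hb l x))\<^sup>2) =
           g x * cnj (v x) + v x * cnj (g x) - complex_of_real ((l + pi / 2 - x) * (cmod (v x))\<^sup>2)"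
      unfolding e by (simp add: power2_eq_square field_simps del: of_real_add of_real_diff of_real_power)
  qed
  from abs_cont_on_extend[OF this hi] obtain c where
    c: "\<And>z. z \<in> {l<..<l + pi} \<Longrightarrow> F z = c + (LINT t:{l..z}|lborel. ?h t)"
    and W: "abs_cont_on {l..l + pi} (\<lambda>z. c + (LINT t:{l..z}|lborel. ?h t)) ?h" by auto
  define W where "W z = c + (LINT t:{l..z}|lborel. ?h t)" for z
  note Wc = abs_cont_on_continuous[OF W, folded W_def]
  have bd: "cmod (W z) \<le> (1 / 2) * ((z - l) * (l + pi - z) * (cmod (v z))\<^sup>2)" if z: "z \<in> {l<..<l + pi}" for z
  proof -
    have "cmod (W z) = cmod (F z)" using c[OF z] by (simp add: W_def)
    also have "\<dots> = hb l z * (cmod (v z))\<^sup>2"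
      using hb_pos[OF z] by (simp add: F_def norm_mult power2_eq_square)
    finally show ?thesis by (simp add: hb_def)
  qed
  have "W l = 0" "W (l + pi) = 0"
    using L2_vanish_ends[OF v _ Wc bd] by simp_all
  moreover have "(LINT z:{l..l + pi}|lborel. ?h z) = W (l + pi) - W l"
    using abs_cont_onD(2)[OF W, of l "l + pi"] unfolding W_def by simp
  ultimately show ?thesis unfolding set_integral_Icc_Ioo by simp
qed

section \<open>The Wronskian and the obstruction in the strip\<close>

text \<open>With \<open>om = u - hom v\<close> one has \<open>hb om = hb u - hom (hb v)\<close>, a
  combination of functions with known derivatives. The equation gives
  \<open>(hb om)' = \<mu> om - hom f\<close>, and the factor \<open>En l (- \<mu>)\<close> removes
  the term in \<open>om\<close>.\<close>

lemma wronskian_abs_cont: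
  assumes w: "abs_cont_on {l<..<l + pi} (\<lambda>z. complex_of_real (hb l z) * v z) g"
    and u: "abs_cont_on {l..l + pi} u v" and f: "set_borel_measurable lborel {l<..<l + pi} f"
    and eq: "AE z in lborel. z \<in> {l<..<l + pi} \<longrightarrow> g z + u z - \<mu> * v z = f z"
  shows "abs_cont_on {l<..<l + pi} (\<lambda>z. complex_of_real (hb l z) * (u z - hom l \<mu> z * v z) * En l (- \<mu>) z)
     (\<lambda>z. - (hom l \<mu> z * f z * En l (- \<mu>) z))"
proof (rule abs_cont_on_cong)
  have u': "abs_cont_on {l<..<l + pi} u v"
    by (rule abs_cont_on_subset[OF u]) (auto simp: is_interval_oo)
  note I = is_interval_oo[of l "l + pi"]
  show "abs_cont_on {l<..<l + pi} (\<lambda>z. (complex_of_real (hb l z) * u z - hom l \<mu> z * (complex_of_real (hb l z) * v z)) * En l (- \<mu>) z)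
     (\<lambda>z. ((complex_of_real (l + pi / 2 - z) * u z + complex_of_real (hb l z) * v z) - (1 * (complex_of_real (hb l z) * v z) + hom l \<mu> z * g z)) * En l (- \<mu>) z
        + (complex_of_real (hb l z) * u z - hom l \<mu> z * (complex_of_real (hb l z) * v z)) * ((- \<mu>) * En l (- \<mu>) z / complex_of_real (hb l z)))"
    by (intro abs_cont_on_mult[OF abs_cont_on_diff En_abs_cont] abs_cont_on_mult hb_abs_cont hom_abs_cont u' w I)
  show "set_borel_measurable lborel {l<..<l + pi} (\<lambda>z. - (hom l \<mu> z * f z * En l (- \<mu>) z))"
  proof -
    have "set_borel_measurable lborel {l<..<l + pi} (\<lambda>z. (- 1) * (hom l \<mu> z * f z * En l (- \<mu>) z))"
      by (intro set_borel_measurable_mult f set_borel_measurable_continuous_on continuous_on_hom continuous_on_En continuous_on_const) auto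
    then show ?thesis by simp
  qed
  show "AE z in lborel. z \<in> {l<..<l + pi} \<longrightarrow> ((complex_of_real (l + pi / 2 - z) * u z + complex_of_real (hb l z) * v z) - (1 * (complex_of_real (hb l z) * v z) + hom l \<mu> z * g z)) * En l (- \<mu>) z
        + (complex_of_real (hb l z) * u z - hom l \<mu> z * (complex_of_real (hb l z) * v z)) * ((- \<mu>) * En l (- \<mu>) z / complex_of_real (hb l z))
      = - (hom l \<mu> z * f z * En l (- \<mu>) z)"
    using eq
  proof eventually_elim
    case (elim z)
    show ?case
    proof
      assume z: "z \<in> {l<..<l + pi}"
      with elim have g: "g z = f z - u z + \<mu> * v z" by (auto simp: algebra_simps)
      have h: "complex_of_real (hb l z) \<noteq> 0" using hb_pos[OF z] by simp
      \<comment> \<open>This is \<open>hb' = \<mu> - hom\<close>, the identity that makes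
        \<open>hom\<close> a homogeneous solution.\<close>
      have d: "complex_of_real (l + pi / 2 - z) = \<mu> - hom l \<mu> z" by (simp add: hom_def)
      have "((complex_of_real (l + pi / 2 - z) * u z + complex_of_real (hb l z) * v z) - (1 * (complex_of_real (hb l z) * v z) + hom l \<mu> z * g z))
        + (u z - hom l \<mu> z * v z) * (- \<mu>) = - (hom l \<mu> z * f z)"
        unfolding g d by (simp add: algebra_simps)
      moreover have "(complex_of_real (hb l z) * u z - hom l \<mu> z * (complex_of_real (hb l z) * v z)) * ((- \<mu>) * En l (- \<mu>) z / complex_of_real (hb l z))
         = (u z - hom l \<mu> z * v z) * (- \<mu>) * En l (- \<mu>) z"
        using h by (simp add: field_simps)
      ultimately show "((complex_of_real (l + pi / 2 - z) * u z + complex_of_real (hb l z) * v z) - (1 * (complex_of_real (hb l z) * v z) + hom l \<mu> z * g z)) * En l (- \<mu>) z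
        + (complex_of_real (hb l z) * u z - hom l \<mu> z * (complex_of_real (hb l z) * v z)) * ((- \<mu>) * En l (- \<mu>) z / complex_of_real (hb l z))
      = - (hom l \<mu> z * f z * En l (- \<mu>) z)"
        by (metis (no_types, lifting) distrib_right mult_minus_left)
    qed
  qed
qed (simp add: algebra_simps)

lemma exp_xi: "z \<in> {l<..<l + pi} \<Longrightarrow> exp (pi / 2 * xi l z) = (z - l) / (l + pi - z)"
proof -
  assume z: "z \<in> {l<..<l + pi}"
  have "pi / 2 * xi l z = ln (z - l) - ln (l + pi - z)" by (simp add: xi_def)
  with z show ?thesis by (simp only: exp_diff) simp
qed

lemma xi_mono: "z \<in> {l<..<l + pi} \<Longrightarrow> z \<le> l + pi / 2 \<Longrightarrow> xi l z \<le> 0"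
   "z \<in> {l<..<l + pi} \<Longrightarrow> l + pi / 2 \<le> z \<Longrightarrow> 0 \<le> xi l z"
  unfolding xi_def by (intro mult_nonneg_nonpos mult_nonneg_nonneg; simp)+

text \<open>The quantity \<open>r = hb om / En\<close> is constant to the left of \<open>p\<close>
  and to the right of \<open>q\<close>. Square integrability of \<open>om\<close> makes both
  constants 0, so the derivative of \<open>r\<close> integrates to 0 over \<open>{p..q}\<close>. The
  midpoint lies between \<open>p\<close> and \<open>q\<close> so that \<open>xi\<close> has a fixed
  sign on each outer piece.\<close>

lemma strip_obstruction:
  assumes w: "abs_cont_on {l<..<l + pi} (\<lambda>z. complex_of_real (hb l z) * v z) g"
    and u: "abs_cont_on {l..l + pi} u v" and f: "set_borel_measurable lborel {l<..<l + pi} f"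
    and v: "L2_on {l<..<l + pi} v"
    and eq: "AE z in lborel. z \<in> {l<..<l + pi} \<longrightarrow> g z + u z - \<mu> * v z = f z"
    and mu: "\<bar>Re \<mu>\<bar> \<le> pi / 4"
    and pq: "l < p" "p \<le> l + pi / 2" "l + pi / 2 \<le> q" "q < l + pi"
    and f0: "\<And>z. z \<in> {l<..<p} \<union> {q<..<l + pi} \<Longrightarrow> f z = 0"
  shows "(LINT z:{p..q}|lborel. hom l \<mu> z * f z * En l (- \<mu>) z) = 0"
proof -
  define om where "om z = u z - hom l \<mu> z * v z" for z
  define r where "r z = complex_of_real (hb l z) * om z * En l (- \<mu>) z" for z
  have r: "abs_cont_on {l<..<l + pi} r (\<lambda>z. - (hom l \<mu> z * f z * En l (- \<mu>) z))"
    unfolding r_def om_def by (rule wronskian_abs_cont[OF w u f eq])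
  have om: "L2_on {l<..<l + pi} om" unfolding om_def
    by (intro L2_on_diff L2_on_continuous[OF abs_cont_on_continuous[OF u]]
        L2_on_continuous_mult[OF v, of l "l + pi"] continuous_on_hom) auto
  have cm: "(cmod (r z))\<^sup>2 = (hb l z)\<^sup>2 * exp (- 2 * Re \<mu> * xi l z) * (cmod (om z))\<^sup>2" for z
    by (simp add: r_def norm_mult norm_En power_mult_distrib exp_double[symmetric] mult.assoc mult_ac)
  have rp: "r z = r p" if "z \<in> {l<..<p}" for z
  proof -
    have z: "z \<in> {l<..<l + pi}" "p \<in> {l<..<l + pi}" "z \<le> p" using that pq by auto
    have "(LINT t:{z..p}|lborel. - (hom l \<mu> t * f t * En l (- \<mu>) t)) = (LINT t:{z<..<p}|lborel. 0)"
      unfolding set_integral_Icc_Ioo by (rule set_lebesgue_integral_cong) (use f0 that in auto)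
    with abs_cont_onD(2)[OF r z] show ?thesis by simp
  qed
  have rq: "r z = r q" if "z \<in> {q<..<l + pi}" for z
  proof -
    have z: "q \<in> {l<..<l + pi}" "z \<in> {l<..<l + pi}" "q \<le> z" using that pq by auto
    have "(LINT t:{q..z}|lborel. - (hom l \<mu> t * f t * En l (- \<mu>) t)) = (LINT t:{q<..<z}|lborel. 0)"
      unfolding set_integral_Icc_Ioo by (rule set_lebesgue_integral_cong) (use f0 that in auto)
    with abs_cont_onD(2)[OF r z] show ?thesis by simp
  qed
  have "(cmod (r p))\<^sup>2 \<le> 0"
  proof (rule L2_lower_left[OF L2_on_subset[OF om] pq(1)])
    fix z assume z: "z \<in> {l<..<p}"
    then have z': "z \<in> {l<..<l + pi}" "z \<le> l + pi / 2" using pq by auto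
    \<comment> \<open>Here \<open>xi <= 0\<close>, so \<open>Re \<mu> <= pi / 4\<close> bounds the
      exponential by \<open>(l + pi - z) / (z - l)\<close>. This uses up one of the two factors
      \<open>z - l\<close> in \<open>hb^2\<close>; the other is what \<open>L2_lower_left\<close>
      needs.\<close>
    have "(- 2 * Re \<mu>) * xi l z \<le> (- pi / 2) * xi l z"
      by (rule mult_right_mono_neg[OF _ xi_mono(1)[OF z']]) (use mu in auto)
    then have "exp (- 2 * Re \<mu> * xi l z) \<le> inverse (exp (pi / 2 * xi l z))" by (simp add: exp_minus[symmetric])
    then have "(hb l z)\<^sup>2 * exp (- 2 * Re \<mu> * xi l z) \<le> (hb l z)\<^sup>2 * inverse ((z - l) / (l + pi - z))"
      unfolding exp_xi[OF z'(1)] by (rule mult_left_mono) simp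
    also have "\<dots> = ((z - l) / 4) * (l + pi - z) ^ 3"
      using z' by (simp add: hb_def power2_eq_square power3_eq_cube field_simps)
    also have "\<dots> \<le> ((z - l) / 4) * pi ^ 3" using z' by (intro mult_left_mono power_mono) auto
    finally have "(hb l z)\<^sup>2 * exp (- 2 * Re \<mu> * xi l z) * (cmod (om z))\<^sup>2 \<le> ((z - l) / 4) * pi ^ 3 * (cmod (om z))\<^sup>2"
      by (rule mult_right_mono) simp
    then show "(cmod (r p))\<^sup>2 \<le> (pi ^ 3 / 4) * ((z - l) * (cmod (om z))\<^sup>2)"
      unfolding rp[OF z, symmetric] cm by (simp add: mult_ac)
  qed (use pq in auto)
  moreover have "(cmod (r q))\<^sup>2 \<le> 0"
  proof (rule L2_lower_right[OF L2_on_subset[OF om] pq(4)])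
    fix z assume z: "z \<in> {q<..<l + pi}"
    then have z': "z \<in> {l<..<l + pi}" "l + pi / 2 \<le> z" using pq by auto
    \<comment> \<open>The mirror image: now \<open>xi >= 0\<close>, and
      \<open>Re \<mu> >= - pi / 4\<close> is what counts.\<close>
    have "(- 2 * Re \<mu>) * xi l z \<le> (pi / 2) * xi l z"
      by (rule mult_right_mono[OF _ xi_mono(2)[OF z']]) (use mu in auto)
    then have "exp (- 2 * Re \<mu> * xi l z) \<le> exp (pi / 2 * xi l z)" by simp
    then have "(hb l z)\<^sup>2 * exp (- 2 * Re \<mu> * xi l z) \<le> (hb l z)\<^sup>2 * ((z - l) / (l + pi - z))"
      unfolding exp_xi[OF z'(1)] by (rule mult_left_mono) simp
    also have "\<dots> = ((l + pi - z) / 4) * (z - l) ^ 3"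
      using z' by (simp add: hb_def power2_eq_square power3_eq_cube field_simps)
    also have "\<dots> \<le> ((l + pi - z) / 4) * pi ^ 3" using z' by (intro mult_left_mono power_mono) auto
    finally have "(hb l z)\<^sup>2 * exp (- 2 * Re \<mu> * xi l z) * (cmod (om z))\<^sup>2 \<le> ((l + pi - z) / 4) * pi ^ 3 * (cmod (om z))\<^sup>2"
      by (rule mult_right_mono) simp
    then show "(cmod (r q))\<^sup>2 \<le> (pi ^ 3 / 4) * ((l + pi - z) * (cmod (om z))\<^sup>2)"
      unfolding rq[OF z, symmetric] cm by (simp add: mult_ac)
  qed (use pq in auto)
  ultimately have "r p = 0" "r q = 0" by auto
  moreover have pq': "p \<in> {l<..<l + pi}" "q \<in> {l<..<l + pi}" "p \<le> q" using pq by auto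
  ultimately have "(LINT z:{p..q}|lborel. - (hom l \<mu> z * f z * En l (- \<mu>) z)) = 0"
    using abs_cont_onD(2)[OF r pq'] by simp
  moreover have "set_integrable lborel {p..q} (\<lambda>z. hom l \<mu> z * f z * En l (- \<mu>) z)"
    using set_integrable_mult_right[OF abs_cont_onD(1)[OF r pq'], of "-1"] by simp
  ultimately show ?thesis by (simp add: set_integral_uminus)
qed

subsection \<open>Solvability outside the strip\<close>

text \<open>Monotone convergence along compact intervals growing to the open one.\<close>

lemma set_integrable_exhaust:
  fixes G :: "real \<Rightarrow> real"
  assumes lm: "l < m" and G0: "\<And>z. 0 \<le> G z"
    and i: "\<And>p q. l < p \<Longrightarrow> p \<le> q \<Longrightarrow> q < m \<Longrightarrow> set_integrable lborel {p..q} G"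
    and b: "\<And>p q. l < p \<Longrightarrow> p \<le> q \<Longrightarrow> q < m \<Longrightarrow> (LINT z:{p..q}|lborel. G z) \<le> C"
  shows "set_integrable lborel {l<..<m} G"
proof -
  \<comment> \<open>The summand 2 makes \<open>{l + d n .. m - d n}\<close> nonempty already for
    \<open>n = 0\<close>.\<close>
  define d where "d n = (m - l) / (real n + 2)" for n
  define A where "A n = {l + d n .. m - d n}" for n :: nat
  have d0: "d n > 0" "l + d n \<le> m - d n" for n
  proof -
    show "d n > 0" using lm by (simp add: d_def)
    have "d n \<le> (m - l) / 2" unfolding d_def using lm by (intro divide_left_mono) auto
    then show "l + d n \<le> m - d n" by (simp add: field_simps)
  qed
  have dmono: "d j \<le> d i" if "i \<le> j" for i j
    unfolding d_def using lm that by (intro divide_left_mono) auto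
  have d_lim: "d \<longlonglongrightarrow> 0" unfolding d_def by real_asymp
  have un: "(\<Union>n. A n) = {l<..<m}"
  proof safe
    fix x assume x: "x \<in> {l<..<m}"
    then have "min (x - l) (m - x) > 0" by auto
    from order_tendstoD(2)[OF d_lim this] obtain n where "d n < min (x - l) (m - x)"
      by (auto simp: eventually_sequentially)
    then show "x \<in> (\<Union>n. A n)" by (auto simp: A_def intro!: exI[of _ n])
  next
    fix x n assume "x \<in> A n"
    with d0[of n] show "x \<in> {l<..<m}" by (auto simp: A_def)
  qed
  have iA: "set_integrable lborel (A n) G" for n
    unfolding A_def by (rule i) (use d0[of n] in auto)
  define s where "s n = (LINT z:A n|lborel. G z)" for n
  have "incseq s"
    unfolding incseq_def s_def set_lebesgue_integral_def
  proof (intro allI impI Bochner_Integration.integral_mono)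
    fix i j :: nat and x assume "i \<le> j"
    with dmono[of i j] G0 show "indicat_real (A i) x *\<^sub>R G x \<le> indicat_real (A j) x *\<^sub>R G x"
      by (auto simp: A_def indicator_def)
  qed (use iA in \<open>auto simp: set_integrable_def\<close>)
  moreover have "s n \<le> C" for n
    unfolding s_def A_def by (rule b) (use d0[of n] in auto)
  ultimately obtain L where "s \<longlonglongrightarrow> L" using incseq_convergent by blast
  then have "set_integrable lborel (\<Union>n. A n) G"
    unfolding s_def
  proof (intro pos_integrable_to_top)
    show "mono A" 
    proof (rule monoI)
      fix i j :: nat assume "i \<le> j"
      from dmono[OF this] show "A i \<subseteq> A j" by (auto simp: A_def)
    qed
  qed (use G0 iA in \<open>auto simp: A_def\<close>)
  then show ?thesis unfolding un .
qed

text \<open>Nothing is known about integrability of \<open>k\<close> up to the ends, so the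
  primitive is based at the midpoint, with a sign change to its left.\<close>

lemma abs_cont_on_primitive_open:
  assumes lm: "l < m" and i: "\<And>p q. l < p \<Longrightarrow> p \<le> q \<Longrightarrow> q < m \<Longrightarrow> set_integrable lborel {p..q} k"
  shows "\<exists>v. abs_cont_on {l<..<m} v k"
proof -
  define h where "h = (l + m) / 2"
  have h: "l < h" "h < m" using lm by (auto simp: h_def)
  define v where "v z = (if h \<le> z then (LINT t:{h..z}|lborel. k t) else - (LINT t:{z..h}|lborel. k t))" for z
  have "(LINT t:{p..q}|lborel. k t) = v q - v p" if "l < p" "p \<le> q" "q < m" for p q
  proof -
    consider "h \<le> p" | "q < h" | "p < h" "h \<le> q" by linarith
    then show ?thesis
    proof cases
      case 1
      then show ?thesis using set_integral_split[OF i, of h q p] that h by (auto simp: v_def)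
    next
      case 2
      then show ?thesis using set_integral_split[OF i, of p h q] that h by (auto simp: v_def)
    next
      case 3
      then show ?thesis using set_integral_split[OF i, of p q h] that h by (auto simp: v_def)
    qed
  qed
  with i show ?thesis
    unfolding abs_cont_on_def by (intro exI[of _ v] conjI ballI impI) (auto simp: is_interval_oo)
qed

text \<open>Young's inequality \<open>2 |g| |y| <= d |y|^2 + |g|^2 / d\<close> absorbs half of the
  left side before integrating. The factor \<open>\<sigma>\<close>, which is 1 or -1 in the
  applications, is the direction in which the energy \<open>F\<close> grows; it is chosen so that
  the energy at a degenerate end enters with a sign that allows dropping it.\<close>

lemma energy_bound:
  assumes F: "abs_cont_on S F D" and pq: "p \<in> S" "q \<in> S" "p \<le> q" and d: "d > 0"
    and y: "continuous_on {p..q} y" and g: "L2_on {p..q} g"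
    and le: "\<And>z. z \<in> {p..q} \<Longrightarrow> 2 * d * (cmod (y z))\<^sup>2 \<le> \<sigma> * Re (D z) + 2 * (cmod (g z) * cmod (y z))"
  shows "d * (LINT z:{p..q}|lborel. (cmod (y z))\<^sup>2) \<le> \<sigma> * (Re (F q) - Re (F p)) + (LINT z:{p..q}|lborel. (cmod (g z))\<^sup>2) / d"
proof -
  note E = abs_cont_onD[OF F pq]
  have iR: "set_integrable lborel {p..q} (\<lambda>z. Re (D z))"
    and eR: "(LINT z:{p..q}|lborel. Re (D z)) = Re (F q) - Re (F p)"
  proof -
    have *: "(\<lambda>z. indicat_real {p..q} z *\<^sub>R Re (D z)) = (\<lambda>z. Re (indicat_real {p..q} z *\<^sub>R D z))" by auto
    show "set_integrable lborel {p..q} (\<lambda>z. Re (D z))"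
      using E(1) unfolding set_integrable_def * by (rule integrable_Re)
    have "(LINT z:{p..q}|lborel. Re (D z)) = Re (LINT z:{p..q}|lborel. D z)"
      using E(1) unfolding set_lebesgue_integral_def set_integrable_def * by (rule integral_Re)
    then show "(LINT z:{p..q}|lborel. Re (D z)) = Re (F q) - Re (F p)" unfolding E(2) by simp
  qed
  have ig: "set_integrable lborel {p..q} (\<lambda>z. (cmod (g z))\<^sup>2)" by (rule L2_on_square[OF g])
  have iy: "set_integrable lborel {p..q} (\<lambda>z. (cmod (y z))\<^sup>2)"
    by (intro borel_integrable_atLeastAtMost' continuous_intros y)
  have pt: "d * (cmod (y z))\<^sup>2 \<le> \<sigma> * Re (D z) + (cmod (g z))\<^sup>2 / d" if z: "z \<in> {p..q}" for z
  proof -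
    have "0 \<le> (cmod (g z) - d * cmod (y z))\<^sup>2 / d" using d by simp
    also have "\<dots> = (cmod (g z))\<^sup>2 / d - 2 * (cmod (g z) * cmod (y z)) + d * (cmod (y z))\<^sup>2"
      using d by (simp add: power2_eq_square field_simps)
    finally show ?thesis using le[OF z] by linarith
  qed
  have "d * (LINT z:{p..q}|lborel. (cmod (y z))\<^sup>2) = (LINT z:{p..q}|lborel. d * (cmod (y z))\<^sup>2)" by simp
  also have "\<dots> \<le> (LINT z:{p..q}|lborel. \<sigma> * Re (D z) + (cmod (g z))\<^sup>2 / d)"
    by (rule set_integral_mono) (use pt iR ig iy in \<open>auto intro!: set_integral_add\<close>)
  also have "\<dots> = (LINT z:{p..q}|lborel. \<sigma> * Re (D z)) + (LINT z:{p..q}|lborel. (cmod (g z))\<^sup>2 / d)"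
    by (rule set_integral_add(2)) (use iR ig in auto)
  finally show ?thesis using eR by simp
qed

lemma set_integral_subset_mono:
  fixes G :: "real \<Rightarrow> real"
  assumes "set_integrable lborel S G" "T \<in> sets borel" "T \<subseteq> S" "\<And>z. 0 \<le> G z"
  shows "(LINT z:T|lborel. G z) \<le> (LINT z:S|lborel. G z)"
  unfolding set_lebesgue_integral_def
proof (rule Bochner_Integration.integral_mono)
  have "set_integrable lborel T G" by (rule set_integrable_subset[OF assms(1)]) (use assms in auto)
  then show "integrable lborel (\<lambda>x. indicat_real T x *\<^sub>R G x)" unfolding set_integrable_def .
  show "integrable lborel (\<lambda>x. indicat_real S x *\<^sub>R G x)" using assms(1) unfolding set_integrable_def .
qed (use assms in \<open>auto simp: indicator_def\<close>)

lemma set_integral_nonneg_real: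
  fixes G :: "real \<Rightarrow> real"
  assumes "\<And>z. 0 \<le> G z"
  shows "0 \<le> (LINT z:S|lborel. G z)"
  unfolding set_lebesgue_integral_def
  by (rule Bochner_Integration.integral_nonneg) (use assms in auto)

lemma xi_less: "z \<in> {l<..<l + pi} \<Longrightarrow> t \<in> {l<..<l + pi} \<Longrightarrow> z \<le> t \<Longrightarrow> xi l z \<le> xi l t"
  unfolding xi_def by (intro mult_left_mono diff_mono) auto

text \<open>Solutions differ by multiples of \<open>En / hb\<close>, which for
  \<open>Re \<mu> > pi / 4\<close> is square integrable at the left end but not at the right one. So
  the integration constant is fixed by integrating from the right end. The energy
  \<open>hb |om|^2\<close> then gives a bound on compact subintervals that does not depend on
  them.\<close>

lemma half_omega:
  assumes f: "L2_on {l<..<l + pi} f" and mu: "Re \<mu> > pi / 4"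
  shows "\<exists>om. L2_on {l<..<l + pi} om \<and>
     abs_cont_on {l<..<l + pi} om (\<lambda>z. hom l \<mu> z * (om z - f z) / complex_of_real (hb l z))"
proof -
  let ?J = "{l<..<l + pi}"
  define h where "h z = hom l \<mu> z * f z" for z
  have h: "L2_on ?J h"
    unfolding h_def by (rule L2_on_continuous_mult[OF f, of l "l + pi"]) (auto intro: continuous_on_hom)
  define H where "H = (LINT z:?J|lborel. (cmod (h z))\<^sup>2)"
  have H0: "H \<ge> 0" unfolding H_def by (rule set_integral_nonneg_real) simp
  define K where "K z = h z * En l (- \<mu>) z" for z
  \<comment> \<open>\<open>xi\<close> is increasing and \<open>Re \<mu>\<close> positive, so
    \<open>1 / En\<close> decreases in modulus; this makes \<open>K\<close> integrable up to the
    right end.\<close>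
  have En_le: "cmod (En l (- \<mu>) t) \<le> cmod (En l (- \<mu>) z)" if "z \<in> ?J" "t \<in> ?J" "z \<le> t" for z t
  proof -
    have "0 \<le> Re \<mu>" using mu pi_gt_zero by linarith
    then show ?thesis unfolding norm_En using xi_less[OF that] by (auto intro!: mult_left_mono)
  qed
  have Ki: "set_integrable lborel {z..l + pi} K" if z: "z \<in> ?J" for z
  proof -
    have hz: "L2_on {z<..<l + pi} h" by (rule L2_on_subset[OF h]) (use z in auto)
    have "set_integrable lborel {z<..<l + pi} K" unfolding K_def
      by (rule set_integrable_bounded_mult[OF L2_on_integrable[OF hz, of z "l + pi"], of _ "cmod (En l (- \<mu>) z)"])
        (use z in \<open>auto intro!: set_borel_measurable_continuous_on continuous_on_En En_le\<close>)
    then show ?thesis by (simp add: set_integrable_Icc_Ioo)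
  qed
  define r where "r z = (LINT t:{z..l + pi}|lborel. K t)" for z
  have r: "abs_cont_on ?J r (\<lambda>z. (- 1) * K z)"
    unfolding abs_cont_on_def
  proof (intro conjI ballI impI)
    fix p q assume pq: "p \<in> ?J" "q \<in> ?J" "p \<le> q"
    have i: "set_integrable lborel {p..q} K" by (rule set_integrable_subset[OF Ki[OF pq(1)]]) (use pq in auto)
    then show "set_integrable lborel {p..q} (\<lambda>z. (- 1) * K z)" by (rule set_integrable_mult_right)
    have "r p = (LINT t:{p..q}|lborel. K t) + r q"
      unfolding r_def by (rule set_integral_split[OF Ki[OF pq(1)]]) (use pq in auto)
    then show "(LINT t:{p..q}|lborel. (- 1) * K t) = r q - r p" by (subst set_integral_mult_right) simp
  qed (simp add: is_interval_oo)
  define W where "W z = En l \<mu> z * r z" for z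
  define om where "om z = W z * (1 / complex_of_real (hb l z))" for z
  have hbn: "complex_of_real (hb l z) \<noteq> 0" if "z \<in> ?J" for z using hb_pos[OF that] by simp
  have W: "abs_cont_on ?J W (\<lambda>z. \<mu> * om z - h z)"
  proof (rule abs_cont_on_ident[OF abs_cont_on_mult[OF En_abs_cont r]])
    fix z assume "z \<in> ?J"
    show "\<mu> * En l \<mu> z / complex_of_real (hb l z) * r z + En l \<mu> z * (- 1 * K z) = \<mu> * om z - h z"
      using En_uminus(2)[of l \<mu> z] by (simp add: om_def W_def K_def mult_ac)
  qed (simp add: W_def)
  have om: "abs_cont_on ?J om (\<lambda>z. hom l \<mu> z * (om z - f z) / complex_of_real (hb l z))"
  proof (rule abs_cont_on_ident[OF abs_cont_on_mult[OF W inverse_hb_abs_cont]])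
    fix z assume z: "z \<in> ?J"
    have Wz: "W z = om z * complex_of_real (hb l z)" using hbn[OF z] by (simp add: om_def)
    have d: "complex_of_real (l + pi / 2 - z) = \<mu> - hom l \<mu> z" by (simp add: hom_def)
    show "(\<mu> * om z - h z) * (1 / complex_of_real (hb l z)) + W z * (- complex_of_real (l + pi / 2 - z) / (complex_of_real (hb l z))\<^sup>2)
      = hom l \<mu> z * (om z - f z) / complex_of_real (hb l z)"
      unfolding Wz d h_def using hbn[OF z] by (simp add: power2_eq_square field_simps)
  qed (simp add: om_def)
  have omc: "continuous_on ?J om" by (rule abs_cont_on_continuous[OF om])
  \<comment> \<open>The energy \<open>hb |om|^2\<close>, written through \<open>W = hb om\<close>,
    whose derivative \<open>\<mu> om - h\<close> carries no factor \<open>1 / hb\<close>.\<close>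
  define F where "F z = W z * cnj (W z) * (1 / complex_of_real (hb l z))" for z
  define D where "D z = (\<mu> * om z - h z) * cnj (om z) + om z * cnj (\<mu> * om z - h z) - complex_of_real ((l + pi / 2 - z) * (cmod (om z))\<^sup>2)" for z
  have F: "abs_cont_on ?J F D"
  proof (rule abs_cont_on_ident[OF abs_cont_on_mult[OF abs_cont_on_mult[OF W abs_cont_on_cnj[OF W]] inverse_hb_abs_cont]])
    fix z assume z: "z \<in> ?J"
    have Wz: "W z = om z * complex_of_real (hb l z)" using hbn[OF z] by (simp add: om_def)
    have e: "complex_of_real ((l + pi / 2 - z) * (cmod (om z))\<^sup>2) = complex_of_real (l + pi / 2 - z) * (om z * cnj (om z))"
      by (simp only: of_real_mult complex_norm_square)
    show "((\<mu> * om z - h z) * cnj (W z) + W z * cnj (\<mu> * om z - h z)) * (1 / complex_of_real (hb l z)) +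
         W z * cnj (W z) * (- complex_of_real (l + pi / 2 - z) / (complex_of_real (hb l z))\<^sup>2) = D z"
      unfolding Wz D_def e using hbn[OF z]
      by (simp add: power2_eq_square field_simps del: of_real_add of_real_diff)
  qed (simp add: F_def)
  have ReF: "Re (F z) = (cmod (W z))\<^sup>2 / hb l z" for z
    unfolding F_def complex_norm_square[symmetric] by simp
  define d where "d = Re \<mu> - pi / 4"
  have d: "d > 0" using mu by (simp add: d_def)
  have le: "2 * d * (cmod (om z))\<^sup>2 \<le> 1 * Re (D z) + 2 * (cmod (h z) * cmod (om z))" if z: "z \<in> ?J" for z
  proof -
    have "Re (D z) = (2 * Re \<mu> - (l + pi / 2 - z)) * (cmod (om z))\<^sup>2 - 2 * Re (h z * cnj (om z))"
      by (simp add: D_def cmod_power2 algebra_simps) (simp add: power2_eq_square algebra_simps)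
    moreover have "2 * d * (cmod (om z))\<^sup>2 \<le> (2 * Re \<mu> - (l + pi / 2 - z)) * (cmod (om z))\<^sup>2"
      by (rule mult_right_mono) (use z in \<open>auto simp: d_def\<close>)
    moreover have "Re (h z * cnj (om z)) \<le> cmod (h z) * cmod (om z)"
      using complex_Re_le_cmod[of "h z * cnj (om z)"] by (simp add: norm_mult)
    ultimately show ?thesis by linarith
  qed
  \<comment> \<open>The boundary term has to stay bounded as \<open>q\<close> approaches the right
    end. \<open>|W q|\<close> is at most the integral of \<open>|h|\<close> over the remaining
    length \<open>\<delta>\<close>, which is of order \<open>sqrt \<delta>\<close>, while
    \<open>hb l q >= pi \<delta> / 4\<close> to the right of the midpoint.\<close>
  have Wb: "(cmod (W q))\<^sup>2 / hb l q \<le> (1 + H)\<^sup>2 / pi" if q: "q \<in> ?J" "l + pi / 2 \<le> q" for q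
  proof -
    define \<delta> where "\<delta> = l + pi - q"
    have \<delta>: "\<delta> > 0" using q by (simp add: \<delta>_def)
    \<comment> \<open>Weight for \<open>|h| <= (s + |h|^2 / s) / 2\<close>, used in place of the
      Cauchy-Schwarz inequality: with it both terms integrate to the order
      \<open>sqrt \<delta>\<close>.\<close>
    define s where "s = 1 / sqrt \<delta>"
    have s: "s > 0" "s * \<delta> = sqrt \<delta>" using \<delta> by (auto simp: s_def real_div_sqrt)
    have hq: "L2_on {q<..<l + pi} h" by (rule L2_on_subset[OF h]) (use q in auto)
    have ib: "set_integrable lborel {q<..<l + pi} (\<lambda>t. (s + (cmod (h t))\<^sup>2 / s) / 2)"
    proof -
      have "set_integrable lborel {q..l + pi} (\<lambda>t. s)" by (intro borel_integrable_atLeastAtMost' continuous_intros)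
      then have "set_integrable lborel {q<..<l + pi} (\<lambda>t. s)" by (simp add: set_integrable_Icc_Ioo)
      then show ?thesis using L2_on_square[OF hq] by (intro set_integrable_divide set_integral_add(1)) auto
    qed
    have "cmod (W q) = cmod (LINT t:{q<..<l + pi}|lborel. En l \<mu> q * K t)"
      by (simp add: W_def r_def set_integral_Icc_Ioo)
    also have "\<dots> \<le> (LINT t:{q<..<l + pi}|lborel. cmod (En l \<mu> q * K t))"
    proof (rule set_integral_norm_bound)
      show "set_integrable lborel {q<..<l + pi} (\<lambda>t. En l \<mu> q * K t)"
        using Ki[OF q(1)] by (simp add: set_integrable_Icc_Ioo)
    qed
    also have "\<dots> \<le> (LINT t:{q<..<l + pi}|lborel. (s + (cmod (h t))\<^sup>2 / s) / 2)"
    proof (rule set_integral_mono)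
      show "set_integrable lborel {q<..<l + pi} (\<lambda>t. cmod (En l \<mu> q * K t))"
        using Ki[OF q(1)] by (intro set_integrable_norm) (simp add: set_integrable_Icc_Ioo)
      show "set_integrable lborel {q<..<l + pi} (\<lambda>t. (s + (cmod (h t))\<^sup>2 / s) / 2)" by (rule ib)
      fix t assume t: "t \<in> {q<..<l + pi}"
      have "cmod (En l \<mu> q * K t) = cmod (h t) * (cmod (En l \<mu> q) * cmod (En l (- \<mu>) t))"
        by (simp add: K_def norm_mult mult_ac)
      also have "\<dots> \<le> cmod (h t) * (cmod (En l \<mu> q) * cmod (En l (- \<mu>) q))"
        using q t by (intro mult_left_mono En_le) auto
      also have "\<dots> = cmod (h t)" using En_uminus(2)[of l \<mu> q] by (simp flip: norm_mult)
      also have "\<dots> \<le> (s + (cmod (h t))\<^sup>2 / s) / 2"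
      proof -
        have "0 \<le> (cmod (h t) - s)\<^sup>2 / s" using s by simp
        also have "\<dots> = (cmod (h t))\<^sup>2 / s - 2 * cmod (h t) + s"
          using s(1) by (simp add: power2_eq_square field_simps)
        finally show ?thesis by simp
      qed
      finally show "cmod (En l \<mu> q * K t) \<le> (s + (cmod (h t))\<^sup>2 / s) / 2" .
    qed
    also have "\<dots> = (s * \<delta> + (LINT t:{q<..<l + pi}|lborel. (cmod (h t))\<^sup>2) / s) / 2"
    proof -
      have "set_integrable lborel {q..l + pi} (\<lambda>t. s)" by (intro borel_integrable_atLeastAtMost' continuous_intros)
      then have i_s: "set_integrable lborel {q<..<l + pi} (\<lambda>t. s)" by (simp add: set_integrable_Icc_Ioo)
      have "(LINT t:{q<..<l + pi}|lborel. s + (cmod (h t))\<^sup>2 / s) = (LINT t:{q<..<l + pi}|lborel. s) + (LINT t:{q<..<l + pi}|lborel. (cmod (h t))\<^sup>2 / s)"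
        by (rule set_integral_add(2)[OF i_s]) (use L2_on_square[OF hq] in auto)
      moreover have "(LINT t:{q<..<l + pi}|lborel. s) = s * \<delta>"
        using \<delta> by (simp add: set_lebesgue_integral_def \<delta>_def)
      ultimately show ?thesis by simp
    qed
    also have "\<dots> \<le> (s * \<delta> + H / s) / 2"
      unfolding H_def using s q
      by (intro divide_right_mono add_left_mono set_integral_subset_mono L2_on_square h) auto
    also have "\<dots> = sqrt \<delta> * (1 + H) / 2" using \<delta> by (simp add: s(2)) (simp add: s_def algebra_simps)
    finally have "cmod (W q) \<le> sqrt \<delta> * (1 + H) / 2" .
    then have "(cmod (W q))\<^sup>2 \<le> (sqrt \<delta> * (1 + H) / 2)\<^sup>2" by (rule power_mono) simp
    also have "\<dots> = \<delta> * (1 + H)\<^sup>2 / 4" using \<delta> by (simp add: power_mult_distrib power_divide)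
    finally have "(cmod (W q))\<^sup>2 / hb l q \<le> (\<delta> * (1 + H)\<^sup>2 / 4) / hb l q"
      using hb_pos[OF q(1)] by (intro divide_right_mono) auto
    also have "\<dots> \<le> (\<delta> * (1 + H)\<^sup>2 / 4) / (pi * \<delta> / 4)"
    proof (rule divide_left_mono)
      have "pi / 2 * \<delta> \<le> (q - l) * \<delta>" using q \<delta> by (intro mult_right_mono) auto
      then show "pi * \<delta> / 4 \<le> hb l q" by (simp add: hb_def \<delta>_def)
    qed (use \<delta> hb_pos[OF q(1)] in auto)
    also have "\<dots> = (1 + H)\<^sup>2 / pi" using \<delta> by simp
    finally show ?thesis .
  qed
  define C where "C = ((1 + H)\<^sup>2 / pi + H / d) / d"
  have bound1: "(LINT z:{p..q}|lborel. (cmod (om z))\<^sup>2) \<le> C" if pq: "p \<in> ?J" "q \<in> ?J" "p \<le> q" "l + pi / 2 \<le> q" for p q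
  proof -
    have sub: "{p..q} \<subseteq> ?J" using pq by auto
    have "d * (LINT z:{p..q}|lborel. (cmod (om z))\<^sup>2) \<le> 1 * (Re (F q) - Re (F p)) + (LINT z:{p..q}|lborel. (cmod (h z))\<^sup>2) / d"
      by (rule energy_bound[OF F pq(1-3) d continuous_on_subset[OF omc sub] L2_on_subset[OF h _ sub] le]) (use sub in auto)
    moreover have "(LINT z:{p..q}|lborel. (cmod (h z))\<^sup>2) / d \<le> H / d"
      unfolding H_def using d sub by (intro divide_right_mono set_integral_subset_mono L2_on_square h) auto
    moreover have "Re (F p) \<ge> 0" unfolding ReF using hb_pos[OF pq(1)] by simp
    moreover have "Re (F q) \<le> (1 + H)\<^sup>2 / pi" unfolding ReF by (rule Wb[OF pq(2,4)])
    ultimately have "d * (LINT z:{p..q}|lborel. (cmod (om z))\<^sup>2) \<le> (1 + H)\<^sup>2 / pi + H / d"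
      unfolding mult_1_left by linarith
    then show ?thesis unfolding C_def using d by (simp add: pos_le_divide_eq mult.commute)
  qed
  have iom: "set_integrable lborel {p..q} (\<lambda>z. (cmod (om z))\<^sup>2)" if "l < p" "q < l + pi" for p q
    by (intro borel_integrable_atLeastAtMost' continuous_intros continuous_on_subset[OF omc]) (use that in auto)
  have "set_integrable lborel ?J (\<lambda>z. (cmod (om z))\<^sup>2)"
  proof (rule set_integrable_exhaust)
    fix p q assume pq: "l < p" "p \<le> q" "q < l + pi"
    show "set_integrable lborel {p..q} (\<lambda>z. (cmod (om z))\<^sup>2)" by (rule iom[OF pq(1,3)])
    \<comment> \<open>The boundary bound holds only beyond the midpoint, so the interval is first
      enlarged to reach it.\<close>
    have "(LINT z:{p..q}|lborel. (cmod (om z))\<^sup>2) \<le> (LINT z:{p..max q (l + pi / 2)}|lborel. (cmod (om z))\<^sup>2)"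
      by (intro set_integral_subset_mono iom) (use pq in auto)
    also have "\<dots> \<le> C" by (rule bound1) (use pq in auto)
    finally show "(LINT z:{p..q}|lborel. (cmod (om z))\<^sup>2) \<le> C" .
  qed auto
  moreover have "set_borel_measurable lborel ?J om" by (rule set_borel_measurable_continuous_on[OF omc]) simp
  ultimately show ?thesis using om unfolding L2_on_def by blast
qed

lemma half_integrate:
  assumes g: "L2_on {l<..<l + pi} g"
    and v: "abs_cont_on {l<..<l + pi} v (\<lambda>z. g z / complex_of_real (hb l z))"
  shows "L2_on {l<..<l + pi} v"
proof -
  let ?J = "{l<..<l + pi}"
  have vc: "continuous_on ?J v" by (rule abs_cont_on_continuous[OF v])
  define F where "F z = complex_of_real (hb l z) * (v z * cnj (v z))" for z
  define D where "D z = complex_of_real ((l + pi / 2 - z) * (cmod (v z))\<^sup>2) + (g z * cnj (v z) + v z * cnj (g z))" for z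
  have F: "abs_cont_on ?J F D"
  proof (rule abs_cont_on_ident[OF abs_cont_on_mult[OF hb_abs_cont abs_cont_on_mult[OF v abs_cont_on_cnj[OF v]]]])
    fix z assume z: "z \<in> ?J"
    have e: "complex_of_real ((l + pi / 2 - z) * (cmod (v z))\<^sup>2) = complex_of_real (l + pi / 2 - z) * (v z * cnj (v z))"
      by (simp only: of_real_mult complex_norm_square)
    show "complex_of_real (l + pi / 2 - z) * (v z * cnj (v z)) + complex_of_real (hb l z) *
       (g z / complex_of_real (hb l z) * cnj (v z) + v z * cnj (g z / complex_of_real (hb l z))) = D z"
      unfolding D_def e using hb_pos[OF z] by (simp add: field_simps del: of_real_add of_real_diff)
  qed (simp_all add: F_def is_interval_oo)
  have ReF: "Re (F z) = hb l z * (cmod (v z))\<^sup>2" for z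
    unfolding F_def complex_norm_square[symmetric] by simp
  have ReD: "Re (D z) = (l + pi / 2 - z) * (cmod (v z))\<^sup>2 + 2 * Re (g z * cnj (v z))" for z
    by (simp add: D_def)
  have Rb: "\<bar>Re (g z * cnj (v z))\<bar> \<le> cmod (g z) * cmod (v z)" for z
    using abs_Re_le_cmod[of "g z * cnj (v z)"] by (simp add: norm_mult)
  define G where "G = (LINT z:?J|lborel. (cmod (g z))\<^sup>2)"
  have iv: "set_integrable lborel {p..q} (\<lambda>z. (cmod (v z))\<^sup>2)" if "l < p" "q < l + pi" for p q
    by (intro borel_integrable_atLeastAtMost' continuous_intros continuous_on_subset[OF vc]) (use that in auto)
  \<comment> \<open>\<open>hb'\<close> is at least \<open>pi / 4\<close> left of \<open>a\<close>
    and at most \<open>- pi / 4\<close> right of \<open>b\<close>; \<open>energy_bound\<close> is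
    stated with \<open>2 d\<close>, hence \<open>d = pi / 8\<close>.\<close>
  have d: "pi / 8 > 0" by simp
  define a where "a = l + pi / 4"
  define b where "b = l + 3 * pi / 4"
  have ab: "a \<in> ?J" "b \<in> ?J" by (auto simp: a_def b_def)
  have Gb: "(LINT z:{p..q}|lborel. (cmod (g z))\<^sup>2) / (pi / 8) \<le> G / (pi / 8)" if "l < p" "q < l + pi" for p q
    unfolding G_def using that by (intro divide_right_mono set_integral_subset_mono L2_on_square g) auto
  have left: "pi / 8 * (LINT z:{p..q}|lborel. (cmod (v z))\<^sup>2) \<le> hb l a * (cmod (v a))\<^sup>2 + G / (pi / 8)"
    if pq: "l < p" "p \<le> q" "q < a" for p q
  proof -
    have pa: "p \<in> ?J" "p \<le> a" and sub: "{p..a} \<subseteq> ?J" using pq ab by auto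
    have "pi / 8 * (LINT z:{p..a}|lborel. (cmod (v z))\<^sup>2) \<le> 1 * (Re (F a) - Re (F p)) + (LINT z:{p..a}|lborel. (cmod (g z))\<^sup>2) / (pi / 8)"
    proof (rule energy_bound[OF F pa(1) ab(1) pa(2) d continuous_on_subset[OF vc sub] L2_on_subset[OF g _ sub]])
      fix z assume z: "z \<in> {p..a}"
      have "(pi / 4) * (cmod (v z))\<^sup>2 \<le> (l + pi / 2 - z) * (cmod (v z))\<^sup>2"
        by (rule mult_right_mono) (use z in \<open>auto simp: a_def\<close>)
      with Rb[of z] show "2 * (pi / 8) * (cmod (v z))\<^sup>2 \<le> 1 * Re (D z) + 2 * (cmod (g z) * cmod (v z))"
        unfolding ReD by (simp add: abs_le_iff)
    qed simp
    moreover have "Re (F p) \<ge> 0" unfolding ReF using hb_pos[OF pa(1)] by simp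
    moreover have "pi / 8 * (LINT z:{p..q}|lborel. (cmod (v z))\<^sup>2) \<le> pi / 8 * (LINT z:{p..a}|lborel. (cmod (v z))\<^sup>2)"
      by (intro mult_left_mono set_integral_subset_mono iv) (use pq ab in auto)
    moreover have "(LINT z:{p..a}|lborel. (cmod (g z))\<^sup>2) / (pi / 8) \<le> G / (pi / 8)" by (rule Gb) (use pa ab in auto)
    moreover have "E' \<le> B' + G'" if "A' \<le> 1 * (B' - C') + D'" "0 \<le> C'" "E' \<le> A'" "D' \<le> G'" for A' B' C' D' E' G' :: real
      using that unfolding mult_1_left by linarith
    ultimately show ?thesis unfolding ReF[of a] by blast
  qed
  have right: "pi / 8 * (LINT z:{p..q}|lborel. (cmod (v z))\<^sup>2) \<le> hb l b * (cmod (v b))\<^sup>2 + G / (pi / 8)"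
    if pq: "b < p" "p \<le> q" "q < l + pi" for p q
  proof -
    have qb: "q \<in> ?J" "b \<le> q" and sub: "{b..q} \<subseteq> ?J" using pq ab by auto
    have "pi / 8 * (LINT z:{b..q}|lborel. (cmod (v z))\<^sup>2) \<le> (- 1) * (Re (F q) - Re (F b)) + (LINT z:{b..q}|lborel. (cmod (g z))\<^sup>2) / (pi / 8)"
    proof (rule energy_bound[OF F ab(2) qb d continuous_on_subset[OF vc sub] L2_on_subset[OF g _ sub]])
      fix z assume z: "z \<in> {b..q}"
      have "(pi / 4) * (cmod (v z))\<^sup>2 \<le> - (l + pi / 2 - z) * (cmod (v z))\<^sup>2"
        by (rule mult_right_mono) (use z in \<open>auto simp: b_def\<close>)
      with Rb[of z] show "2 * (pi / 8) * (cmod (v z))\<^sup>2 \<le> (- 1) * Re (D z) + 2 * (cmod (g z) * cmod (v z))"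
        unfolding ReD by (simp add: abs_le_iff algebra_simps)
    qed simp
    moreover have "Re (F q) \<ge> 0" unfolding ReF using hb_pos[OF qb(1)] by simp
    moreover have "pi / 8 * (LINT z:{p..q}|lborel. (cmod (v z))\<^sup>2) \<le> pi / 8 * (LINT z:{b..q}|lborel. (cmod (v z))\<^sup>2)"
      by (intro mult_left_mono set_integral_subset_mono iv) (use pq ab in auto)
    moreover have "(LINT z:{b..q}|lborel. (cmod (g z))\<^sup>2) / (pi / 8) \<le> G / (pi / 8)" by (rule Gb) (use qb ab in auto)
    moreover have "E' \<le> B' + G'" if "A' \<le> (- 1) * (C' - B') + D'" "0 \<le> C'" "E' \<le> A'" "D' \<le> G'" for A' B' C' D' E' G' :: real
      using that by (simp add: algebra_simps)
    ultimately show ?thesis unfolding ReF[of b] by blast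
  qed
  have div: "x \<le> y / (pi / 8)" if "pi / 8 * x \<le> y" for x y :: real
    using that by (simp add: field_simps)
  have "set_integrable lborel {l<..<a} (\<lambda>z. (cmod (v z))\<^sup>2)"
    by (rule set_integrable_exhaust[OF _ _ iv div[OF left]]) (use ab in auto)
  moreover have "set_integrable lborel {b<..<l + pi} (\<lambda>z. (cmod (v z))\<^sup>2)"
    by (rule set_integrable_exhaust[OF _ _ iv div[OF right]]) (use ab in auto)
  moreover have "set_integrable lborel {a..b} (\<lambda>z. (cmod (v z))\<^sup>2)" by (rule iv) (use ab in auto)
  ultimately have "set_integrable lborel (({l<..<a} \<union> {a..b}) \<union> {b<..<l + pi}) (\<lambda>z. (cmod (v z))\<^sup>2)"
    by (intro set_integrable_Un) auto
  also have "({l<..<a} \<union> {a..b}) \<union> {b<..<l + pi} = ?J" using ab by auto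
  finally show ?thesis
    unfolding L2_on_def using set_borel_measurable_continuous_on[OF vc] by simp
qed

text \<open>Absolute continuity of \<open>hb v\<close> is asked on the closed half period. As
  \<open>hb\<close> is 0 at the ends, this says that \<open>hb v\<close> tends to 0 there, which is
  what permits gluing.\<close>

definition half_sol :: "real \<Rightarrow> complex \<Rightarrow> (real \<Rightarrow> complex) \<Rightarrow> (real \<Rightarrow> complex) \<Rightarrow> (real \<Rightarrow> complex) \<Rightarrow> bool" where
  "half_sol l \<mu> f v u \<longleftrightarrow> L2_on {l<..<l + pi} v \<and> abs_cont_on {l..l + pi} u v
     \<and> abs_cont_on {l..l + pi} (\<lambda>z. complex_of_real (hb l z) * v z) (\<lambda>z. f z - u z + \<mu> * v z)"

text \<open>The two first-order problems in turn: \<open>om\<close> from \<open>half_omega\<close>,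
  then \<open>v\<close> from \<open>hb v' = f - om\<close>, and finally
  \<open>u = om + hom v\<close>, extended continuously to the ends.\<close>

lemma half_sol_right_strip:
  assumes f: "L2_on {l<..<l + pi} f" and mu: "Re \<mu> > pi / 4"
  shows "\<exists>v u. half_sol l \<mu> f v u"
proof -
  let ?J = "{l<..<l + pi}"
  obtain om where omL: "L2_on ?J om" and
     om: "abs_cont_on ?J om (\<lambda>z. hom l \<mu> z * (om z - f z) / complex_of_real (hb l z))"
    using half_omega[OF f mu] by blast
  define g where "g z = f z - om z" for z
  have g: "L2_on ?J g" unfolding g_def by (intro L2_on_diff f omL) simp
  have "\<exists>v. abs_cont_on ?J v (\<lambda>z. g z * (1 / complex_of_real (hb l z)))"
  proof (rule abs_cont_on_primitive_open)
    fix p q assume pq: "l < p" "p \<le> q" "q < l + pi"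
    have "L2_on {p..q} g" by (rule L2_on_subset[OF g]) (use pq in auto)
    then have "set_integrable lborel {p..q} g" by (rule L2_on_integrable[of _ _ p q]) auto
    then show "set_integrable lborel {p..q} (\<lambda>z. g z * (1 / complex_of_real (hb l z)))"
      by (rule set_integrable_continuous_mult)
        (use pq in \<open>auto intro!: continuous_on_subset[OF abs_cont_on_continuous[OF inverse_hb_abs_cont[of l]]]\<close>)
  qed simp
  then obtain v where v: "abs_cont_on ?J v (\<lambda>z. g z / complex_of_real (hb l z))" by auto
  have vL: "L2_on ?J v" by (rule half_integrate[OF g v])
  have hbn: "complex_of_real (hb l z) \<noteq> 0" if "z \<in> ?J" for z using hb_pos[OF that] by simp
  \<comment> \<open>The singular terms \<open>hom (om - f) / hb\<close> and
    \<open>hom g / hb\<close> cancel because \<open>g = f - om\<close>.\<close>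
  have u0: "abs_cont_on ?J (\<lambda>z. om z + hom l \<mu> z * v z) v"
  proof (rule abs_cont_on_ident[OF abs_cont_on_add[OF om abs_cont_on_mult[OF hom_abs_cont v]]])
    fix z assume "z \<in> ?J"
    then show "hom l \<mu> z * (om z - f z) / complex_of_real (hb l z) + (1 * v z + hom l \<mu> z * (g z / complex_of_real (hb l z))) = v z"
      using hbn by (simp add: g_def field_simps)
  qed (auto simp: is_interval_oo)
  have vi: "set_integrable lborel ?J v" by (rule L2_on_integrable[OF vL, of l "l + pi"]) auto
  obtain c where c: "\<And>z. z \<in> ?J \<Longrightarrow> om z + hom l \<mu> z * v z = c + (LINT t:{l..z}|lborel. v t)"
     "abs_cont_on {l..l + pi} (\<lambda>z. c + (LINT t:{l..z}|lborel. v t)) v"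
    using abs_cont_on_extend[OF u0 vi] by auto
  define u where "u z = c + (LINT t:{l..z}|lborel. v t)" for z
  have u: "abs_cont_on {l..l + pi} u v" using c(2) unfolding u_def .
  have uL: "L2_on ?J u"
    by (rule L2_on_continuous[OF abs_cont_on_continuous[OF u]]) auto
  have w: "abs_cont_on ?J (\<lambda>z. complex_of_real (hb l z) * v z) (\<lambda>z. f z - u z + \<mu> * v z)"
  proof (rule abs_cont_on_ident[OF abs_cont_on_mult[OF hb_abs_cont v]])
    fix z assume z: "z \<in> ?J"
    have d: "complex_of_real (l + pi / 2 - z) = \<mu> - hom l \<mu> z" by (simp add: hom_def)
    have uz: "u z = om z + hom l \<mu> z * v z" using c(1)[OF z] by (simp add: u_def)
    show "complex_of_real (l + pi / 2 - z) * v z + complex_of_real (hb l z) * (g z / complex_of_real (hb l z)) = f z - u z + \<mu> * v z"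
      unfolding d uz g_def using hbn[OF z] by (simp add: field_simps)
  qed (auto simp: is_interval_oo)
  have "L2_on ?J (\<lambda>z. f z - u z + \<mu> * v z)"
    by (intro L2_on_add L2_on_diff L2_on_cmult f uL vL) auto
  then have "set_integrable lborel ?J (\<lambda>z. f z - u z + \<mu> * v z)"
    by (rule L2_on_integrable[of _ _ l "l + pi"]) auto
  from half_extend[OF w vL this] u vL show ?thesis unfolding half_sol_def by blast
qed

text \<open>\<open>hb\<close> is symmetric about the midpoint and derivatives change sign under the
  reflection, so \<open>\<mu>\<close>, \<open>f\<close> and \<open>u\<close> change sign while
  \<open>v\<close> does not.\<close>

lemma half_sol_reflect:
  assumes "half_sol l (- \<mu>) (\<lambda>z. - f (l + (l + pi) - z)) v u"
  shows "half_sol l \<mu> f (\<lambda>z. v (l + (l + pi) - z)) (\<lambda>z. - u (l + (l + pi) - z))"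
proof -
  have hb: "hb l (l + (l + pi) - z) = hb l z" for z by (simp add: hb_def)
  have v: "L2_on {l<..<l + pi} v" and u: "abs_cont_on {l..l + pi} u v"
    and w: "abs_cont_on {l..l + pi} (\<lambda>z. complex_of_real (hb l z) * v z) (\<lambda>z. - f (l + (l + pi) - z) - u z + (- \<mu>) * v z)"
    using assms unfolding half_sol_def by auto
  have "abs_cont_on {l..l + pi} (\<lambda>z. - u (l + (l + pi) - z)) (\<lambda>z. v (l + (l + pi) - z))"
    using abs_cont_on_cmult[OF abs_cont_on_reflect[OF u], of "- 1"] by simp
  moreover have "abs_cont_on {l..l + pi} (\<lambda>z. complex_of_real (hb l z) * v (l + (l + pi) - z))
     (\<lambda>z. f z - - u (l + (l + pi) - z) + \<mu> * v (l + (l + pi) - z))"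
    by (rule abs_cont_on_ident[OF abs_cont_on_reflect[OF w]]) (simp_all only: hb, simp add: algebra_simps)
  ultimately show ?thesis unfolding half_sol_def using L2_on_reflect[OF v] by blast
qed

lemma half_sol_exists:
  assumes f: "L2_on {l<..<l + pi} f" and mu: "\<bar>Re \<mu>\<bar> > pi / 4"
  shows "\<exists>v u. half_sol l \<mu> f v u"
proof (cases "Re \<mu> > pi / 4")
  case True then show ?thesis by (rule half_sol_right_strip[OF f])
next
  case False
  with mu have "Re (- \<mu>) > pi / 4" by simp
  moreover have "L2_on {l<..<l + pi} (\<lambda>z. - f (l + (l + pi) - z))"
    using L2_on_cmult[OF L2_on_reflect[OF f], of "- 1"] by simp
  ultimately show ?thesis using half_sol_right_strip half_sol_reflect by blast
qed

subsection \<open>The spectrum\<close>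

lemma L2dot_iff: "f \<in> L2dot \<longleftrightarrow> L2_on Iper f \<and> (LINT x:Iper|lborel. f x) = 0"
  by (simp add: L2dot_def L2_on_def)

lemma Iper_integrable: "L2_on Iper f \<Longrightarrow> set_integrable lborel Iper f"
  by (rule L2_on_integrable[of _ _ "-pi" pi]) auto

lemma Iper_null: "Iper \<subseteq> ({-pi<..<0} \<union> {0<..<pi}) \<union> {0}"
  by auto

lemma L2_on_Iper: "L2_on {-pi<..<0} f \<Longrightarrow> L2_on {0<..<pi} f \<Longrightarrow> L2_on Iper f"
  by (rule L2_on_null_diff[OF L2_on_Un Iper_null]) auto

lemma Iper_split:
  fixes f :: "real \<Rightarrow> 'a :: {banach, second_countable_topology}"
  assumes "set_integrable lborel Iper f"
  shows "(LINT x:Iper|lborel. f x) = (LINT x:{-pi<..<0}|lborel. f x) + (LINT x:{0<..<pi}|lborel. f x)"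
  using set_integral_split[of "-pi" pi f 0] assms by (simp add: set_integrable_Icc_Ioo set_integral_Icc_Ioo)

lemma coeffA_eq:
  assumes z: "z \<in> Iper"
  shows "coeffA v z = complex_of_real (\<bar>z\<bar> * (pi - \<bar>z\<bar>) / 2) * v z"
proof -
  have "\<lfloor>(z + pi) / (2 * pi)\<rfloor> = 0" using z by (simp add: floor_eq_iff)
  then have "U_star z = (1 / sqrt 2) * (\<bar>z\<bar> - pi / 2)" by (simp add: U_star_def)
  then have "c_star - (U_star z)\<^sup>2 = \<bar>z\<bar> * (pi - \<bar>z\<bar>) / 2"
    by (simp add: c_star_def power_mult_distrib power_divide) (simp add: power2_eq_square field_simps)
  then show ?thesis unfolding coeffA_def by (simp only:)
qed

lemma hb_left: "z \<in> {-pi..0} \<Longrightarrow> hb (-pi) z = \<bar>z\<bar> * (pi - \<bar>z\<bar>) / 2"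
  and hb_right: "z \<in> {0..pi} \<Longrightarrow> hb 0 z = \<bar>z\<bar> * (pi - \<bar>z\<bar>) / 2"
  by (auto simp: hb_def algebra_simps)

lemma L2_on_coeffA: "L2_on Iper v \<Longrightarrow> L2_on Iper (coeffA v)"
  by (rule L2_on_ident[OF L2_on_continuous_mult[where l="-pi" and m=pi
        and g="\<lambda>z. complex_of_real (\<bar>z\<bar> * (pi - \<bar>z\<bar>) / 2)"]])
    (auto simp: coeffA_eq intro!: continuous_intros)

lemma antideriv_abs_cont:
  assumes v: "L2_on Iper v"
  shows "abs_cont_on {-pi..pi} (antideriv v) v"
proof -
  define c where "c = - (complex_of_real (1 / (2 * pi)) * (LINT s:Iper|lborel. (LINT t:{-pi..s}|lborel. v t)))"
  have "antideriv v = (\<lambda>z. c + (LINT t:{-pi..z}|lborel. v t))"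
    by (rule ext) (simp add: antideriv_def c_def)
  then show ?thesis
    using abs_cont_on_primitive[of "-pi" pi v c] Iper_integrable[OF v] by (simp add: set_integrable_Icc_Ioo)
qed

lemma antideriv_periodic:
  assumes "v \<in> L2dot"
  shows "antideriv v pi = antideriv v (-pi)"
  using abs_cont_onD(2)[OF antideriv_abs_cont, of v "-pi" pi] assms
  by (simp add: L2dot_iff set_integral_Icc_Ioo)

lemma antideriv_eq:
  assumes u: "abs_cont_on {-pi..pi} u v" and z: "z \<in> {-pi..pi}" and u0: "(LINT x:Iper|lborel. u x) = 0"
  shows "antideriv v z = u z"
proof -
  have e: "(LINT t:{-pi..s}|lborel. v t) = u s - u (-pi)" if "s \<in> {-pi..pi}" for s
    by (rule abs_cont_onD(2)[OF u]) (use that in auto)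
  have ui: "set_integrable lborel Iper u"
    using borel_integrable_atLeastAtMost'[OF abs_cont_on_continuous[OF u]] by (simp add: set_integrable_Icc_Ioo)
  have ci: "set_integrable lborel Iper (\<lambda>s. u (-pi))"
    using borel_integrable_atLeastAtMost'[of "-pi" pi "\<lambda>s. u (-pi)"] by (simp add: set_integrable_Icc_Ioo)
  have "(LINT s:Iper|lborel. (LINT t:{-pi..s}|lborel. v t)) = (LINT s:Iper|lborel. u s - u (-pi))"
    by (rule set_lebesgue_integral_cong) (use e in auto)
  also have "\<dots> = - (LINT s:Iper|lborel. u (-pi))" using set_integral_diff(2)[OF ui ci] u0 by simp
  also have "(LINT s:Iper|lborel. u (-pi)) = complex_of_real (2 * pi) * u (-pi)"
    by (simp add: set_lebesgue_integral_def scaleR_conv_of_real)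
  finally show ?thesis unfolding antideriv_def e[OF z] by simp
qed

text \<open>\<open>vt\<close> is the absolutely continuous version of \<open>coeffA v\<close>
  divided by the coefficient. Thus \<open>hb vt\<close> is absolutely continuous at every point of
  the open half periods, not merely after changes on a null set, and \<open>g\<close> is the very
  derivative that \<open>opA\<close> selects.\<close>

lemma domA_representative:
  assumes v: "v \<in> domA"
  obtains g vt where "g \<in> L2dot" "distr_deriv (coeffA v) g" "opA v = (\<lambda>z. g z + antideriv v z)"
    "AE z in lborel. z \<in> Iper \<longrightarrow> v z = vt z" "L2_on Iper vt"
    "\<forall>l\<in>{-pi, 0}. abs_cont_on {l<..<l + pi} (\<lambda>z. complex_of_real (hb l z) * vt z) g"
proof -
  define g where "g = (SOME g. g \<in> L2dot \<and> distr_deriv (coeffA v) g)"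
  have vL: "L2_on Iper v" using v by (simp add: domA_def L2dot_iff)
  have "\<exists>g. g \<in> L2dot \<and> distr_deriv (coeffA v) g" using v unfolding domA_def by blast
  from someI_ex[OF this] have g: "g \<in> L2dot" "distr_deriv (coeffA v) g" unfolding g_def by blast+
  have gi: "set_integrable lborel Iper g" using g(1) by (intro Iper_integrable) (simp add: L2dot_iff)
  obtain c where c: "AE x in lborel. x \<in> Iper \<longrightarrow> coeffA v x = c + (LINT t:{-pi..x}|lborel. g t)"
    using distr_deriv_imp_abs_cont[OF g(2) Iper_integrable[OF L2_on_coeffA[OF vL]] gi] by blast
  define w where "w z = c + (LINT t:{-pi..z}|lborel. g t)" for z
  have w: "abs_cont_on {-pi..pi} w g" unfolding w_def
    by (rule abs_cont_on_primitive) (use gi in \<open>simp add: set_integrable_Icc_Ioo\<close>)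
  define vt where "vt z = w z / complex_of_real (\<bar>z\<bar> * (pi - \<bar>z\<bar>) / 2)" for z
  have ae: "AE z in lborel. z \<in> Iper \<longrightarrow> v z = vt z"
    \<comment> \<open>The coefficient vanishes at 0, where dividing by it gives no information about
      \<open>v\<close>.\<close>
    using c AE_lborel_singleton[of 0]
  proof eventually_elim
    case (elim z)
    show ?case
    proof
      assume z: "z \<in> Iper"
      then have "complex_of_real (\<bar>z\<bar> * (pi - \<bar>z\<bar>) / 2) \<noteq> 0" using elim(2) by (auto simp del: of_real_mult of_real_divide)
      moreover have "complex_of_real (\<bar>z\<bar> * (pi - \<bar>z\<bar>) / 2) * v z = w z"
        using elim(1) z coeffA_eq[OF z, of v] by (simp add: w_def)
      ultimately show "v z = vt z" unfolding vt_def by (simp add: nonzero_eq_divide_eq mult.commute)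
    qed
  qed
  have J: "abs_cont_on {l<..<l + pi} (\<lambda>z. complex_of_real (hb l z) * vt z) g"
    and Jm: "set_borel_measurable lborel {l<..<l + pi} vt" if l: "l \<in> {-pi, 0}" for l
  proof -
    have hbl: "hb l z = \<bar>z\<bar> * (pi - \<bar>z\<bar>) / 2" if "z \<in> {l<..<l + pi}" for z
      using l that hb_left[of z] hb_right[of z] by auto
    have wJ: "abs_cont_on {l<..<l + pi} w g"
      by (rule abs_cont_on_subset[OF w]) (use l in \<open>auto simp: is_interval_oo\<close>)
    show "abs_cont_on {l<..<l + pi} (\<lambda>z. complex_of_real (hb l z) * vt z) g"
    proof (rule abs_cont_on_ident[OF wJ])
      fix z assume z: "z \<in> {l<..<l + pi}"
      show "w z = complex_of_real (hb l z) * vt z"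
        unfolding vt_def hbl[OF z, symmetric] using hb_pos[OF z] by simp
    qed simp
    have "continuous_on {l<..<l + pi} (\<lambda>z. w z * (1 / complex_of_real (hb l z)))"
      by (intro continuous_on_mult abs_cont_on_continuous[OF wJ] abs_cont_on_continuous[OF inverse_hb_abs_cont])
    then have "set_borel_measurable lborel {l<..<l + pi} (\<lambda>z. w z * (1 / complex_of_real (hb l z)))"
      by (rule set_borel_measurable_continuous_on) simp
    then show "set_borel_measurable lborel {l<..<l + pi} vt"
      by (rule set_borel_measurable_ident) (simp add: vt_def hbl)
  qed
  have L: "L2_on {l<..<l + pi} vt" if l: "l \<in> {-pi, 0}" for l
  proof (rule L2_on_cong_ae[OF L2_on_subset[OF vL] Jm[OF l]])
    have sub: "{l<..<l + pi} \<subseteq> Iper" using l by auto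
    then show "{l<..<l + pi} \<subseteq> Iper" .
    show "AE z in lborel. z \<in> {l<..<l + pi} \<longrightarrow> v z = vt z"
      using ae by eventually_elim (use sub in auto)
  qed auto
  have "L2_on Iper vt" using L[of "-pi"] L[of 0] by (intro L2_on_Iper) auto
  moreover have "opA v = (\<lambda>z. g z + antideriv v z)" by (rule ext) (simp add: opA_def g_def)
  ultimately show thesis using that[OF g] ae J by blast
qed

lemma abs_cont_on_antideriv_representative:
  assumes "L2_on Iper v" "L2_on Iper vt" "AE z in lborel. z \<in> Iper \<longrightarrow> v z = vt z"
  shows "abs_cont_on {-pi..pi} (antideriv v) vt"
proof (rule abs_cont_on_cong[OF antideriv_abs_cont[OF assms(1)] refl])
  have "L2_on ({-pi..<pi}) vt" by (rule L2_on_null_diff[OF assms(2), of _ "-pi"]) auto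
  then have "L2_on {-pi..pi} vt" by (rule L2_on_null_diff[of _ _ _ pi]) auto
  then show "set_borel_measurable lborel {-pi..pi} vt" by (rule L2_on_measurable)
  show "AE x in lborel. x \<in> {-pi..pi} \<longrightarrow> v x = vt x"
    using assms(3) AE_lborel_singleton[of pi] AE_lborel_singleton[of "-pi"]
    by eventually_elim auto
qed

lemma l2norm_cong_ae:
  assumes "set_borel_measurable lborel Iper f" "set_borel_measurable lborel Iper g"
    "AE z in lborel. z \<in> Iper \<longrightarrow> f z = g z"
  shows "l2norm f = l2norm g"
proof -
  have "(LINT x:Iper|lborel. (cmod (f x))\<^sup>2) = (LINT x:Iper|lborel. (cmod (g x))\<^sup>2)"
    by (intro set_integral_cong_ae set_borel_measurable_cmod_square assms(1,2))
      (use assms(3) in \<open>auto elim: eventually_mono\<close>)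
  then show ?thesis by (simp add: l2norm_def)
qed

section \<open>The lower bound outside the strip\<close>

lemma numerical_range:
  assumes v: "v \<in> domA" and mu: "\<bar>Re \<mu>\<bar> > pi / 4"
  shows "(\<bar>Re \<mu>\<bar> - pi / 4) * l2norm v \<le> l2norm (\<lambda>z. opA v z - \<mu> * v z)"
proof -
  define d where "d = \<bar>Re \<mu>\<bar> - pi / 4"
  have d: "d > 0" using mu by (simp add: d_def)
  obtain g vt where g: "g \<in> L2dot" and "distr_deriv (coeffA v) g" and op: "opA v = (\<lambda>z. g z + antideriv v z)"
    and ae: "AE z in lborel. z \<in> Iper \<longrightarrow> v z = vt z" and vt: "L2_on Iper vt"
    and w0: "\<forall>l\<in>{-pi, 0}. abs_cont_on {l<..<l + pi} (\<lambda>z. complex_of_real (hb l z) * vt z) g"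
    by (rule domA_representative[OF v])
  note w = bspec[OF w0]
  have vd: "v \<in> L2dot" using v by (simp add: domA_def)
  then have vL: "L2_on Iper v" by (simp add: L2dot_iff)
  have gL: "L2_on Iper g" using g by (simp add: L2dot_iff)
  define u where "u = antideriv v"
  have u: "abs_cont_on {-pi..pi} u vt" unfolding u_def by (rule abs_cont_on_antideriv_representative[OF vL vt ae])
  have uL: "L2_on Iper u" by (rule L2_on_continuous[OF abs_cont_on_continuous[OF u]]) auto
  define P where "P z = g z + u z - \<mu> * vt z" for z
  have PL: "L2_on Iper P" unfolding P_def by (intro L2_on_diff L2_on_add L2_on_cmult gL uL vt) auto
  have FP: "l2norm (\<lambda>z. opA v z - \<mu> * v z) = l2norm P"
  proof (rule l2norm_cong_ae)
    show "set_borel_measurable lborel Iper (\<lambda>z. opA v z - \<mu> * v z)"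
      unfolding op u_def[symmetric] by (intro L2_on_measurable L2_on_diff L2_on_add L2_on_cmult gL uL vL) auto
    show "AE z in lborel. z \<in> Iper \<longrightarrow> opA v z - \<mu> * v z = P z"
      using ae by eventually_elim (auto simp: op P_def u_def)
  qed (rule L2_on_measurable[OF PL])
  have vv: "l2norm v = l2norm vt" by (rule l2norm_cong_ae[OF L2_on_measurable[OF vL] L2_on_measurable[OF vt] ae])
  define N where "N = (LINT z:Iper|lborel. (cmod (vt z))\<^sup>2)"
  define M where "M = (LINT z:Iper|lborel. (cmod (P z))\<^sup>2)"
  have N0: "N \<ge> 0" "M \<ge> 0" unfolding N_def M_def by (auto intro: set_integral_nonneg_real)
  \<comment> \<open>The derivative of the coefficient, piecewise because it jumps at 0.\<close>
  define \<kappa> where "\<kappa> z = (if z < 0 then - pi / 2 - z else pi / 2 - z)" for z :: real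
  have [measurable]: "\<kappa> \<in> borel_measurable borel" unfolding \<kappa>_def by measurable
  have \<kappa>b: "\<bar>\<kappa> z\<bar> \<le> pi / 2" if "z \<in> Iper" for z using that unfolding \<kappa>_def abs_le_iff by auto
  have \<kappa>L: "L2_on Iper (\<lambda>z. complex_of_real (\<kappa> z) * vt z)"
    by (rule L2_on_bounded_mult[OF vt, of _ "pi / 2"]) (use \<kappa>b in \<open>auto simp: set_borel_measurable_def\<close>)
  have i\<kappa>: "set_integrable lborel Iper (\<lambda>z. complex_of_real (\<kappa> z * (cmod (vt z))\<^sup>2))"
    using L2_on_mult_integrable[OF \<kappa>L L2_on_cnj[OF vt]]
    by (simp only: of_real_mult complex_norm_square mult.assoc) simp
  define Y where "Y z = g z * cnj (vt z) + vt z * cnj (g z) - complex_of_real (\<kappa> z * (cmod (vt z))\<^sup>2)" for z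
  have Yi: "set_integrable lborel Iper Y" unfolding Y_def
    by (intro set_integral_diff(1) set_integral_add(1) L2_on_mult_integrable L2_on_cnj gL vt i\<kappa>) auto
  have Y0: "(LINT z:Iper|lborel. Y z) = 0"
  proof -
    have "(LINT z:{-pi<..<0}|lborel. Y z) = (LINT z:{-pi<..<-pi+pi}|lborel. g z * cnj (vt z) + vt z * cnj (g z)
      - complex_of_real ((-pi + pi / 2 - z) * (cmod (vt z))\<^sup>2))"
      unfolding add.left_inverse by (rule set_lebesgue_integral_cong) (auto simp: Y_def \<kappa>_def)
    also have "\<dots> = 0"
      by (rule half_energy[OF w]) (auto intro: L2_on_subset[OF vt] L2_on_subset[OF gL])
    finally have l: "(LINT z:{-pi<..<0}|lborel. Y z) = 0" .
    have "(LINT z:{0<..<pi}|lborel. Y z) = (LINT z:{0<..<0+pi}|lborel. g z * cnj (vt z) + vt z * cnj (g z)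
      - complex_of_real ((0 + pi / 2 - z) * (cmod (vt z))\<^sup>2))"
      unfolding add_0 by (rule set_lebesgue_integral_cong) (auto simp: Y_def \<kappa>_def)
    also have "\<dots> = 0"
      by (rule half_energy[OF w]) (auto intro: L2_on_subset[OF vt] L2_on_subset[OF gL])
    finally have r: "(LINT z:{0<..<pi}|lborel. Y z) = 0" .
    show ?thesis using Iper_split[OF Yi] l r by simp
  qed
  define X where "X z = P z * cnj (vt z) + vt z * cnj (P z)" for z
  have Xi: "set_integrable lborel Iper X" unfolding X_def
    by (intro set_integral_add(1) L2_on_mult_integrable L2_on_cnj PL vt) auto
  define T where "T z = vt z * cnj (u z) + u z * cnj (vt z)" for z
  have Ti: "set_integrable lborel Iper T" unfolding T_def
    by (intro set_integral_add(1) L2_on_mult_integrable L2_on_cnj uL vt) auto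
  \<comment> \<open>Skew-adjointness of the antiderivative: \<open>T\<close> is the derivative of
    \<open>|u|^2\<close>, and \<open>u\<close> is periodic because \<open>v\<close> has zero
    mean.\<close>
  have "abs_cont_on {-pi..pi} (\<lambda>z. u z * cnj (u z)) T"
    unfolding T_def by (rule abs_cont_on_mult[OF u abs_cont_on_cnj[OF u]])
  from abs_cont_onD(2)[OF this, of "-pi" pi] have T0: "(LINT z:Iper|lborel. T z) = 0"
    using antideriv_periodic[OF vd] by (simp add: set_integral_Icc_Ioo u_def)
  define Z where "Z z = complex_of_real (\<kappa> z * (cmod (vt z))\<^sup>2) - X z" for z
  have Zi: "set_integrable lborel Iper Z" unfolding Z_def by (intro set_integral_diff(1) i\<kappa> Xi)
  \<comment> \<open>Pointwise form of twice the real part of the pairing with \<open>vt\<close>: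
    \<open>Y\<close> holds the exact energy derivative, \<open>T\<close> the antiderivative term,
    both of integral 0, and \<open>Z\<close> everything that has to be estimated.\<close>
  have Zeq: "complex_of_real (2 * Re \<mu> * (cmod (vt z))\<^sup>2) = (Y z + T z) + Z z" for z
  proof -
    have "complex_of_real (2 * Re \<mu> * (cmod (vt z))\<^sup>2) = (\<mu> + cnj \<mu>) * (vt z * cnj (vt z))"
      by (simp only: of_real_mult complex_norm_square complex_add_cnj)
    also have "\<dots> = (Y z + T z) + Z z"
      by (simp add: Y_def T_def Z_def X_def P_def algebra_simps)
    finally show ?thesis .
  qed
  have "complex_of_real (2 * Re \<mu> * N) = (LINT z:Iper|lborel. complex_of_real (2 * Re \<mu> * (cmod (vt z))\<^sup>2))"
    unfolding set_integral_complex_of_real N_def by simp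
  also have "\<dots> = (LINT z:Iper|lborel. Y z + T z) + (LINT z:Iper|lborel. Z z)"
    unfolding Zeq by (intro set_integral_add(2) set_integral_add(1) Yi Ti Zi)
  also have "(LINT z:Iper|lborel. Y z + T z) = 0" using set_integral_add(2)[OF Yi Ti] Y0 T0 by simp
  finally have ZN: "(LINT z:Iper|lborel. Z z) = complex_of_real (2 * Re \<mu> * N)" by simp
  \<comment> \<open>\<open>d\<close> serves as the weight in Young's inequality: as
    \<open>2 |Re \<mu>| = pi / 2 + 2 d\<close>, moving \<open>pi / 2 + d\<close> to the left leaves
    \<open>d N <= M / d\<close>.\<close>
  have i1: "set_integrable lborel Iper (\<lambda>z. (pi / 2 + d) * (cmod (vt z))\<^sup>2)"
    and i2: "set_integrable lborel Iper (\<lambda>z. (cmod (P z))\<^sup>2 / d)"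
    using L2_on_square[OF vt] L2_on_square[OF PL] by auto
  have "2 * \<bar>Re \<mu>\<bar> * N = cmod (LINT z:Iper|lborel. Z z)"
    unfolding ZN norm_of_real using N0 by (simp add: abs_mult)
  also have "\<dots> \<le> (LINT z:Iper|lborel. cmod (Z z))" by (rule set_integral_norm_bound[OF Zi])
  also have "\<dots> \<le> (LINT z:Iper|lborel. (pi / 2 + d) * (cmod (vt z))\<^sup>2 + (cmod (P z))\<^sup>2 / d)"
  proof (rule set_integral_mono)
    show "set_integrable lborel Iper (\<lambda>z. cmod (Z z))" by (rule set_integrable_norm[OF Zi])
    show "set_integrable lborel Iper (\<lambda>z. (pi / 2 + d) * (cmod (vt z))\<^sup>2 + (cmod (P z))\<^sup>2 / d)"
      by (intro set_integral_add(1) i1 i2)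
    fix z assume z: "z \<in> Iper"
    have "cmod (Z z) \<le> \<bar>\<kappa> z\<bar> * (cmod (vt z))\<^sup>2 + (cmod (P z) * cmod (vt z) + cmod (vt z) * cmod (P z))"
    proof -
      have "cmod (Z z) \<le> cmod (complex_of_real (\<kappa> z * (cmod (vt z))\<^sup>2)) + cmod (X z)"
        unfolding Z_def by (rule norm_triangle_ineq4)
      moreover have "cmod (X z) \<le> cmod (P z) * cmod (vt z) + cmod (vt z) * cmod (P z)"
        unfolding X_def by (rule order_trans[OF norm_triangle_ineq]) (simp add: norm_mult)
      moreover have "cmod (complex_of_real (\<kappa> z * (cmod (vt z))\<^sup>2)) = \<bar>\<kappa> z\<bar> * (cmod (vt z))\<^sup>2"
        unfolding norm_of_real abs_mult by simp
      ultimately show ?thesis by linarith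
    qed
    moreover have "\<bar>\<kappa> z\<bar> * (cmod (vt z))\<^sup>2 \<le> pi / 2 * (cmod (vt z))\<^sup>2"
      by (rule mult_right_mono[OF \<kappa>b[OF z]]) simp
    moreover have "cmod (P z) * cmod (vt z) + cmod (vt z) * cmod (P z) \<le> d * (cmod (vt z))\<^sup>2 + (cmod (P z))\<^sup>2 / d"
    proof -
      have "0 \<le> (cmod (P z) - d * cmod (vt z))\<^sup>2 / d" using d by simp
      also have "\<dots> = (cmod (P z))\<^sup>2 / d - 2 * (cmod (P z) * cmod (vt z)) + d * (cmod (vt z))\<^sup>2"
        using d by (simp add: power2_eq_square field_simps)
      finally show ?thesis by (simp add: mult.commute)
    qed
    ultimately show "cmod (Z z) \<le> (pi / 2 + d) * (cmod (vt z))\<^sup>2 + (cmod (P z))\<^sup>2 / d"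
      unfolding distrib_right by linarith
  qed
  also have "\<dots> = (pi / 2 + d) * N + M / d"
    using set_integral_add(2)[OF i1 i2] unfolding N_def M_def by simp
  finally have "2 * \<bar>Re \<mu>\<bar> * N \<le> (pi / 2 + d) * N + M / d" .
  then have "d * N \<le> M / d" unfolding d_def by (simp add: algebra_simps)
  then have "d\<^sup>2 * N \<le> M" using d by (simp add: pos_le_divide_eq power2_eq_square mult_ac)
  then have "sqrt (d\<^sup>2 * N) \<le> sqrt M" by simp
  then have "d * sqrt N \<le> sqrt M" using d by (simp add: real_sqrt_mult)
  then show ?thesis unfolding FP vv unfolding l2norm_def N_def[symmetric] M_def[symmetric] d_def .
qed

section \<open>Gluing the half periods\<close>

text \<open>The derivative may change at the two ends: a function glued by \<open>if z < m\<close>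
  already takes the right-hand derivative at \<open>m\<close>, also when viewed on
  \<open>{l..m}\<close>.\<close>

lemma abs_cont_on_ident_Icc:
  assumes w: "abs_cont_on {l..m} w g" and eq: "\<And>x. x \<in> {l..m} \<Longrightarrow> w x = w' x" "\<And>x. x \<in> {l<..<m} \<Longrightarrow> g x = g' x"
  shows "abs_cont_on {l..m} w' g'"
  unfolding abs_cont_on_def
proof (intro conjI ballI impI)
  fix p q assume pq: "p \<in> {l..m}" "q \<in> {l..m}" "p \<le> q"
  have "set_integrable lborel {p<..<q} g = set_integrable lborel {p<..<q} g'"
    by (rule set_integrable_cong) (use eq(2) pq in auto)
  with abs_cont_onD(1)[OF w pq] show "set_integrable lborel {p..q} g'" by (simp add: set_integrable_Icc_Ioo)
  have "(LINT t:{p<..<q}|lborel. g t) = (LINT t:{p<..<q}|lborel. g' t)"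
    by (rule set_lebesgue_integral_cong) (use eq(2) pq in auto)
  with abs_cont_onD(2)[OF w pq] eq(1) pq show "(LINT t:{p..q}|lborel. g' t) = w' q - w' p"
    unfolding set_integral_Icc_Ioo by simp
qed (simp add: is_interval_cc)

lemma abs_cont_on_glue_if:
  assumes "abs_cont_on {l..m} w g" "abs_cont_on {m..n} w' g'" "w m = w' m" "l \<le> m" "m \<le> n"
  shows "abs_cont_on {l..n} (\<lambda>z. if z < m then w z else w' z) (\<lambda>z. if z < m then g z else g' z)"
proof (rule abs_cont_on_glue[OF _ _ assms(4,5)])
  show "abs_cont_on {l..m} (\<lambda>z. if z < m then w z else w' z) (\<lambda>z. if z < m then g z else g' z)"
    by (rule abs_cont_on_ident_Icc[OF assms(1)]) (use assms(3) in \<open>auto simp: not_less\<close>)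
  show "abs_cont_on {m..n} (\<lambda>z. if z < m then w z else w' z) (\<lambda>z. if z < m then g z else g' z)"
    by (rule abs_cont_on_ident_Icc[OF assms(2)]) auto
qed

text \<open>\<open>hb' + hom = \<mu>\<close>, so the constant \<open>k\<close> and its primitive
  \<open>k hom\<close> solve the homogeneous equation. This is the one free parameter on each half
  period.\<close>

lemma half_sol_add_hom:
  assumes "half_sol l \<mu> f v u"
  shows "half_sol l \<mu> f (\<lambda>z. v z + k) (\<lambda>z. u z + k * hom l \<mu> z)"
  unfolding half_sol_def
proof (intro conjI)
  have v: "L2_on {l<..<l + pi} v" and u: "abs_cont_on {l..l + pi} u v"
    and w: "abs_cont_on {l..l + pi} (\<lambda>z. complex_of_real (hb l z) * v z) (\<lambda>z. f z - u z + \<mu> * v z)"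
    using assms unfolding half_sol_def by auto
  show "L2_on {l<..<l + pi} (\<lambda>z. v z + k)"
    by (intro L2_on_add v L2_on_const[of _ l "l + pi"]) auto
  show "abs_cont_on {l..l + pi} (\<lambda>z. u z + k * hom l \<mu> z) (\<lambda>z. v z + k)"
    using abs_cont_on_add[OF u abs_cont_on_cmult[OF hom_abs_cont, of _ k]] by (simp add: is_interval_cc)
  show "abs_cont_on {l..l + pi} (\<lambda>z. complex_of_real (hb l z) * (v z + k)) (\<lambda>z. f z - (u z + k * hom l \<mu> z) + \<mu> * (v z + k))"
    by (rule abs_cont_on_ident[OF abs_cont_on_add[OF w abs_cont_on_cmult[OF hb_abs_cont, of _ k]]])
      (auto simp: is_interval_cc hom_def algebra_simps)
qed

text \<open>The functions \<open>hb v\<close> fit together by themselves, vanishing at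
  \<open>-pi\<close>, \<open>0\<close> and \<open>pi\<close>; only \<open>u\<close> has to be
  matched, at \<open>0\<close> and across the period, with one parameter available for each
  condition. The zero means of \<open>v\<close> and \<open>g\<close> then express that
  \<open>u\<close> and \<open>hb v\<close> have equal values at \<open>-pi\<close> and
  \<open>pi\<close>.\<close>

lemma surjective_outside:
  assumes f: "f \<in> L2dot" and mu: "\<bar>Re \<mu>\<bar> > pi / 4"
  shows "\<exists>v\<in>domA. ae_eq (\<lambda>z. opA v z - \<mu> * v z) f"
proof -
  have fL: "L2_on Iper f" and f0: "(LINT x:Iper|lborel. f x) = 0" using f by (auto simp: L2dot_iff)
  have "\<mu> \<noteq> 0" using mu by auto
  have "L2_on {-pi<..<-pi + pi} f" "L2_on {0<..<0 + pi} f" by (auto intro: L2_on_subset[OF fL])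
  then obtain v1 u1 v2 u2 where h0: "half_sol (-pi) \<mu> f v1 u1" "half_sol 0 \<mu> f v2 u2"
    using half_sol_exists[OF _ mu] by metis
  define a where "a = \<mu> + complex_of_real (pi / 2)"
  define b where "b = \<mu> - complex_of_real (pi / 2)"
  define s where "s = u2 0 - u1 0"
  define t where "t = u1 (-pi) - u2 pi"
  \<comment> \<open>Cramer's rule: \<open>a\<close> is the value of \<open>hom\<close> at the right
    end of either half period and \<open>b\<close> the value at the left end, so
    \<open>a - b = pi\<close> and \<open>a + b = 2 \<mu>\<close>.\<close>
  define \<Delta> where "\<Delta> = a * a - b * b"
  have "\<Delta> = 2 * complex_of_real pi * \<mu>" by (simp add: \<Delta>_def a_def b_def algebra_simps)
  then have \<Delta>: "\<Delta> \<noteq> 0" using \<open>\<mu> \<noteq> 0\<close> by simp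
  define k1 where "k1 = (a * s + b * t) / \<Delta>"
  define k2 where "k2 = (a * t + b * s) / \<Delta>"
  have k: "k1 * a - k2 * b = s" "k2 * a - k1 * b = t"
  proof -
    have "k1 * a - k2 * b = s * \<Delta> / \<Delta>" unfolding k1_def k2_def \<Delta>_def by (simp add: algebra_simps diff_divide_distrib add_divide_distrib)
    then show "k1 * a - k2 * b = s" using \<Delta> by simp
    have "k2 * a - k1 * b = t * \<Delta> / \<Delta>" unfolding k1_def k2_def \<Delta>_def by (simp add: algebra_simps diff_divide_distrib add_divide_distrib)
    then show "k2 * a - k1 * b = t" using \<Delta> by simp
  qed
  define vm where "vm z = v1 z + k1" for z
  define um where "um z = u1 z + k1 * hom (-pi) \<mu> z" for z
  define vp where "vp z = v2 z + k2" for z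
  define up where "up z = u2 z + k2 * hom 0 \<mu> z" for z
  have "half_sol (-pi) \<mu> f vm um" "half_sol 0 \<mu> f vp up"
    unfolding vm_def um_def vp_def up_def by (intro half_sol_add_hom h0)+
  then have vm: "L2_on {-pi<..<0} vm" and um: "abs_cont_on {-pi..0} um vm"
    and wm: "abs_cont_on {-pi..0} (\<lambda>z. complex_of_real (hb (-pi) z) * vm z) (\<lambda>z. f z - um z + \<mu> * vm z)"
    and vp: "L2_on {0<..<pi} vp" and up: "abs_cont_on {0..pi} up vp"
    and wp: "abs_cont_on {0..pi} (\<lambda>z. complex_of_real (hb 0 z) * vp z) (\<lambda>z. f z - up z + \<mu> * vp z)"
    unfolding half_sol_def by auto
  have hv: "hom (-pi) \<mu> 0 = a" "hom 0 \<mu> 0 = b" "hom (-pi) \<mu> (-pi) = b" "hom 0 \<mu> pi = a"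
    by (simp_all add: hom_def a_def b_def)
  have m0: "um 0 = up 0" and mpi: "up pi = um (-pi)"
    using k by (simp_all add: um_def up_def hv s_def t_def algebra_simps)
  define v where "v z = (if z < 0 then vm z else vp z)" for z
  define u where "u z = (if z < 0 then um z else up z)" for z
  define w where "w z = (if z < 0 then complex_of_real (hb (-pi) z) * vm z else complex_of_real (hb 0 z) * vp z)" for z
  define g where "g z = f z - u z + \<mu> * v z" for z
  have u: "abs_cont_on {-pi..pi} u v" unfolding u_def v_def
    by (rule abs_cont_on_glue_if[OF um up m0]) auto
  have "abs_cont_on {-pi..pi} w (\<lambda>z. if z < 0 then f z - um z + \<mu> * vm z else f z - up z + \<mu> * vp z)"
    unfolding w_def by (rule abs_cont_on_glue_if[OF wm wp]) (use hb_ends(2)[of "-pi"] hb_ends(1)[of 0] in auto)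
  then have w: "abs_cont_on {-pi..pi} w g"
    by (rule abs_cont_on_ident) (auto simp: g_def u_def v_def)
  have vL: "L2_on Iper v"
    by (rule L2_on_Iper) (auto simp: v_def intro!: L2_on_ident[OF vm] L2_on_ident[OF vp])
  have uL: "L2_on Iper u" by (rule L2_on_continuous[OF abs_cont_on_continuous[OF u]]) auto
  have gL: "L2_on Iper g" unfolding g_def by (intro L2_on_add L2_on_diff L2_on_cmult fL uL vL) auto
  have v0: "(LINT x:Iper|lborel. v x) = 0"
    using abs_cont_onD(2)[OF u, of "-pi" pi] mpi by (simp add: set_integral_Icc_Ioo u_def)
  have g0: "(LINT x:Iper|lborel. g x) = 0"
    using abs_cont_onD(2)[OF w, of "-pi" pi] hb_ends(1)[of "-pi"] hb_ends(2)[of 0] by (simp add: set_integral_Icc_Ioo w_def)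
  \<comment> \<open>No constant is left to adjust the mean of \<open>u\<close>; it is 0 by
    integrating the equation, in which all other terms have zero mean. Hence \<open>u\<close> is the
    antiderivative used by \<open>opA\<close>.\<close>
  have u0: "(LINT x:Iper|lborel. u x) = 0"
  proof -
    note i = Iper_integrable[OF fL] Iper_integrable[OF uL] Iper_integrable[OF L2_on_cmult[OF vL, of \<mu>]]
    have "(LINT x:Iper|lborel. g x) = (LINT x:Iper|lborel. f x - u x) + (LINT x:Iper|lborel. \<mu> * v x)"
      unfolding g_def by (intro set_integral_add(2) set_integral_diff(1) i) simp
    also have "(LINT x:Iper|lborel. f x - u x) = (LINT x:Iper|lborel. f x) - (LINT x:Iper|lborel. u x)"
      by (intro set_integral_diff(2) i)
    finally show ?thesis using g0 f0 v0 by simp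
  qed
  have dd: "distr_deriv (coeffA v) g"
  proof (rule abs_cont_on_imp_distr_deriv[OF w L2_on_measurable[OF L2_on_coeffA[OF vL]]])
    have "coeffA v x = w x" if "x \<in> Iper" for x
    proof -
      have "\<bar>x\<bar> * (pi - \<bar>x\<bar>) / 2 = (if x < 0 then hb (-pi) x else hb 0 x)"
        using that hb_left[of x] hb_right[of x] by auto
      then show ?thesis unfolding coeffA_eq[OF that] w_def v_def by (cases "x < 0") (simp_all only: if_True if_False simp_thms)
    qed
    then show "AE x in lborel. x \<in> Iper \<longrightarrow> coeffA v x = w x" by simp
  qed
  have vD: "v \<in> domA"
    unfolding domA_def using dd gL g0 vL v0 by (auto simp: L2dot_iff)
  obtain g' where g': "g' \<in> L2dot" "distr_deriv (coeffA v) g'" and op: "opA v = (\<lambda>z. g' z + antideriv v z)"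
    by (rule domA_representative[OF vD])
  have g'i: "set_integrable lborel Iper g'" using g'(1) by (intro Iper_integrable) (simp add: L2dot_iff)
  have "AE x in lborel. x \<in> Iper \<longrightarrow> g' x = g x"
    by (rule distr_deriv_unique[OF g'(2) dd Iper_integrable[OF L2_on_coeffA[OF vL]] g'i Iper_integrable[OF gL]])
  then have "ae_eq (\<lambda>z. opA v z - \<mu> * v z) f"
    unfolding ae_eq_def
  proof eventually_elim
    case (elim z)
    show ?case
    proof
      assume z: "z \<in> Iper"
      have "antideriv v z = u z" by (rule antideriv_eq[OF u _ u0]) (use z in auto)
      with elim z show "opA v z - \<mu> * v z = f z" by (simp add: op g_def)
    qed
  qed
  with vD show ?thesis by blast
qed

lemma l2norm_zero_iff:
  assumes v: "L2_on Iper v" and z: "l2norm v = 0"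
  shows "ae_eq v (\<lambda>_. 0)"
proof -
  have "(LINT x:Iper|lborel. (cmod (v x))\<^sup>2) = 0" using z by (simp add: l2norm_def)
  then have "AE x in lborel. indicat_real Iper x *\<^sub>R (cmod (v x))\<^sup>2 = 0"
    unfolding set_lebesgue_integral_def
    by (subst (asm) integral_nonneg_eq_0_iff_AE) (use L2_on_square[OF v] in \<open>auto simp: set_integrable_def\<close>)
  then show ?thesis unfolding ae_eq_def by eventually_elim (auto simp: indicator_def split: if_splits)
qed

lemma resolvent_outside:
  assumes mu: "\<bar>Re \<mu>\<bar> > pi / 4"
  shows "\<mu> \<in> resolventA"
  unfolding resolventA_def mem_Collect_eq
proof (intro conjI ballI impI)
  define d where "d = \<bar>Re \<mu>\<bar> - pi / 4"
  have d: "d > 0" using mu by (simp add: d_def)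
  note nr = numerical_range[OF _ mu, folded d_def]
  show "\<exists>C. \<forall>v\<in>domA. l2norm v \<le> C * l2norm (\<lambda>z. opA v z - \<mu> * v z)"
    using nr d by (intro exI[of _ "1 / d"]) (auto simp: pos_le_divide_eq mult.commute)
  fix v assume v: "v \<in> domA" and z: "ae_eq (\<lambda>z. opA v z - \<mu> * v z) (\<lambda>_. 0)"
  have "AE x in lborel. indicat_real Iper x *\<^sub>R (cmod (opA v x - \<mu> * v x))\<^sup>2 = 0"
    using z unfolding ae_eq_def by eventually_elim (auto simp: indicator_def)
  then have "l2norm (\<lambda>z. opA v z - \<mu> * v z) = 0"
    unfolding l2norm_def set_lebesgue_integral_def by (simp add: integral_eq_zero_AE)
  with nr[OF v] d have "l2norm v \<le> 0" by (simp add: mult_le_0_iff)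
  moreover have "0 \<le> l2norm v" unfolding l2norm_def by (intro real_sqrt_ge_zero set_integral_nonneg_real) simp
  ultimately show "ae_eq v (\<lambda>_. 0)"
    using v by (intro l2norm_zero_iff) (auto simp: domA_def L2dot_iff)
qed (rule surjective_outside[OF _ mu])

section \<open>The strip belongs to the spectrum\<close>

text \<open>Surjectivity fails for a right-hand side whose part in \<open>(0, pi)\<close> pairs with
  \<open>hom / En\<close> to a strictly positive number, contradicting
  \<open>strip_obstruction\<close>.\<close>

lemma strip_not_resolvent:
  assumes mu: "\<bar>Re \<mu>\<bar> \<le> pi / 4"
  shows "\<mu> \<notin> resolventA"
proof
  assume res: "\<mu> \<in> resolventA"
  \<comment> \<open>The conjugate of \<open>hom\<close> times \<open>En\<close> turns the
    obstruction integrand into \<open>|hom|^2\<close>.\<close>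
  define k where "k z = cnj (hom 0 \<mu> z) * En 0 \<mu> z" for z
  \<comment> \<open>The support \<open>{1..2}\<close> lies inside \<open>(0, pi)\<close> and
    contains the midpoint, as the obstruction requires.\<close>
  have p2: "1 \<le> pi / 2" "pi / 2 \<le> 2" "2 < pi" using pi_gt3 pi_less_4 by auto
  have kc: "continuous_on {1..2} k" unfolding k_def
    by (intro continuous_intros continuous_on_hom continuous_on_En) (use p2 in auto)
  define c where "c = (LINT z:{1..2}|lborel. k z)"
  \<comment> \<open>The constant on \<open>(-pi, 0)\<close> only restores zero mean; the obstruction
    is local to the other half period.\<close>
  define f where "f z = (if z < 0 then - c / pi else if z \<in> {1..2} then k z else 0)" for z
  have f2: "(LINT z:{0<..<pi}|lborel. f z) = c"
    unfolding c_def set_lebesgue_integral_def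
    by (rule Bochner_Integration.integral_cong) (use p2 in \<open>auto simp: f_def indicator_def\<close>)
  have f1: "(LINT z:{-pi<..<0}|lborel. f z) = - c"
  proof -
    have "(LINT z:{-pi<..<0}|lborel. f z) = (LINT z:{-pi<..<0}|lborel. - c / pi)"
      by (rule set_lebesgue_integral_cong) (auto simp: f_def)
    then show ?thesis by (simp add: set_lebesgue_integral_def scaleR_conv_of_real)
  qed
  have fL1: "L2_on {-pi<..<0} f"
    by (rule L2_on_ident[OF L2_on_const[of "{-pi<..<0}" "-pi" 0 "- c / pi"]]) (auto simp: f_def)
  have fL2: "L2_on {0<..<pi} f"
  proof -
    have 1: "L2_on ({0<..<1} \<union> {2<..<pi}) f"
      by (rule L2_on_ident[OF L2_on_const[of "{0<..<1} \<union> {2<..<pi}" 0 pi 0]]) (use p2 in \<open>auto simp: f_def\<close>)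
    have 2: "L2_on {1..2} f"
      by (rule L2_on_ident[OF L2_on_continuous[OF kc]]) (auto simp: f_def)
    have "L2_on (({0<..<1} \<union> {2<..<pi}) \<union> {1..2}) f" by (rule L2_on_Un[OF 1 2]) auto
    then show ?thesis by (rule L2_on_subset) auto
  qed
  have fL: "L2_on Iper f" by (rule L2_on_Iper[OF fL1 fL2])
  have "(LINT z:Iper|lborel. f z) = 0" using Iper_split[OF Iper_integrable[OF fL]] f1 f2 by simp
  with fL have "f \<in> L2dot" by (simp add: L2dot_iff)
  with res obtain v where v: "v \<in> domA" and e: "ae_eq (\<lambda>z. opA v z - \<mu> * v z) f"
    unfolding resolventA_def by blast
  obtain g vt where g: "g \<in> L2dot" and "distr_deriv (coeffA v) g" and op: "opA v = (\<lambda>z. g z + antideriv v z)"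
    and ae: "AE z in lborel. z \<in> Iper \<longrightarrow> v z = vt z" and vt: "L2_on Iper vt"
    and w0: "\<forall>l\<in>{-pi, 0}. abs_cont_on {l<..<l + pi} (\<lambda>z. complex_of_real (hb l z) * vt z) g"
    by (rule domA_representative[OF v])
  note w = bspec[OF w0]
  have vL: "L2_on Iper v" using v by (simp add: domA_def L2dot_iff)
  have u: "abs_cont_on {-pi..pi} (antideriv v) vt" by (rule abs_cont_on_antideriv_representative[OF vL vt ae])
  have "(LINT z:{1..2}|lborel. hom 0 \<mu> z * f z * En 0 (- \<mu>) z) = 0"
  proof (rule strip_obstruction[OF w])
    show "abs_cont_on {0..0 + pi} (antideriv v) vt"
      by (rule abs_cont_on_subset[OF u]) (auto simp: is_interval_cc)
    show "set_borel_measurable lborel {0<..<0 + pi} f" using L2_on_measurable[OF fL2] by simp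
    show "L2_on {0<..<0 + pi} vt" by (rule L2_on_subset[OF vt]) auto
    show "AE z in lborel. z \<in> {0<..<0 + pi} \<longrightarrow> g z + antideriv v z - \<mu> * vt z = f z"
      using ae e[unfolded ae_eq_def] by eventually_elim (auto simp: op)
  qed (use mu p2 in \<open>auto simp: f_def\<close>)
  also have "(LINT z:{1..2}|lborel. hom 0 \<mu> z * f z * En 0 (- \<mu>) z) = (LINT z:{1..2}|lborel. complex_of_real ((cmod (hom 0 \<mu> z))\<^sup>2))"
  proof (rule set_lebesgue_integral_cong)
    show "\<forall>z. z \<in> {1..2} \<longrightarrow> hom 0 \<mu> z * f z * En 0 (- \<mu>) z = complex_of_real ((cmod (hom 0 \<mu> z))\<^sup>2)"
    proof (intro allI impI)
      fix z :: real assume "z \<in> {1..2}"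
      then have "hom 0 \<mu> z * f z * En 0 (- \<mu>) z = hom 0 \<mu> z * cnj (hom 0 \<mu> z) * (En 0 \<mu> z * En 0 (- \<mu>) z)"
        by (simp add: f_def k_def mult_ac)
      then show "hom 0 \<mu> z * f z * En 0 (- \<mu>) z = complex_of_real ((cmod (hom 0 \<mu> z))\<^sup>2)"
        unfolding En_uminus complex_norm_square by simp
    qed
  qed simp
  finally have zero: "(LINT z:{1..2}|lborel. (cmod (hom 0 \<mu> z))\<^sup>2) = 0"
    unfolding set_integral_complex_of_real by simp
  define s where "s = pi / 2 - Re \<mu>"
  have "(LINT z:{1..2}|lborel. (z - s)\<^sup>2) = (2 - s) ^ 3 / 3 - (1 - s) ^ 3 / 3"
    unfolding set_lebesgue_integral_def
  proof (rule integral_FTC_atLeastAtMost)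
    fix x :: real
    show "((\<lambda>z. (z - s) ^ 3 / 3) has_vector_derivative (x - s)\<^sup>2) (at x within {1..2})"
      unfolding has_real_derivative_iff_has_vector_derivative[symmetric]
      by (auto intro!: derivative_eq_intros)
  qed (auto intro!: continuous_intros)
  also have "\<dots> = (s - 3 / 2)\<^sup>2 + 1 / 12"
    by (simp add: power2_eq_square power3_eq_cube field_simps)
  \<comment> \<open>\<open>z - s\<close> is the real part of \<open>hom\<close>; the term
    \<open>1 / 12\<close>, the variance of a uniform variable on an interval of length 1, keeps the
    integral positive whatever \<open>s\<close> is.\<close>
  finally have "(LINT z:{1..2}|lborel. (z - s)\<^sup>2) > 0" by (simp add: add_nonneg_pos)
  also have "(LINT z:{1..2}|lborel. (z - s)\<^sup>2) \<le> (LINT z:{1..2}|lborel. (cmod (hom 0 \<mu> z))\<^sup>2)"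
    by (rule set_integral_mono)
      (auto intro!: borel_integrable_atLeastAtMost' continuous_intros continuous_on_hom simp: cmod_power2 hom_def s_def algebra_simps)
  finally show False using zero by simp
qed

theorem theorem2p3:
  shows "spectrumA = {\<mu>. - pi / 4 \<le> Re \<mu> \<and> Re \<mu> \<le> pi / 4}
         \<and> \<not> spectrumA \<subseteq> {\<mu>. Re \<mu> = 0}"
proof -
  have sp: "\<mu> \<in> spectrumA \<longleftrightarrow> \<bar>Re \<mu>\<bar> \<le> pi / 4" for \<mu>
    using resolvent_outside[of \<mu>] strip_not_resolvent[of \<mu>] unfolding spectrumA_def by force
  have "spectrumA = {\<mu>. - pi / 4 \<le> Re \<mu> \<and> Re \<mu> \<le> pi / 4}"
  proof (rule set_eqI)
    fix \<mu> :: complex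
    show "\<mu> \<in> spectrumA \<longleftrightarrow> \<mu> \<in> {\<mu>. - pi / 4 \<le> Re \<mu> \<and> Re \<mu> \<le> pi / 4}"
      unfolding sp mem_Collect_eq abs_le_iff by linarith
  qed
  \<comment> \<open>A boundary point of the strip serves as a spectral value off the imaginary
    axis.\<close>
  moreover have "complex_of_real (pi / 4) \<in> spectrumA" unfolding sp by simp
  moreover have "complex_of_real (pi / 4) \<notin> {\<mu>. Re \<mu> = 0}" by simp
  ultimately show ?thesis by blast
qed

end
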